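(* Let $d\in\mathbb{N}^{+}\cup\{\infty\}$, $\eta>0$, $h>0$, $r\in(0,1]$, $\alpha\in\mathrm{DC}^{d}$, and suppose that $v(x)=\sum_{\mathbf{k}\in\Gamma_{r}}\widehat{v}_{\mathbf{k}}\,\mathrm{e}^{\mathrm{i}\langle\mathbf{k},x\rangle}\in C^{\omega}(\mathbb{T}^{d}_{h},\mathbb{C})$. Then there exists $\lambda_{0}=\lambda_{0}(\eta,h,r,\alpha,\|v\|_{h})$ such that if $|\lambda|<\lambda_{0}$, then for any $E\in[-2,2]$, with $\rho=\rho(E):=\arccos\big(\frac{E}{2}\big)\bmod\pi$, the following hold: (1) If $\rho\in\mathrm{DC}(\alpha)=\bigcup_{\kappa>0}\mathrm{DC}_{\kappa,\tau}(\alpha)$, where $$\mathrm{DC}_{\kappa,\tau}(\alpha):=\Big\{\rho\in\mathbb{R}:\ \|2\rho-\langle\mathbf{k},\alpha\rangle\|_{\mathbb{T}}>\kappa\prod_{j}\frac{1}{1+\langle j\rangle^{\tau}|\mathbf{k}_j|^{\tau}},\ \forall\,\mathbf{k}\in\mathbb{Z}^{d}_{*}\Big\},$$ then $(\alpha,S_{E,\lambda v})$ is reducible to $\Big(\alpha,\begin{pmatrix}\mathrm{e}^{\mathrm{i}\rho}&0\\0&\mathrm{e}^{-\mathrm{i}\rho}\end{pmatrix}\Big)$. (2) If $2\rho=\langle\mathbf{k},\alpha\rangle\bmod 2\pi$ for some $\mathbf{k}\in\mathbb{Z}^d_*$, then $(\alpha,S_{E,\lambda v})$ is reducible to $(\alpha,A)$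 where $A=\begin{pmatrix}1&0\\0&1\end{pmatrix}$ or $A=\begin{pmatrix}1&\zeta\\0&1\end{pmatrix}$ with $\zeta\neq0$.
   Context: $\mathbb{T}=\mathbb{R}/2\pi\mathbb{Z}$, $\mathbb{T}^d=(\mathbb{R}/2\pi\mathbb{Z})^d$ with $d\in\mathbb{N}^+\cup\{\infty\}$; $2\mathbb{T}^d=(\mathbb{R}/4\pi\mathbb{Z})^d$; $\|\cdot\|_{\mathbb{T}}$ is the distance to zero in $\mathbb{T}$. The index $j$ runs over the coordinates, and $\langle j\rangle=\max\{1,j\}$. The coupling constant $\lambda$ is real. For an integer vector $\mathbf{k}\in\mathbb{Z}^d$ and fixed $\eta>0$, $|\mathbf{k}|_\eta=\sum_j\langle j\rangle^\eta|\mathbf{k}_j|$, and $\mathbb{Z}^d_*=\{\mathbf{k}:0<|\mathbf{k}|_\eta<\infty\}$. $\mathbb{T}^d_h=\{x\in\mathbb{C}^d:\mathrm{Re}\,x_j\in\mathbb{T},\ |\mathrm{Im}\,x_j|<h\langle j\rangle^\eta\}$; $C^\omega(\mathbb{T}^d_h,\mathbb{C})$ is the space of bounded analytic functions on $\mathbb{T}^d_h$ with norm $\|v\|_h=\sum_{\mathbf{k}}|\widehat v_{\mathbf{k}}|\mathrm{e}^{h|\mathbf{k}|_\eta}$, $\widehat v_{\mathbf{k}}$ being the Fourier coefficients. Integer cone: with weights $w_j>0$, $\sum_jw_j=1$, $\Gamma_r=\{\mathbf{k}\in\mathbb{Z}^d_*:\sum_j\langle j\rangle^\eta\mathbf{k}_jw_j\ge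 r|\mathbf{k}|_\eta\}$. For $\gamma\in(0,1)$ and $\tau>1$, $\mathrm{DC}^d_{\gamma,\tau}$ is the set of frequencies $\alpha\in[1,2]^d$ with $\inf_{n\in\mathbb{Z}}|\langle\mathbf{k},\alpha\rangle-n|\ge\gamma\prod_j\frac1{1+\langle j\rangle^\tau|\mathbf{k}_j|^\tau}$ for all $\mathbf{k}\in\mathbb{Z}^d_*$; $\mathrm{DC}^d=\bigcup_{\gamma>0}\mathrm{DC}^d_{\gamma,\tau}$. Schrödinger cocycle: $(\alpha,S_{E,\lambda v})$ with $S_{E,\lambda v}(x)=\begin{pmatrix}E-\lambda v(x)&-1\\1&0\end{pmatrix}$. A cocycle $(\alpha,A)$ is reducible to $(\alpha,A')$, with $A'\in\mathrm{SL}(2,\mathbb{C})$ constant, if there is an analytic $B\in C^\omega(2\mathbb{T}^d,\mathrm{SL}(2,\mathbb{C}))$ with $B(x+\alpha)^{-1}A(x)B(x)=A'$.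
   Formalization: DC^d is read modulo 2π, with |⟨k,α⟩−2πn| in place of |⟨k,α⟩−n|; (1) is stated for |E|<2, and E=±2 is treated in (2) with k=0; in (2), writing 2ρ=⟨k,α⟩+2πn with ρ in [0,π], the diagonal entries of A are (−1)^n instead of 1. *)

theory Defs
  imports "HOL-Probability.Probability" "HOL-Complex_Analysis.Complex_Analysis"
begin

section \<open>Coordinates and integer vectors\<close>

text \<open>
  A vector indexed by the coordinates \<open>j = 1, 2, \<dots>\<close>, \<open>j \<le> d\<close> is a function on \<open>nat\<close>; points of
  \<open>\<real>\<^sup>d\<close> and \<open>\<complex>\<^sup>d\<close> are extensional on \<open>coords d\<close>, integer vectors vanish outside \<open>coords d\<close>.
\<close>

definition coords :: "enat \<Rightarrow> nat set" where
  "coords d = {j. 1 \<le> j \<and> enat j \<le> d}"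

definition jb :: "nat \<Rightarrow> real" where
  "jb j = real (max 1 j)"

definition kweight :: "real \<Rightarrow> (nat \<Rightarrow> int) \<Rightarrow> nat \<Rightarrow> real" where
  "kweight \<eta> k j = jb j powr \<eta> * \<bar>real_of_int (k j)\<bar>"

definition kabs :: "enat \<Rightarrow> real \<Rightarrow> (nat \<Rightarrow> int) \<Rightarrow> real" where
  "kabs d \<eta> k = (\<Sum>\<^sub>\<infinity>j\<in>coords d. kweight \<eta> k j)"

text \<open>The integer vectors with \<open>|k|\<^sub>\<eta> < \<infinity>\<close>, the zero vector included. Since \<open>infsum\<close> is \<open>0\<close> on
  divergent families, finiteness is summability.\<close>

definition ivecs :: "enat \<Rightarrow> real \<Rightarrow> (nat \<Rightarrow> int) set" where
  "ivecs d \<eta> = {k. (\<forall>j. j \<notin> coords d \<longrightarrow> k j = 0) \<and> kweight \<eta> k summable_on coords d}"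

definition ivecs_star :: "enat \<Rightarrow> real \<Rightarrow> (nat \<Rightarrow> int) set" where
  "ivecs_star d \<eta> = {k \<in> ivecs d \<eta>. 0 < kabs d \<eta> k}"

text \<open>For \<open>\<eta> > 0\<close> every vector in \<open>ivecs d \<eta>\<close> has finite support, so sums and products over all
  coordinates whose terms are trivial for \<open>k j = 0\<close> are taken over the support of \<open>k\<close>.\<close>

definition pairing :: "(nat \<Rightarrow> int) \<Rightarrow> (nat \<Rightarrow> 'a) \<Rightarrow> 'a::comm_ring_1" where
  "pairing k x = (\<Sum>j | k j \<noteq> 0. of_int (k j) * x j)"

definition dioph_weight :: "real \<Rightarrow> (nat \<Rightarrow> int) \<Rightarrow> real" where
  "dioph_weight \<tau> k =
     (\<Prod>j | k j \<noteq> 0. 1 / (1 + jb j powr \<tau> * \<bar>real_of_int (k j)\<bar> powr \<tau>))"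

definition int_cone :: "enat \<Rightarrow> real \<Rightarrow> (nat \<Rightarrow> real) \<Rightarrow> real \<Rightarrow> (nat \<Rightarrow> int) set" where
  "int_cone d \<eta> w r =
     {k \<in> ivecs_star d \<eta>. (\<Sum>j | k j \<noteq> 0. jb j powr \<eta> * of_int (k j) * w j) \<ge> r * kabs d \<eta> k}"


section \<open>Diophantine conditions\<close>

definition torus_norm :: "real \<Rightarrow> real" where
  "torus_norm t = (INF n::int. \<bar>t - 2 * pi * of_int n\<bar>)"

text \<open>
  All angles live in \<open>\<real>/2\<pi>\<int>\<close> and the dynamics is \<open>x \<mapsto> x + \<alpha>\<close> on that torus, so the
  integer translates in the Diophantine condition on \<open>\<alpha>\<close> are taken modulo the period \<open>2\<pi>\<close>.
  Measuring \<open>\<langle>k,\<alpha>\<rangle>\<close> against \<open>\<int>\<close> instead would admit periodic rotations such as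
  \<open>d = 1\<close>, \<open>\<alpha> = 2\<pi>/5\<close>.
\<close>

definition DC_freq_const :: "enat \<Rightarrow> real \<Rightarrow> real \<Rightarrow> real \<Rightarrow> (nat \<Rightarrow> real) set" where
  "DC_freq_const d \<eta> \<gamma> \<tau> =
     {\<alpha> \<in> coords d \<rightarrow>\<^sub>E {1..2}.
        \<forall>k\<in>ivecs_star d \<eta>. torus_norm (pairing k \<alpha>) \<ge> \<gamma> * dioph_weight \<tau> k}"

definition DC_freq :: "enat \<Rightarrow> real \<Rightarrow> real \<Rightarrow> (nat \<Rightarrow> real) set" where
  "DC_freq d \<eta> \<tau> = (\<Union>\<gamma>\<in>{0<..}. DC_freq_const d \<eta> \<gamma> \<tau>)"

definition DC_rot_const :: "enat \<Rightarrow> real \<Rightarrow> real \<Rightarrow> real \<Rightarrow> (nat \<Rightarrow> real) \<Rightarrow> real set" where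
  "DC_rot_const d \<eta> \<kappa> \<tau> \<alpha> =
     {\<rho>. \<forall>k\<in>ivecs_star d \<eta>. torus_norm (2 * \<rho> - pairing k \<alpha>) > \<kappa> * dioph_weight \<tau> k}"

definition DC_rot :: "enat \<Rightarrow> real \<Rightarrow> real \<Rightarrow> (nat \<Rightarrow> real) \<Rightarrow> real set" where
  "DC_rot d \<eta> \<tau> \<alpha> = (\<Union>\<kappa>\<in>{0<..}. DC_rot_const d \<eta> \<kappa> \<tau> \<alpha>)"


section \<open>Analytic functions on the complex strip around a torus\<close>

text \<open>
  Functions on the torus \<open>m\<T>\<^sup>d = (\<real>/2\<pi>m\<int>)\<^sup>d\<close> (only \<open>m = 1\<close> and \<open>m = 2\<close> are used) and its complex
  neighbourhoods are functions on the covering strip that are \<open>2\<pi>m\<close>-periodic in the coordinates.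
  The characters of \<open>m\<T>\<^sup>d\<close> are \<open>e\<^sup>i\<^sup>\<langle>\<^sup>k\<^sup>/\<^sup>m\<^sup>,\<^sup>x\<^sup>\<rangle>\<close>.
\<close>

definition strip :: "enat \<Rightarrow> real \<Rightarrow> real \<Rightarrow> (nat \<Rightarrow> complex) set" where
  "strip d \<eta> h = {x \<in> coords d \<rightarrow>\<^sub>E UNIV. \<forall>j\<in>coords d. \<bar>Im (x j)\<bar> < h * jb j powr \<eta>}"

definition real_points :: "enat \<Rightarrow> (nat \<Rightarrow> complex) set" where
  "real_points d = coords d \<rightarrow>\<^sub>E \<real>"

definition vadd :: "enat \<Rightarrow> (nat \<Rightarrow> complex) \<Rightarrow> (nat \<Rightarrow> complex) \<Rightarrow> nat \<Rightarrow> complex" where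
  "vadd d x y = (\<lambda>j\<in>coords d. x j + y j)"

definition torus_char :: "nat \<Rightarrow> (nat \<Rightarrow> int) \<Rightarrow> (nat \<Rightarrow> complex) \<Rightarrow> complex" where
  "torus_char m k x = exp (\<i> * pairing k x / of_nat m)"

definition torus_measure :: "nat \<Rightarrow> enat \<Rightarrow> (nat \<Rightarrow> real) measure" where
  "torus_measure m d = PiM (coords d) (\<lambda>_. uniform_measure lborel {0..2 * pi * real m})"

definition fourier ::
  "nat \<Rightarrow> enat \<Rightarrow> ((nat \<Rightarrow> complex) \<Rightarrow> complex) \<Rightarrow> (nat \<Rightarrow> int) \<Rightarrow> complex" where
  "fourier m d f k =
     (\<integral>x. (let z = (\<lambda>j\<in>coords d. complex_of_real (x j)) in f z * torus_char m (\<lambda>j. - k j) z)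
        \<partial>torus_measure m d)"

definition fnorm_term ::
  "nat \<Rightarrow> enat \<Rightarrow> real \<Rightarrow> real \<Rightarrow> ((nat \<Rightarrow> complex) \<Rightarrow> complex) \<Rightarrow> (nat \<Rightarrow> int) \<Rightarrow> real" where
  "fnorm_term m d \<eta> h f k = cmod (fourier m d f k) * exp (h * kabs d \<eta> k / real m)"

definition fnorm :: "nat \<Rightarrow> enat \<Rightarrow> real \<Rightarrow> real \<Rightarrow> ((nat \<Rightarrow> complex) \<Rightarrow> complex) \<Rightarrow> real" where
  "fnorm m d \<eta> h f = (\<Sum>\<^sub>\<infinity>k\<in>ivecs d \<eta>. fnorm_term m d \<eta> h f k)"

definition torus_periodic ::
  "nat \<Rightarrow> enat \<Rightarrow> real \<Rightarrow> real \<Rightarrow> ((nat \<Rightarrow> complex) \<Rightarrow> complex) \<Rightarrow> bool" where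
  "torus_periodic m d \<eta> h f \<longleftrightarrow>
     (\<forall>x\<in>strip d \<eta> h. \<forall>n :: nat \<Rightarrow> int.
        f (vadd d x (\<lambda>j. of_real (2 * pi * real m * of_int (n j)))) = f x)"

text \<open>A bounded function is analytic, in finite as in infinite dimension, iff it is holomorphic along
  complex lines. For \<open>d = \<infinity>\<close> the trace of the strip on a line need not be open, whence \<open>interior\<close>.\<close>

definition line_holomorphic ::
  "enat \<Rightarrow> real \<Rightarrow> real \<Rightarrow> ((nat \<Rightarrow> complex) \<Rightarrow> complex) \<Rightarrow> bool" where
  "line_holomorphic d \<eta> h f \<longleftrightarrow>
     (\<forall>x y. (\<lambda>t. f (vadd d x (\<lambda>j. t * y j))) holomorphic_on
              interior {t. vadd d x (\<lambda>j. t * y j) \<in> strip d \<eta> h})"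

text \<open>Bounded analytic functions of finite norm. The last clause, that a function is the sum of its
  Fourier series, is automatic for finite \<open>d\<close>; for \<open>d = \<infinity>\<close> it is part of the usual definition
  of this space and excludes functions not determined by their Fourier coefficients.\<close>

definition Comega ::
  "nat \<Rightarrow> enat \<Rightarrow> real \<Rightarrow> real \<Rightarrow> ((nat \<Rightarrow> complex) \<Rightarrow> complex) set" where
  "Comega m d \<eta> h =
     {f. torus_periodic m d \<eta> h f
       \<and> bounded (f ` strip d \<eta> h)
       \<and> line_holomorphic d \<eta> h f
       \<and> fnorm_term m d \<eta> h f summable_on ivecs d \<eta>
       \<and> (\<forall>x\<in>strip d \<eta> h.
            ((\<lambda>k. fourier m d f k * torus_char m k x) has_sum f x) (ivecs d \<eta>))}"


section \<open>Cocycles\<close>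

definition mat2 :: "complex \<Rightarrow> complex \<Rightarrow> complex \<Rightarrow> complex \<Rightarrow> complex^2^2" where
  "mat2 a b c e = vector [vector [a, b], vector [c, e]]"

definition schroedinger ::
  "real \<Rightarrow> real \<Rightarrow> ((nat \<Rightarrow> complex) \<Rightarrow> complex) \<Rightarrow> (nat \<Rightarrow> complex) \<Rightarrow> complex^2^2" where
  "schroedinger E lam v x = mat2 (of_real E - of_real lam * v x) (- 1) 1 0"

text \<open>\<open>C\<^sup>\<omega>(m\<T>\<^sup>d, SL(2,\<complex>))\<close>: analytic on some strip, of unspecified width.\<close>

definition Comega_SL2 ::
  "nat \<Rightarrow> enat \<Rightarrow> real \<Rightarrow> ((nat \<Rightarrow> complex) \<Rightarrow> complex^2^2) set" where
  "Comega_SL2 m d \<eta> =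
     {B. \<exists>h>0. (\<forall>i l. (\<lambda>x. B x $ i $ l) \<in> Comega m d \<eta> h) \<and> (\<forall>x\<in>strip d \<eta> h. det (B x) = 1)}"

definition reducible ::
  "enat \<Rightarrow> real \<Rightarrow> (nat \<Rightarrow> real) \<Rightarrow> ((nat \<Rightarrow> complex) \<Rightarrow> complex^2^2) \<Rightarrow> complex^2^2 \<Rightarrow> bool" where
  "reducible d \<eta> \<alpha> A A' \<longleftrightarrow> det A' = 1 \<and>
     (\<exists>B\<in>Comega_SL2 2 d \<eta>. \<forall>x\<in>real_points d.
        matrix_inv (B (vadd d x (\<lambda>j. of_real (\<alpha> j)))) ** A x ** B x = A')"

text \<open>
  The angle \<open>\<rho>(E) = arccos (E/2)\<close> matters modulo \<open>\<pi>\<close> only for the arithmetic conditions, which involve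
  \<open>2\<rho>\<close> modulo \<open>2\<pi>\<close>. The constant matrices with eigenvalues \<open>e\<^sup>\<plusminus>\<^sup>i\<^sup>\<rho>\<close> see the sign lost in this
  reduction, so the representative in \<open>[0,\<pi>]\<close> is fixed.
\<close>

definition rho :: "real \<Rightarrow> real" where
  "rho E = arccos (E / 2)"

text \<open>
  If \<open>2\<rho> = \<langle>k,\<alpha>\<rangle> + 2\<pi>n\<close>, then \<open>e\<^sup>i\<^sup>\<rho> = (-1)\<^sup>n e\<^sup>i\<^sup>\<langle>\<^sup>k\<^sup>,\<^sup>\<alpha>\<^sup>\<rangle>\<^sup>/\<^sup>2\<close>: removing the resonance by a conjugation on
  \<open>2\<T>\<^sup>d\<close> leaves the double eigenvalue \<open>(-1)\<^sup>n\<close>, and for odd \<open>n\<close> this sign cannot be conjugated away.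
\<close>

definition res_sign :: "int \<Rightarrow> complex" where
  "res_sign n = (if even n then 1 else - 1)"

end

theory Submission
  imports Defs "HOL-Library.Function_Algebras"
begin

text \<open>
  The spectrum of \<open>v\<close> lies in a cone on which the additive functional
  \<open>f(k) = \<Sum>\<^sub>j \<langle>j\<rangle>\<^sup>\<eta> k\<^sub>j w\<^sub>j\<close> is positive, so no KAM iteration is needed: the Floquet solutions
  \<open>\<phi> = 1 + \<Sum> \<phi>\<^sub>s e\<^sup>i\<^sup>\<langle>\<^sup>s\<^sup>,\<^sup>x\<^sup>\<rangle>\<close>, \<open>f(s) > 0\<close>, are given by a convergent recursion on \<open>s\<close>.
  Unrolled, \<open>\<phi>\<^sub>s\<close> is a sum over chains of partial sums \<open>s\<^sub>0, s\<^sub>1, \<dots>, s\<^sub>n = s\<close> of Fourier modes of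
  \<open>v\<close>, with one divisor \<open>\<bar>z(s\<^sub>i) - 1\<bar> \<bar>z(s\<^sub>i) - e\<^sup>-\<^sup>2\<^sup>i\<^sup>\<theta>\<bar>\<close> per point, where \<open>z(s) = e\<^sup>i\<^sup>\<langle>\<^sup>s\<^sup>,\<^sup>\<alpha>\<^sup>\<rangle>\<close>.
  As the points of a chain are distinct, few of them can be close to the same point of the circle
  (Siegel), and a chain of \<open>n\<close> steps and length \<open>L\<close> costs at most a factor \<open>C\<^sup>n e\<^sup>\<epsilon>\<^sup>L\<close>, except for a single
  divisor near \<open>e\<^sup>-\<^sup>2\<^sup>i\<^sup>\<theta>\<close>, the only place where \<open>\<rho>\<close> enters. Hence \<open>\<lambda>\<^sub>0\<close> does not depend on \<open>\<rho>\<close>.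

  The solutions for \<open>\<theta> = \<plusminus>\<rho>\<close> have a constant Wronskian, read off from the zero mode. If
  \<open>2\<rho>\<close> is resonant, the resonance lies on one side of the hyperplane \<open>f = 0\<close> and obstructs only one of
  the two solutions; correcting that one by a multiple of the other gives a Jordan block.
\<close>

section \<open>Siegel's estimate for products of small divisors along chains\<close>

text \<open>What makes the divisors manageable even for infinite \<open>d\<close> is a sublinear
  exponent. Large indices are expensive in \<open>|k|_\<eta>\<close>, so a vector of norm
  \<open>N\<close> has at most \<open>2 N^(1/(1+\<eta>))\<close> nonzero coordinates, and the
  Diophantine product is at least \<open>exp (- a N^\<beta>)\<close> with
  \<open>\<beta> < 1\<close>. In a chain of length \<open>L\<close> the point removed when
  \<open>j\<close> others remain costs about \<open>(L/j)^\<beta>\<close>. Summed over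
  \<open>j\<close> this is of order \<open>L^\<beta> n^(1-\<beta>)\<close>, which Young's inequality
  splits into a small multiple of \<open>L\<close>, paid by the width of the strip, and a multiple
  of \<open>n\<close>, paid by the coupling. The constant of the one exceptional divisor multiplies
  the whole series, so it does not affect convergence.

  The Wronskian of the two plain Floquet solutions is \<open>1/e - e\<close> with
  \<open>e = exp (i \<theta>)\<close>. It vanishes at \<open>E = 2\<close> and
  \<open>E = -2\<close>, which are therefore treated as the resonance \<open>k = 0\<close>. A
  resonance at \<open>p\<close> is removed with \<open>exp (i<p,x>/2)\<close>; this is why the
  conjugation lives on the double torus.\<close>

lemma sum_powr_neg_le:
  fixes \<beta> :: real
  assumes "0 < \<beta>" "\<beta> < 1"
  shows "(\<Sum>j=1..n. real j powr (- \<beta>)) \<le> real n powr (1 - \<beta>) / (1 - \<beta>)"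
proof (induction n)
  case (Suc n)
  let ?m = "real (Suc n)"
  \<comment> \<open>Weighted AM-GM replaces the comparison with an integral: it shows that the
    increment of \<open>n powr (1 - \<beta>) / (1 - \<beta>)\<close> is at least the new
    term.\<close>
  have "real n powr (1 - \<beta>) * ?m powr \<beta> \<le> (1 - \<beta>) * real n + \<beta> * ?m"
  proof (cases "n = 0")
    case False
    then show ?thesis using Youngs_inequality_0[of "1 - \<beta>" \<beta> "real n" ?m] assms by simp
  qed (use assms in simp)
  also have "\<dots> = ?m - (1 - \<beta>)" by (simp add: algebra_simps)
  finally have "real n powr (1 - \<beta>) * ?m powr \<beta> * ?m powr (- \<beta>) \<le> (?m - (1 - \<beta>)) * ?m powr (- \<beta>)"
    by (rule mult_right_mono) simp
  moreover have "?m powr \<beta> * ?m powr (- \<beta>) = 1"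
    by (simp flip: powr_add)
  moreover have "?m * ?m powr (- \<beta>) = ?m powr (1 - \<beta>)"
    using powr_add[of ?m 1 "- \<beta>"] by simp
  ultimately have "real n powr (1 - \<beta>) \<le> ?m powr (1 - \<beta>) - (1 - \<beta>) * ?m powr (- \<beta>)"
    by (simp add: algebra_simps)
  then have "real n powr (1 - \<beta>) / (1 - \<beta>)
      \<le> (?m powr (1 - \<beta>) - (1 - \<beta>) * ?m powr (- \<beta>)) / (1 - \<beta>)"
    using assms by (intro divide_right_mono) auto
  also have "\<dots> = ?m powr (1 - \<beta>) / (1 - \<beta>) - ?m powr (- \<beta>)"
    using assms by (simp add: diff_divide_distrib)
  finally have "real n powr (1 - \<beta>) / (1 - \<beta>) + ?m powr (- \<beta>) \<le> ?m powr (1 - \<beta>) / (1 - \<beta>)"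
    by simp
  then show ?case using Suc by simp
qed simp

lemma sum_gap_bound:
  fixes a b \<beta> \<delta> :: real
  assumes "0 \<le> a" "0 \<le> b" "0 < \<beta>" "\<beta> < 1" "0 < \<delta>"
  obtains C where "0 \<le> C"
    "\<And>L n. 0 \<le> L \<Longrightarrow> (\<Sum>j=1..n. ln 2 + b + a * (L / real j) powr \<beta>) \<le> \<delta> * L + C * real n"
proof -
  \<comment> \<open>\<open>\<mu>\<close> is chosen so that
    \<open>\<epsilon> powr \<beta> * \<mu> powr (1 - \<beta>) = 1\<close> in Young's inequality, and
    \<open>\<epsilon>\<close> so that after the factor \<open>a / (1 - \<beta>)\<close> at most
    \<open>\<delta>\<close> is left; \<open>a + 1\<close> covers \<open>a = 0\<close>.\<close>
  define \<epsilon> where "\<epsilon> = \<delta> * (1 - \<beta>) / (a + 1)"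
  define \<mu> where "\<mu> = \<epsilon> powr (- \<beta> / (1 - \<beta>))"
  define C where "C = ln 2 + b + a / (1 - \<beta>) * \<mu>"
  have e: "\<epsilon> > 0" and m: "\<mu> > 0" using assms by (simp_all add: \<epsilon>_def \<mu>_def)
  have young: "L powr \<beta> * real n powr (1 - \<beta>) \<le> \<epsilon> * L + \<mu> * real n" if L: "0 \<le> L" for L n
  proof (cases "L = 0 \<or> n = 0")
    case False
    then have "(\<epsilon> * L) powr \<beta> * (\<mu> * real n) powr (1 - \<beta>) \<le> \<beta> * (\<epsilon> * L) + (1 - \<beta>) * (\<mu> * real n)"
      using Youngs_inequality_0[of \<beta> "1 - \<beta>" "\<epsilon> * L" "\<mu> * real n"] assms e m L by simp
    also have "\<dots> \<le> 1 * (\<epsilon> * L) + 1 * (\<mu> * real n)"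
      using assms e m L by (intro add_mono mult_right_mono) auto
    also have "(\<epsilon> * L) powr \<beta> * (\<mu> * real n) powr (1 - \<beta>)
        = (\<epsilon> powr \<beta> * \<mu> powr (1 - \<beta>)) * (L powr \<beta> * real n powr (1 - \<beta>))"
      using e m L by (simp add: powr_mult mult_ac)
    also have "\<epsilon> powr \<beta> * \<mu> powr (1 - \<beta>) = 1"
      using assms e by (simp add: \<mu>_def powr_powr flip: powr_add)
    finally show ?thesis by simp
  next
    case True
    then have "L powr \<beta> * real n powr (1 - \<beta>) = 0" using assms by auto
    moreover have "0 \<le> \<epsilon> * L + \<mu> * real n" using e m L by simp
    ultimately show ?thesis by linarith
  qed
  show ?thesis
  proof
    show "0 \<le> C" using assms m by (simp add: C_def)
    fix L :: real and n :: nat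
    assume L: "0 \<le> L"
    have "(\<Sum>j=1..n. (L / real j) powr \<beta>) = L powr \<beta> * (\<Sum>j=1..n. real j powr (- \<beta>))"
      unfolding sum_distrib_left
      by (intro sum.cong) (use L in \<open>auto simp: powr_divide powr_minus_divide\<close>)
    also have "\<dots> \<le> L powr \<beta> * (real n powr (1 - \<beta>) / (1 - \<beta>))"
      by (intro mult_left_mono sum_powr_neg_le assms) auto
    also have "\<dots> \<le> (\<epsilon> * L + \<mu> * real n) / (1 - \<beta>)"
      using young[OF L, of n] assms by (simp add: divide_right_mono)
    finally have "a * (\<Sum>j=1..n. (L / real j) powr \<beta>) \<le> a * ((\<epsilon> * L + \<mu> * real n) / (1 - \<beta>))"
      using assms by (intro mult_left_mono)
    also have "\<dots> = a / (a + 1) * (\<delta> * L) + a / (1 - \<beta>) * \<mu> * real n"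
      using assms by (simp add: \<epsilon>_def divide_simps) (simp add: algebra_simps)
    also have "\<dots> \<le> 1 * (\<delta> * L) + a / (1 - \<beta>) * \<mu> * real n"
      using assms L m by (intro add_mono mult_right_mono) (auto simp: divide_simps)
    finally show "(\<Sum>j=1..n. ln 2 + b + a * (L / real j) powr \<beta>) \<le> \<delta> * L + C * real n"
      by (simp add: sum.distrib C_def algebra_simps flip: sum_distrib_left)
  qed
qed

lemma sum_gaps_le:
  fixes P :: "nat \<Rightarrow> real"
  assumes "finite T" "T \<noteq> {}" "\<And>i l. i \<in> T \<Longrightarrow> l \<in> T \<Longrightarrow> i < l \<Longrightarrow> g \<le> P l - P i"
  shows "\<exists>i\<in>T. P i + g * real (card T - 1) \<le> P (Max T)"
  using assms
proof (induction T rule: finite_linorder_max_induct)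
  case (insert b A)
  show ?case
  proof (cases "A = {}")
    case False
    with insert obtain i where i: "i \<in> A" "P i + g * real (card A - 1) \<le> P (Max A)" by blast
    have mb: "Max A \<in> A" using insert False by simp
    then have "g \<le> P b - P (Max A)" using insert by auto
    moreover have "Max (insert b A) = b"
      using insert by (intro Max_eqI) (auto intro: less_imp_le)
    moreover have "card (insert b A) - 1 = Suc (card A - 1)"
      using insert False by (metis card_Suc_eq_finite card_gt_0_iff Suc_pred diff_Suc_1 less_irrefl)
    ultimately show ?thesis using i by (intro bexI[of _ i]) (auto simp: algebra_simps)
  qed simp
qed simp

text \<open>Pigeonhole, with no monotonicity of \<open>P\<close>: if every forward gap exceeded
  \<open>L / j\<close>, the \<open>j\<close> consecutive ones would add up to more than
  \<open>L\<close>.\<close>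

lemma exists_small_gap:
  fixes P :: "nat \<Rightarrow> real"
  assumes "finite T" "card T = Suc j" "1 \<le> j" "\<And>i. i \<in> T \<Longrightarrow> 0 \<le> P i \<and> P i \<le> L"
  shows "\<exists>i\<in>T. \<exists>l\<in>T. i < l \<and> P l - P i \<le> L / real j"
proof (rule ccontr)
  assume "\<not> ?thesis"
  then have gap: "L / real j < P l - P i" if "i \<in> T" "l \<in> T" "i < l" for i l
    using that by force
  \<comment> \<open>\<open>sum_gaps_le\<close> yields only a weak inequality; splitting off the last
    gap keeps it strict.\<close>
  define T' where "T' = T - {Max T}"
  have "T \<noteq> {}" using assms by auto
  with assms have T: "T \<noteq> {}" "Max T \<in> T" by auto
  have T': "finite T'" "card T' = j" using assms T by (auto simp: T'_def)
  with assms(3) have "T' \<noteq> {}" by auto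
  note T' = T' this
  from T' obtain i where i: "i \<in> T'" "P i + L / real j * real (card T' - 1) \<le> P (Max T')"
    using sum_gaps_le[of T' "L / real j" P] gap by (auto simp: T'_def intro: less_imp_le)
  have mT': "Max T' \<in> T'" using T' by simp
  then have "Max T' < Max T" using assms
    by (metis DiffE Max_ge T'_def le_neq_implies_less singletonI)
  then have "L / real j < P (Max T) - P (Max T')" using gap T mT' by (auto simp: T'_def)
  with i have "P i + L / real j * real (card T' - 1) + L / real j < P (Max T)" by simp
  moreover have "L / real j * real (card T' - 1) + L / real j = L"
    using T' assms(3) by (simp add: of_nat_diff field_simps)
  ultimately have "P i + L < P (Max T)" by simp
  then show False using assms(4)[of i] assms(4)[of "Max T"] i T by (auto simp: T'_def)
qed

text \<open>Greedy choice: while \<open>j + 1\<close> indices remain, \<open>1 \<le> j\<close>, one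
  with \<open>c j \<le> x i\<close> is removed; the last index is estimated by \<open>m\<close>.
  Thus the uniform bound \<open>m\<close> is spent only once.\<close>

lemma prod_ge_by_removal:
  fixes x c :: "nat \<Rightarrow> real"
  assumes "finite T" "card T = Suc n" "0 < m" "\<And>i. i \<in> T \<Longrightarrow> m \<le> x i" "\<And>j. 0 \<le> c j"
    and "\<And>T' j. T' \<subseteq> T \<Longrightarrow> card T' = Suc j \<Longrightarrow> 1 \<le> j \<Longrightarrow> \<exists>i\<in>T'. c j \<le> x i"
  shows "m * (\<Prod>j=1..n. c j) \<le> (\<Prod>i\<in>T. x i)"
  using assms
proof (induction n arbitrary: T)
  case 0
  then obtain i where "T = {i}" by (metis card_1_singletonE One_nat_def)
  with 0 show ?case by simp
next
  case (Suc n)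
  obtain i where i: "i \<in> T" "c (Suc n) \<le> x i" using Suc.prems(6)[of T "Suc n"] Suc.prems(2) by auto
  have "m * (\<Prod>j=1..n. c j) \<le> (\<Prod>i\<in>T - {i}. x i)"
  proof (rule Suc.IH)
    fix T' j
    assume "T' \<subseteq> T - {i}" "card T' = Suc j" "1 \<le> j"
    then show "\<exists>i\<in>T'. c j \<le> x i" by (intro Suc.prems(6)) auto
  qed (use Suc.prems i in auto)
  moreover have "(\<Prod>i\<in>T. x i) = x i * (\<Prod>i\<in>T - {i}. x i)"
    using Suc.prems i by (simp add: prod.remove)
  moreover have "c (Suc n) * (m * (\<Prod>j=1..n. c j)) \<le> x i * (\<Prod>i\<in>T - {i}. x i)"
    using i Suc.prems calculation(1)
    by (intro mult_mono) (auto intro!: mult_nonneg_nonneg prod_nonneg intro: order_trans[of 0 "c (Suc n)"])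
  ultimately show ?case by (simp add: mult_ac)
qed

text \<open>Abstract form of the lattice \<open>ivecs d \<eta>\<close> with the norm
  \<open>kabs d \<eta>\<close> and the character \<open>cis (pairing k \<alpha>)\<close>. The
  carrier \<open>K\<close> is there because the type \<open>nat \<Rightarrow> int\<close> also
  contains inadmissible vectors.\<close>

locale torus_translation =
  fixes K :: "'a::ab_group_add set" and N :: "'a \<Rightarrow> real" and z :: "'a \<Rightarrow> complex"
    and a b \<beta> :: real
  assumes K_zero: "0 \<in> K" and K_add: "x \<in> K \<Longrightarrow> y \<in> K \<Longrightarrow> x + y \<in> K"
    and K_uminus: "x \<in> K \<Longrightarrow> - x \<in> K"
    and N_nonneg: "0 \<le> N x" and N_zero: "N 0 = 0"
    and N_add: "x \<in> K \<Longrightarrow> y \<in> K \<Longrightarrow> N (x + y) \<le> N x + N y"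
    and z_add: "x \<in> K \<Longrightarrow> y \<in> K \<Longrightarrow> z (x + y) = z x * z y"
    and norm_z: "norm (z x) = 1"
    and ab: "0 \<le> a" "0 \<le> b" "0 < \<beta>" "\<beta> < 1"
    and small_divisor: "x \<in> K \<Longrightarrow> x \<noteq> 0 \<Longrightarrow> exp (- (b + a * N x powr \<beta>)) \<le> norm (z x - 1)"
begin

lemma K_diff: "x \<in> K \<Longrightarrow> y \<in> K \<Longrightarrow> x - y \<in> K"
  using K_add[of x "- y"] K_uminus[of y] by simp

lemma sum_list_in_K: "set ms \<subseteq> K \<Longrightarrow> sum_list ms \<in> K"
  by (induction ms) (auto simp: K_zero K_add)

lemma N_sum_list: "set ms \<subseteq> K \<Longrightarrow> N (sum_list ms) \<le> sum_list (map N ms)"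
proof (induction ms)
  case (Cons m ms)
  then have "N (m + sum_list ms) \<le> N m + N (sum_list ms)"
    by (intro N_add) (auto simp: sum_list_in_K)
  with Cons show ?case by auto
qed (simp add: N_zero)

lemma dist_z:
  assumes "x \<in> K" "y \<in> K"
  shows "norm (z x - z y) = norm (z (x - y) - 1)"
proof -
  have "z x = z (x - y) * z y" using z_add[of "x - y" y] assms by (simp add: K_diff)
  then have "z x - z y = (z (x - y) - 1) * z y" by (simp add: algebra_simps)
  then show ?thesis by (simp add: norm_mult norm_z)
qed

definition points :: "'a \<Rightarrow> 'a list \<Rightarrow> nat \<Rightarrow> 'a" where
  "points t ms i = t + sum_list (take i ms)"

lemma points_in_K: "t \<in> K \<Longrightarrow> set ms \<subseteq> K \<Longrightarrow> points t ms i \<in> K"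
  unfolding points_def by (intro K_add sum_list_in_K) (auto dest: in_set_takeD)

text \<open>Siegel's argument: among \<open>j + 1\<close> points of a chain of length \<open>L\<close> two are at distance at most
  \<open>L / j\<close>, so at least one of them is not too close to \<open>u\<close>, whatever \<open>u\<close> is.\<close>

lemma chain_prod_ge:
  assumes t: "t \<in> K" and ms: "set ms \<subseteq> K"
    and ne: "\<And>xs ys zs. ms = xs @ ys @ zs \<Longrightarrow> ys \<noteq> [] \<Longrightarrow> sum_list ys \<noteq> 0"
    and m: "0 < m" "\<And>i. i \<le> length ms \<Longrightarrow> m \<le> norm (z (points t ms i) - u)"
  shows "m * exp (- (\<Sum>j=1..length ms. ln 2 + b + a * (sum_list (map N ms) / real j) powr \<beta>))
    \<le> (\<Prod>i\<le>length ms. norm (z (points t ms i) - u))"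
proof -
  let ?L = "sum_list (map N ms)"
  let ?x = "\<lambda>i. norm (z (points t ms i) - u)"
  define c where "c j = exp (- (ln 2 + b + a * (?L / real j) powr \<beta>))" for j :: nat
  have "m * (\<Prod>j=1..length ms. c j) \<le> (\<Prod>i\<in>{..length ms}. ?x i)"
  proof (rule prod_ge_by_removal)
    fix T' j
    assume T': "T' \<subseteq> {..length ms}" and card: "card T' = Suc j" and j: "1 \<le> j"
    have fin: "finite T'" using T' finite_subset by blast
    define P where "P i = sum_list (map N (take i ms))" for i
    have P: "0 \<le> P i \<and> P i \<le> ?L" for i
    proof -
      have "P i + sum_list (map N (drop i ms)) = ?L"
        unfolding P_def by (metis append_take_drop_id map_append sum_list_append)
      moreover have "0 \<le> sum_list (map N (drop i ms))" "0 \<le> P i"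
        unfolding P_def by (auto intro!: sum_list_nonneg N_nonneg)
      ultimately show ?thesis by simp
    qed
    obtain i l where il: "i \<in> T'" "l \<in> T'" "i < l" "P l - P i \<le> ?L / real j"
      using exists_small_gap[of T' j P ?L] fin card j P by blast
    \<comment> \<open>The steps between the two close points. Their sum is the difference of the
      points and is nonzero by \<open>ne\<close>, so the small divisor estimate applies to
      it.\<close>
    define ys where "ys = take (l - i) (drop i ms)"
    have tl: "take l ms = take i ms @ ys"
      using take_add[of i "l - i" ms] il(3) by (simp add: ys_def)
    have l: "l \<le> length ms" using il(2) T' by auto
    have ys: "ys \<noteq> []" using il(3) l by (simp add: ys_def)
    have "ms = take i ms @ ys @ drop l ms"
      using tl by (metis append.assoc append_take_drop_id)
    then have ne0: "sum_list ys \<noteq> 0" using ne ys by blast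
    have ysK: "set ys \<subseteq> K" using ms by (auto simp: ys_def dest: in_set_takeD in_set_dropD)
    have pts: "points t ms l - points t ms i = sum_list ys"
      by (simp add: points_def tl)
    have Nys: "N (sum_list ys) \<le> ?L / real j"
      using N_sum_list[OF ysK] il(4) by (simp add: P_def tl)
    have "exp (- (b + a * (?L / real j) powr \<beta>)) \<le> exp (- (b + a * N (sum_list ys) powr \<beta>))"
      using Nys ab by (auto intro!: mult_left_mono powr_mono2 N_nonneg)
    also have "\<dots> \<le> norm (z (sum_list ys) - 1)"
      using small_divisor[OF sum_list_in_K[OF ysK] ne0] .
    also have "\<dots> = norm (z (points t ms l) - z (points t ms i))"
      using dist_z[of "points t ms l" "points t ms i"] pts t ms by (simp add: points_in_K)
    also have "\<dots> \<le> ?x l + ?x i"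
      using norm_triangle_ineq4[of "z (points t ms l) - u" "z (points t ms i) - u"] by simp
    \<comment> \<open>One of the two points is at least half their distance away from
      \<open>u\<close>; this half is the \<open>ln 2\<close> in \<open>c j\<close>.\<close>
    finally have "2 * c j \<le> ?x l + ?x i"
      by (simp add: c_def exp_diff exp_add exp_minus field_simps)
    then have "c j \<le> ?x l \<or> c j \<le> ?x i" by linarith
    then show "\<exists>i\<in>T'. c j \<le> ?x i" using il by blast
  qed (use m in \<open>auto simp: c_def\<close>)
  moreover have "(\<Prod>j=1..length ms. c j)
      = exp (- (\<Sum>j=1..length ms. ln 2 + b + a * (?L / real j) powr \<beta>))"
    unfolding c_def by (simp add: exp_sum flip: sum_negf)
  ultimately show ?thesis by simp
qed

end

section \<open>Weighted summable coefficients and sums over chains\<close>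

lemma has_sum_Sigma_nonneg:
  fixes f :: "'b \<times> 'c \<Rightarrow> real"
  assumes "\<And>x. x \<in> A \<Longrightarrow> ((\<lambda>y. f (x, y)) has_sum g x) (B x)" "(g has_sum S) A"
    and "\<And>x y. x \<in> A \<Longrightarrow> y \<in> B x \<Longrightarrow> 0 \<le> f (x, y)"
  shows "(f has_sum S) (Sigma A B)"
  using assms
  by (intro has_sum_SigmaI summable_on_SigmaI[where f = f and g = g])
     (auto simp: has_sum_imp_summable)

lemma abs_summable_times:
  fixes f :: "'b \<Rightarrow> 'd::{real_normed_field, banach}" and g :: "'c \<Rightarrow> 'd"
  assumes "(\<lambda>x. norm (f x)) summable_on A" "(\<lambda>y. norm (g y)) summable_on B"
  shows "(\<lambda>p. norm (case p of (x, y) \<Rightarrow> f x * g y)) summable_on A \<times> B"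
proof -
  have "((\<lambda>p. norm (f (fst p)) * norm (g (snd p)))
      has_sum (infsum (\<lambda>x. norm (f x)) A * infsum (\<lambda>y. norm (g y)) B)) (A \<times> B)"
    by (rule has_sum_Sigma_nonneg[where g = "\<lambda>x. norm (f x) * infsum (\<lambda>y. norm (g y)) B"])
       (auto intro!: has_sum_cmult_right has_sum_cmult_left has_sum_infsum assms)
  then show ?thesis
    by (auto dest!: has_sum_imp_summable simp: norm_mult case_prod_unfold)
qed

text \<open>Fubini for \<open>f x * g y\<close> after the change of variables
  \<open>s = x + y\<close>.\<close>

lemma convolution_summable:
  fixes f g :: "'a::ab_group_add \<Rightarrow> 'd::{real_normed_field, banach}"
  assumes f: "(\<lambda>x. norm (f x)) summable_on UNIV" and g: "(\<lambda>x. norm (g x)) summable_on UNIV"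
  shows "(\<lambda>i. f i * g (s - i)) summable_on UNIV"
    and "((\<lambda>s. \<Sum>\<^sub>\<infinity>i. f i * g (s - i)) has_sum (infsum f UNIV * infsum g UNIV)) UNIV"
proof -
  have "(\<lambda>(x, y). f x * g y) summable_on UNIV \<times> UNIV"
    by (rule abs_summable_summable[OF abs_summable_times[OF f g]])
  moreover have "((\<lambda>y. f x * g y) has_sum f x * infsum g UNIV) UNIV" for x
    by (intro has_sum_cmult_right has_sum_infsum abs_summable_summable[OF g])
  moreover have "((\<lambda>x. f x * infsum g UNIV) has_sum (infsum f UNIV * infsum g UNIV)) UNIV"
    by (intro has_sum_cmult_left has_sum_infsum abs_summable_summable[OF f])
  ultimately have "((\<lambda>(x, y). f x * g y) has_sum (infsum f UNIV * infsum g UNIV)) (UNIV \<times> UNIV)"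
    by (intro has_sum_SigmaI[where g = "\<lambda>x. f x * infsum g UNIV"]) auto
  also have "?this \<longleftrightarrow> ((\<lambda>(s, i). f i * g (s - i)) has_sum (infsum f UNIV * infsum g UNIV)) (UNIV \<times> UNIV)"
    by (rule has_sum_reindex_bij_witness[where j = "\<lambda>(x, y). (x + y, x)" and i = "\<lambda>(s, i). (i, s - i)"]) auto
  finally have *: "((\<lambda>(s, i). f i * g (s - i)) has_sum (infsum f UNIV * infsum g UNIV)) (UNIV \<times> UNIV)" .
  have "(\<lambda>(x, y). norm (f x * g y)) summable_on UNIV \<times> UNIV"
    using abs_summable_times[OF f g] by (simp add: case_prod_unfold)
  also have "?this \<longleftrightarrow> (\<lambda>(s, i). norm (f i * g (s - i))) summable_on UNIV \<times> UNIV"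
    by (rule summable_on_reindex_bij_witness[where j = "\<lambda>(x, y). (x + y, x)" and i = "\<lambda>(s, i). (i, s - i)"]) auto
  finally have inner: "(\<lambda>i. f i * g (s - i)) summable_on UNIV" for s
    by (rule abs_summable_summable[OF summable_on_SigmaD1[of "\<lambda>s i. norm (f i * g (s - i))" UNIV "\<lambda>_. UNIV" s]]) auto
  from this show "(\<lambda>i. f i * g (s - i)) summable_on UNIV" .
  show "((\<lambda>s. \<Sum>\<^sub>\<infinity>i. f i * g (s - i)) has_sum (infsum f UNIV * infsum g UNIV)) UNIV"
    by (rule has_sum_SigmaD[OF *]) (auto intro!: has_sum_infsum inner)
qed

text \<open>Pushes coefficients forward along \<open>e\<close>. It serves for chains grouped by
  their endpoint and for the frequencies \<open>k + k + p\<close> on the double torus.\<close>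

lemma fiber_summable:
  fixes A :: "'i \<Rightarrow> 'd::{real_normed_vector, banach}" and e :: "'i \<Rightarrow> 'a" and W :: "'a \<Rightarrow> real"
  assumes summ: "(\<lambda>i. norm (A i) * W (e i)) summable_on UNIV" and W: "\<And>k. 0 < W k"
  shows "(\<lambda>i. norm (A i)) summable_on {i. e i = k}"
    and "(\<lambda>k. norm (infsum A {i. e i = k}) * W k) summable_on UNIV"
proof -
  have "(\<lambda>i. norm (A i) * W k) summable_on {i. e i = k}" for k
    using summable_on_subset[OF summ, of "{i. e i = k}"]
    by (rule summable_on_cong[THEN iffD1, rotated]) auto
  then show abs: "(\<lambda>i. norm (A i)) summable_on {i. e i = k}" for k
    using summable_on_cmult_left'[of "W k" "\<lambda>i. norm (A i)" "{i. e i = k}"] W[of k] by auto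
  have "(\<lambda>(k, i). norm (A i) * W k) summable_on (SIGMA k:UNIV. {i. e i = k})"
    by (rule summable_on_reindex_bij_witness[where j = snd and i = "\<lambda>i. (e i, i)", THEN iffD2, OF _ _ _ _ _ summ])
       auto
  then have "(\<lambda>k. \<Sum>\<^sub>\<infinity>i\<in>{i. e i = k}. norm (A i) * W k) summable_on UNIV"
    by (rule summable_on_Sigma_banach)
  then have "(\<lambda>k. norm (infsum A {i. e i = k} ) * norm (W k)) summable_on UNIV"
    unfolding norm_mult[symmetric]
  proof (rule summable_on_comparison_test, goal_cases)
    case (1 k)
    have "norm (infsum A {i. e i = k}) \<le> (\<Sum>\<^sub>\<infinity>i\<in>{i. e i = k}. norm (A i))"
      by (rule norm_infsum_bound[OF abs])
    then show ?case using W[of k] by (simp add: infsum_cmult_left')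
  qed auto
  then show "(\<lambda>k. norm (infsum A {i. e i = k}) * W k) summable_on UNIV"
    using W by (simp add: less_imp_le)
qed

text \<open>The lists of length \<open>n\<close> contribute the \<open>n\<close>-th power of the sum
  of \<open>V\<close>, so this is a geometric series.\<close>

lemma summable_prod_list:
  fixes V :: "'b \<Rightarrow> real"
  assumes V: "\<And>m. 0 \<le> V m" "V summable_on UNIV" "infsum V UNIV < 1"
  shows "(\<lambda>ms. prod_list (map V ms)) summable_on UNIV"
proof -
  have nn: "0 \<le> prod_list (map V ms)" for ms by (induction ms) (auto simp: V)
  have len: "((\<lambda>ms. prod_list (map V ms)) has_sum (infsum V UNIV ^ n)) {ms. length ms = n}" for n
  proof (induction n)
    case (Suc n)
    have "((\<lambda>(m, ms). V m * prod_list (map V ms)) has_sum (infsum V UNIV * infsum V UNIV ^ n))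
        (UNIV \<times> {ms. length ms = n})"
      by (rule has_sum_Sigma_nonneg[where g = "\<lambda>m. V m * infsum V UNIV ^ n"])
         (auto intro!: has_sum_cmult_right has_sum_cmult_left mult_nonneg_nonneg Suc has_sum_infsum V nn)
    also have "?this \<longleftrightarrow> ((\<lambda>ms. prod_list (map V ms)) has_sum (infsum V UNIV ^ Suc n)) {ms. length ms = Suc n}"
      by (rule has_sum_reindex_bij_witness[where j = "\<lambda>(m, ms). m # ms" and i = "\<lambda>ms. (hd ms, tl ms)"])
         (auto simp: length_Suc_conv)
    finally show ?case .
  qed (simp add: has_sum_finiteI)
  have "(\<lambda>n. infsum V UNIV ^ n) summable_on (UNIV :: nat set)"
    using V infsum_nonneg[of UNIV V]
    by (subst summable_on_UNIV_nonneg_real_iff) (auto intro!: summable_geometric)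
  then have "(\<lambda>(n, ms). prod_list (map V ms)) summable_on (SIGMA n:UNIV. {ms. length ms = n})"
    by (intro summable_on_SigmaI[where g = "\<lambda>n. infsum V UNIV ^ n"]) (use len nn in auto)
  then show ?thesis
    by (rule summable_on_reindex_bij_witness[where j = snd and i = "\<lambda>ms. (length ms, ms)", THEN iffD1, rotated -1])
       auto
qed

section \<open>Weighted summable coefficients, their convolution, and linear equations solved by
  sums over chains\<close>

context torus_translation
begin

text \<open>Fourier side of \<open>Comega\<close> on the strip of width \<open>h\<close>. Vanishing
  off \<open>K\<close> lets all sums range over the whole type.\<close>

definition ell1 :: "real \<Rightarrow> ('a \<Rightarrow> complex) set" where
  "ell1 h = {c. (\<forall>k. k \<notin> K \<longrightarrow> c k = 0) \<and> (\<lambda>k. norm (c k) * exp (h * N k)) summable_on UNIV}"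

definition conv :: "('a \<Rightarrow> complex) \<Rightarrow> ('a \<Rightarrow> complex) \<Rightarrow> 'a \<Rightarrow> complex" where
  "conv c e s = (\<Sum>\<^sub>\<infinity>i. c i * e (s - i))"

lemma ell1_support: "c \<in> ell1 h \<Longrightarrow> c k \<noteq> 0 \<Longrightarrow> k \<in> K"
  by (auto simp: ell1_def)

lemma ell1_comparison:
  assumes "c \<in> ell1 h" "\<And>k. norm (e k) * exp (h' * N k) \<le> B * (norm (c k) * exp (h * N k))"
  shows "e \<in> ell1 h'"
proof -
  have "e k = 0" if "k \<notin> K" for k
  proof -
    have "norm (e k) * exp (h' * N k) \<le> 0" using assms(2)[of k] assms(1) that by (simp add: ell1_def)
    then show ?thesis by (simp add: mult_le_0_iff)
  qed
  moreover have "(\<lambda>k. norm (e k) * exp (h' * N k)) summable_on UNIV"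
  proof (rule summable_on_comparison_test)
    show "(\<lambda>k. B * (norm (c k) * exp (h * N k))) summable_on UNIV"
      using assms(1) by (intro summable_on_cmult_right) (simp add: ell1_def)
  qed (use assms(2) in auto)
  ultimately show ?thesis by (auto simp: ell1_def)
qed

lemma ell1_mono: "c \<in> ell1 h \<Longrightarrow> h' \<le> h \<Longrightarrow> c \<in> ell1 h'"
  by (rule ell1_comparison[where B = 1]) (auto intro!: mult_left_mono mult_right_mono N_nonneg)

lemma ell1_mult: "c \<in> ell1 h \<Longrightarrow> (\<And>k. norm (u k) \<le> B) \<Longrightarrow> (\<lambda>k. u k * c k) \<in> ell1 h"
  by (rule ell1_comparison[where B = B and c = c]) (auto simp: norm_mult mult.assoc intro!: mult_right_mono)

lemma ell1_cmult: "c \<in> ell1 h \<Longrightarrow> (\<lambda>k. u * c k) \<in> ell1 h"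
  by (rule ell1_mult[where B = "norm u"]) auto

lemma ell1_add:
  assumes "c \<in> ell1 h" "e \<in> ell1 h"
  shows "(\<lambda>k. c k + e k) \<in> ell1 h"
proof -
  have "(\<lambda>k. norm (c k) * exp (h * N k) + norm (e k) * exp (h * N k)) summable_on UNIV"
    using assms by (intro summable_on_add) (auto simp: ell1_def)
  then have "(\<lambda>k. norm (c k + e k) * exp (h * N k)) summable_on UNIV"
    by (rule summable_on_comparison_test)
       (auto simp: norm_triangle_ineq simp flip: distrib_right)
  then show ?thesis using assms by (auto simp: ell1_def)
qed

lemma ell1_indicator: "p \<in> K \<Longrightarrow> (\<lambda>k. if k = p then u else 0) \<in> ell1 h"
  unfolding ell1_def by (auto intro!: finite_nonzero_values_imp_summable_on)

lemma ell1_shift: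
  assumes "c \<in> ell1 h" "p \<in> K" "0 \<le> h"
  shows "(\<lambda>k. c (k - p)) \<in> ell1 h"
proof -
  have "(\<lambda>k. exp (h * N p) * (norm (c k) * exp (h * N k))) summable_on UNIV"
    using assms by (intro summable_on_cmult_right) (auto simp: ell1_def)
  also have "?this \<longleftrightarrow> (\<lambda>k. exp (h * N p) * (norm (c (k - p)) * exp (h * N (k - p)))) summable_on UNIV"
    by (rule summable_on_reindex_bij_witness[where j = "\<lambda>k. k + p" and i = "\<lambda>k. k - p"]) auto
  finally have "(\<lambda>k. norm (c (k - p)) * exp (h * N k)) summable_on UNIV"
  proof (rule summable_on_comparison_test)
    fix k
    show "norm (c (k - p)) * exp (h * N k) \<le> exp (h * N p) * (norm (c (k - p)) * exp (h * N (k - p)))"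
    proof (cases "c (k - p) = 0")
      case False
      then have "N k \<le> N (k - p) + N p"
        using N_add[of "k - p" p] assms ell1_support by auto
      then have "h * N k \<le> h * N p + h * N (k - p)"
        using assms(3) by (metis add.commute distrib_left mult_left_mono)
      then have "exp (h * N k) \<le> exp (h * N p) * exp (h * N (k - p))"
        by (simp flip: exp_add)
      then show ?thesis by (metis mult.left_commute mult_left_mono norm_ge_zero)
    qed simp
  qed auto
  moreover have "c (k - p) = 0" if "k \<notin> K" for k
    using assms that K_add[of "k - p" p] by (auto simp: ell1_def)
  ultimately show ?thesis by (auto simp: ell1_def)
qed

lemma ell1_abs_summable:
  assumes "c \<in> ell1 h" "\<And>k. k \<in> K \<Longrightarrow> norm (X k) \<le> exp (h * N k)"
  shows "(\<lambda>k. norm (c k * X k)) summable_on UNIV"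
proof (rule summable_on_comparison_test)
  show "(\<lambda>k. norm (c k) * exp (h * N k)) summable_on UNIV" using assms(1) by (simp add: ell1_def)
  show "norm (c k * X k) \<le> norm (c k) * exp (h * N k)" for k
    using assms by (cases "k \<in> K") (auto simp: ell1_def norm_mult intro: mult_left_mono)
qed simp

text \<open>Subadditivity of \<open>N\<close> makes the weight \<open>exp (h * N k)\<close>
  submultiplicative, so the weighted convolution is dominated by that of two summable
  families.\<close>

lemma ell1_conv:
  assumes c: "c \<in> ell1 h" and e: "e \<in> ell1 h" and h: "0 \<le> h"
  shows "conv c e \<in> ell1 h"
proof -
  define f where "f k = norm (c k) * exp (h * N k)" for k
  define g where "g k = norm (e k) * exp (h * N k)" for k
  have f: "(\<lambda>x. norm (f x)) summable_on UNIV" and g: "(\<lambda>x. norm (g x)) summable_on UNIV"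
    using c e by (auto simp: f_def g_def ell1_def)
  note conv = convolution_summable[OF f g]
  have le: "norm (c i * e (s - i)) * exp (h * N s) \<le> f i * g (s - i)" for i s
  proof (cases "c i = 0 \<or> e (s - i) = 0")
    case False
    then have "i \<in> K" "s - i \<in> K" using c e ell1_support by blast+
    then have "h * N s \<le> h * (N i + N (s - i))"
      using N_add[of i "s - i"] h by (intro mult_left_mono) auto
    then have "exp (h * N s) \<le> exp (h * N i) * exp (h * N (s - i))"
      by (simp add: distrib_left flip: exp_add)
    then have "norm (c i * e (s - i)) * exp (h * N s)
        \<le> norm (c i * e (s - i)) * (exp (h * N i) * exp (h * N (s - i)))"
      by (intro mult_left_mono) auto
    then show ?thesis by (simp add: f_def g_def norm_mult mult_ac)
  qed (auto simp: f_def g_def)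
  have "norm (conv c e s) * exp (h * N s) \<le> (\<Sum>\<^sub>\<infinity>i. f i * g (s - i))" for s
  proof -
    have abs: "(\<lambda>i. norm (c i * e (s - i)) * exp (h * N s)) summable_on UNIV"
      by (rule summable_on_comparison_test[OF conv(1)[of s]]) (use le in auto)
    then have "(\<lambda>i. norm (c i * e (s - i))) summable_on UNIV"
      using summable_on_cmult_left'[of "exp (h * N s)"] by auto
    then have "norm (conv c e s) * exp (h * N s) \<le> (\<Sum>\<^sub>\<infinity>i. norm (c i * e (s - i))) * exp (h * N s)"
      unfolding conv_def by (intro mult_right_mono norm_infsum_bound) auto
    also have "\<dots> \<le> (\<Sum>\<^sub>\<infinity>i. f i * g (s - i))"
      unfolding infsum_cmult_left'[symmetric] by (intro infsum_mono abs conv(1) le)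
    finally show ?thesis .
  qed
  then have "(\<lambda>s. norm (conv c e s) * exp (h * N s)) summable_on UNIV"
    by (intro summable_on_comparison_test[OF has_sum_imp_summable[OF conv(2)]]) auto
  moreover have "conv c e k = 0" if "k \<notin> K" for k
  proof -
    have "c i * e (k - i) = 0" for i
      using that K_add[of i "k - i"] c e by (auto simp: ell1_def)
    then show ?thesis unfolding conv_def by (intro infsum_0)
  qed
  ultimately show ?thesis by (auto simp: ell1_def)
qed

lemma infsum_conv:
  assumes c: "c \<in> ell1 h" and e: "e \<in> ell1 h"
    and X: "\<And>k. k \<in> K \<Longrightarrow> norm (X k) \<le> exp (h * N k)"
    and X_add: "\<And>k l. k \<in> K \<Longrightarrow> l \<in> K \<Longrightarrow> X (k + l) = X k * X l"
  shows "(\<Sum>\<^sub>\<infinity>k. conv c e k * X k) = (\<Sum>\<^sub>\<infinity>k. c k * X k) * (\<Sum>\<^sub>\<infinity>k. e k * X k)"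
proof -
  have "(\<Sum>\<^sub>\<infinity>i. c i * X i * (e (s - i) * X (s - i))) = conv c e s * X s" for s
    unfolding conv_def infsum_cmult_left'[symmetric]
  proof (rule infsum_cong)
    fix i
    show "c i * X i * (e (s - i) * X (s - i)) = c i * e (s - i) * X s"
    proof (cases "c i = 0 \<or> e (s - i) = 0")
      case False
      then have "i \<in> K" "s - i \<in> K" using c e ell1_support by blast+
      then show ?thesis using X_add[of i "s - i"] by simp
    qed auto
  qed
  then show ?thesis
    using convolution_summable(2)[OF ell1_abs_summable[OF c X] ell1_abs_summable[OF e X]]
    by (simp add: has_sum_iff)
qed

text \<open>\<open>\<xi> s\<close> is the sum over all chains ending at \<open>s\<close>; splitting off the last step gives the equation.\<close>

lemma solve_by_chains:
  fixes R g v :: "'a \<Rightarrow> complex" and u :: complex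
  assumes g: "g \<in> ell1 h" and v: "v \<in> ell1 h" and \<delta>: "\<delta> \<le> h" and C: "0 \<le> C"
    and bound: "\<And>t ms. g t \<noteq> 0 \<Longrightarrow> (\<And>m. m \<in> set ms \<Longrightarrow> v m \<noteq> 0) \<Longrightarrow>
      norm (\<Prod>i\<le>length ms. R (points t ms i))
        \<le> B * C ^ length ms * exp (\<delta> * (N t + sum_list (map N ms)))"
    and small: "norm u * C * (\<Sum>\<^sub>\<infinity>m. norm (v m) * exp (h * N m)) < 1"
  obtains \<xi> where "\<xi> \<in> ell1 (h - \<delta>)" "\<And>s. \<xi> s = R s * (g s + u * conv v \<xi> s)"
    "\<And>S s. (\<And>t. g t \<noteq> 0 \<Longrightarrow> t \<in> S) \<Longrightarrow> (\<And>m t. v m \<noteq> 0 \<Longrightarrow> t \<in> S \<Longrightarrow> t + m \<in> S) \<Longrightarrow>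
      \<xi> s \<noteq> 0 \<Longrightarrow> s \<in> S"
proof -
  define A where "A = (\<lambda>(t, ms). g t * prod_list (map (\<lambda>m. u * v m) ms)
    * (\<Prod>i\<le>length ms. R (points t ms i)))"
  define e where "e = (\<lambda>(t, ms). t + sum_list ms :: 'a)"
  \<comment> \<open>Each step is charged the coupling, its Fourier coefficient, the factor
    \<open>C\<close> and its weight; \<open>small\<close> makes the total less than
    \<open>1\<close>.\<close>
  define V where "V m = norm u * C * (norm (v m) * exp (h * N m))" for m
  define \<xi> where "\<xi> s = infsum A {c. e c = s}" for s
  have V: "0 \<le> V m" "V summable_on UNIV" "infsum V UNIV < 1" for m
    using C v small unfolding V_def
    by (auto simp: ell1_def infsum_cmult_right' intro!: summable_on_cmult_right)
  have Anz: "g t \<noteq> 0 \<and> (\<forall>m\<in>set ms. v m \<noteq> 0)" if "A (t, ms) \<noteq> 0" for t ms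
    using that by (auto simp: A_def prod_list_zero_iff)
  have AK: "t \<in> K" "set ms \<subseteq> K" if "A (t, ms) \<noteq> 0" for t ms
    using Anz[OF that] g v ell1_support by blast+
  have V_list: "norm (prod_list (map (\<lambda>m. u * v m) ms)) * C ^ length ms * exp (h * sum_list (map N ms))
      = prod_list (map V ms)" for ms
  proof (induction ms)
    case (Cons m ms)
    have "norm (prod_list (map (\<lambda>m. u * v m) (m # ms))) * C ^ length (m # ms)
        * exp (h * sum_list (map N (m # ms)))
      = V m * (norm (prod_list (map (\<lambda>m. u * v m) ms)) * C ^ length ms * exp (h * sum_list (map N ms)))"
      by (simp add: V_def norm_mult distrib_left exp_add mult_ac)
    then show ?case by (simp only: Cons.IH) simp
  qed simp
  \<comment> \<open>The loss \<open>exp (\<delta> * ?L)\<close> from the divisors is offset by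
    measuring the endpoint with width \<open>h - \<delta>\<close> only: the exponents add up to
    \<open>h * ?L\<close>, which factors along the chain.\<close>
  have major: "norm (A (t, ms)) * exp ((h - \<delta>) * N (e (t, ms)))
      \<le> \<bar>B\<bar> * (norm (g t) * exp (h * N t)) * prod_list (map V ms)" for t ms
  proof (cases "A (t, ms) = 0")
    case True
    have "0 \<le> prod_list (map V ms)" by (induction ms) (auto simp: V)
    with True show ?thesis by simp
  next
    case False
    let ?L = "N t + sum_list (map N ms)"
    have "N (e (t, ms)) \<le> N t + N (sum_list ms)"
      using AK[OF False] by (auto simp: e_def intro!: N_add sum_list_in_K)
    also have "\<dots> \<le> ?L" using N_sum_list AK[OF False] by simp
    finally have "exp ((h - \<delta>) * N (e (t, ms))) \<le> exp ((h - \<delta>) * ?L)"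
      using \<delta> by (simp add: mult_left_mono)
    moreover have "norm (A (t, ms)) \<le> norm (g t) * norm (prod_list (map (\<lambda>m. u * v m) ms))
        * (\<bar>B\<bar> * C ^ length ms * exp (\<delta> * ?L))"
    proof -
      have "norm (\<Prod>i\<le>length ms. R (points t ms i)) \<le> B * C ^ length ms * exp (\<delta> * ?L)"
        using bound Anz[OF False] by blast
      also have "\<dots> \<le> \<bar>B\<bar> * C ^ length ms * exp (\<delta> * ?L)"
        using C by (intro mult_right_mono) auto
      finally show ?thesis unfolding A_def by (simp add: norm_mult mult_left_mono)
    qed
    ultimately have "norm (A (t, ms)) * exp ((h - \<delta>) * N (e (t, ms)))
        \<le> norm (g t) * norm (prod_list (map (\<lambda>m. u * v m) ms))
          * (\<bar>B\<bar> * C ^ length ms * exp (\<delta> * ?L)) * exp ((h - \<delta>) * ?L)"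
      using C by (intro mult_mono) auto
    also have "\<dots> = \<bar>B\<bar> * norm (g t) * (exp (\<delta> * ?L) * exp ((h - \<delta>) * ?L))
          * (norm (prod_list (map (\<lambda>m. u * v m) ms)) * C ^ length ms)"
      by (simp add: mult_ac)
    also have "exp (\<delta> * ?L) * exp ((h - \<delta>) * ?L) = exp (h * N t) * exp (h * sum_list (map N ms))"
      unfolding exp_add[symmetric] by (simp add: algebra_simps)
    finally show ?thesis unfolding V_list[symmetric] by (simp add: mult_ac)
  qed
  have "(\<lambda>(t, ms). \<bar>B\<bar> * (norm (g t) * exp (h * N t)) * prod_list (map V ms)) summable_on UNIV \<times> UNIV"
  proof -
    have "0 \<le> prod_list (map V ms)" for ms by (induction ms) (auto simp: V)
    then show ?thesis
      using g summable_prod_list[of V, OF V]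
      by (intro summable_on_SigmaI[where g = "\<lambda>t. \<bar>B\<bar> * (norm (g t) * exp (h * N t)) * infsum (\<lambda>ms. prod_list (map V ms)) UNIV"])
         (auto simp: ell1_def intro!: summable_on_cmult_left summable_on_cmult_right has_sum_cmult_right)
  qed
  then have Asum: "(\<lambda>c. norm (A c) * exp ((h - \<delta>) * N (e c))) summable_on UNIV"
    unfolding UNIV_Times_UNIV by (rule summable_on_comparison_test) (use major in auto)
  note fib = fiber_summable[where A = A and e = e and W = "\<lambda>k. exp ((h - \<delta>) * N k)", OF Asum exp_gt_zero]
  show ?thesis
  proof
    have "\<xi> k = 0" if "k \<notin> K" for k
    proof -
      have "A (t, ms) = 0" if "t + sum_list ms = k" for t ms
        using that \<open>k \<notin> K\<close> AK[of t ms] K_add[of t "sum_list ms"] sum_list_in_K[of ms] by auto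
      then show ?thesis unfolding \<xi>_def by (intro infsum_0) (auto simp: e_def)
    qed
    then show "\<xi> \<in> ell1 (h - \<delta>)"
      using fib(2) by (auto simp: ell1_def \<xi>_def)
  next
    fix s
    have Asm: "A summable_on {c. e c = s}" for s by (rule abs_summable_summable[OF fib(1)])
    let ?j = "\<lambda>(m, (t, ms)). (t, ms @ [m])"
    let ?T = "SIGMA m:UNIV. {c. e c = s - m}"
    \<comment> \<open>The bare chain \<open>(s, [])\<close> yields the source term
      \<open>g s\<close>; appending \<open>m\<close> to the chains ending at \<open>s - m\<close>
      yields the convolution.\<close>
    have split: "{c. e c = s} = insert (s, []) (?j ` ?T)"
    proof (rule set_eqI)
      fix c
      show "c \<in> {c. e c = s} \<longleftrightarrow> c \<in> insert (s, []) (?j ` ?T)"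
      proof (cases c)
        case (Pair t ms)
        show ?thesis
        proof (cases ms rule: rev_exhaust)
          case (snoc ms' m)
          have "c \<in> ?j ` ?T \<longleftrightarrow> t + sum_list ms' = s - m"
            unfolding Pair snoc by (auto simp: e_def image_iff)
          then show ?thesis unfolding Pair snoc by (auto simp: e_def algebra_simps)
        qed (auto simp: Pair e_def image_iff)
      qed
    qed
    have inj: "inj_on ?j ?T" by (auto simp: inj_on_def)
    have step: "A (t, ms @ [m]) = u * v m * R s * A (t, ms)" if "e (t, ms) = s - m" for t ms m
    proof -
      have "(\<Prod>i\<le>length ms. R (points t (ms @ [m]) i)) = (\<Prod>i\<le>length ms. R (points t ms i))"
        by (intro prod.cong) (auto simp: points_def)
      moreover have "points t (ms @ [m]) (Suc (length ms)) = s"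
        using that by (simp add: points_def e_def algebra_simps)
      ultimately show ?thesis by (simp add: A_def mult_ac)
    qed
    have Aj: "A summable_on ?j ` ?T"
      by (rule summable_on_subset[OF Asm[of s]]) (subst split, rule subset_insertI)
    then have "(A \<circ> ?j) summable_on ?T" by (simp only: summable_on_reindex[OF inj])
    also have "?this \<longleftrightarrow> (\<lambda>(m, c). u * v m * R s * A c) summable_on ?T"
      by (intro summable_on_cong) (auto simp: step)
    finally have T: "(\<lambda>(m, c). u * v m * R s * A c) summable_on ?T" .
    have "(s, []) \<notin> ?j ` ?T" by auto
    then have "\<xi> s = A (s, []) + infsum A (?j ` ?T)"
      unfolding \<xi>_def split by (intro infsum_insert Aj)
    also have "infsum A (?j ` ?T) = infsum (\<lambda>(m, c). u * v m * R s * A c) ?T"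
      unfolding infsum_reindex[OF inj] by (intro infsum_cong) (auto simp: step)
    also have "\<dots> = (\<Sum>\<^sub>\<infinity>m. \<Sum>\<^sub>\<infinity>c\<in>{c. e c = s - m}. u * v m * R s * A c)"
      by (rule infsum_Sigma'_banach[OF T, symmetric])
    also have "\<dots> = (\<Sum>\<^sub>\<infinity>m. R s * u * (v m * \<xi> (s - m)))"
      unfolding \<xi>_def by (intro infsum_cong) (subst infsum_cmult_right', simp)
    also have "\<dots> = R s * u * conv v \<xi> s" by (simp add: conv_def infsum_cmult_right')
    also have "A (s, []) = g s * R s" by (simp add: A_def points_def)
    finally show "\<xi> s = R s * (g s + u * conv v \<xi> s)" by (simp add: algebra_simps)
  next
    fix S s
    assume gS: "\<And>t. g t \<noteq> 0 \<Longrightarrow> t \<in> S" and vS: "\<And>m t. v m \<noteq> 0 \<Longrightarrow> t \<in> S \<Longrightarrow> t + m \<in> S"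
      and "\<xi> s \<noteq> 0"
    have "\<exists>c. e c = s \<and> A c \<noteq> 0"
    proof (rule ccontr)
      assume "\<not> ?thesis"
      then have "\<xi> s = 0" unfolding \<xi>_def by (intro infsum_0) auto
      with \<open>\<xi> s \<noteq> 0\<close> show False by contradiction
    qed
    then obtain t ms where c: "A (t, ms) \<noteq> 0" "t + sum_list ms = s" by (auto simp: e_def)
    have "t + sum_list ms \<in> S" if "t \<in> S" "\<forall>m\<in>set ms. v m \<noteq> 0" for t ms
      using that
    proof (induction ms arbitrary: t)
      case (Cons m ms)
      then show ?case using Cons.IH[of "t + m"] vS by (auto simp: add.assoc)
    qed simp
    then show "s \<in> S" using c Anz[OF c(1)] gS by blast
  qed
qed

end

section \<open>Formal Floquet solutions\<close>

context torus_translation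
begin

lemma z_zero: "z 0 = 1"
  using z_add[OF K_zero K_zero] norm_z[of 0] by auto

lemma z_nonzero: "z x \<noteq> 0"
  using norm_z[of x] by auto

lemma z_uminus: "x \<in> K \<Longrightarrow> z (- x) = inverse (z x)"
  using z_add[of x "- x"] K_uminus[of x] z_nonzero[of x] z_zero
  by (simp add: inverse_eq_divide eq_divide_eq mult.commute)

lemma z_eq_one: "x \<in> K \<Longrightarrow> z x = 1 \<Longrightarrow> x = 0"
  using small_divisor[of x] by (cases "x = 0") auto

lemma z_inject: "x \<in> K \<Longrightarrow> y \<in> K \<Longrightarrow> z x = z y \<Longrightarrow> x = y"
  using dist_z[of x y] small_divisor[of "x - y"] by (cases "x = y") (auto simp: K_diff)

text \<open>Fourier symbol, at mode \<open>s\<close>, of the operator sending \<open>u\<close> to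
  \<open>e u(x + \<alpha>) + u(x - \<alpha>) / e - (e + 1 / e) u(x)\<close>.\<close>

definition divisor :: "complex \<Rightarrow> 'a \<Rightarrow> complex" where
  "divisor e s = e * z s + inverse (e * z s) - (e + inverse e)"

lemma divisor_factor:
  assumes "e \<noteq> 0"
  shows "divisor e s = e * inverse (z s) * (z s - 1) * (z s - inverse (e^2))"
  using assms z_nonzero[of s] by (simp add: divisor_def field_simps power2_eq_square)

lemma norm_divisor:
  assumes "norm e = 1"
  shows "norm (divisor e s) = norm (z s - 1) * norm (z s - inverse (e^2))"
proof -
  have "e \<noteq> 0" using assms by auto
  then show ?thesis using assms by (simp add: divisor_factor norm_mult norm_inverse norm_z)
qed

lemma divisor_eq_0: "norm e = 1 \<Longrightarrow> s \<in> K \<Longrightarrow> divisor e s = 0 \<longleftrightarrow> s = 0 \<or> z s = inverse (e^2)"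
  using norm_divisor[of e s] z_eq_one[of s] z_zero
  by (metis mult_eq_0_iff norm_eq_zero right_minus_eq)

end

text \<open>\<open>\<epsilon>\<close> measures the loss of width and \<open>C\<close> the loss per
  step. Solving one equation costs \<open>4 * \<epsilon>\<close>, namely
  \<open>2 * \<epsilon>\<close> for each factor of the divisor; the resonant case solves two
  equations in succession, whence \<open>8 * \<epsilon> \<le> h\<close>.\<close>

locale cone_potential = torus_translation +
  fixes f :: "'a \<Rightarrow> real" and v :: "'a \<Rightarrow> complex" and h \<epsilon> C :: real
  assumes f_add: "x \<in> K \<Longrightarrow> y \<in> K \<Longrightarrow> f (x + y) = f x + f y"
    and v_ell1: "v \<in> ell1 h" and v_pos: "v m \<noteq> 0 \<Longrightarrow> 0 < f m"
    and eps: "0 < \<epsilon>" "8 * \<epsilon> \<le> h" and C_nonneg: "0 \<le> C"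
    and gap_bound: "0 \<le> L \<Longrightarrow> (\<Sum>j=1..n. ln 2 + b + a * (L / real j) powr \<beta>) \<le> \<epsilon> * L + C * real n"
begin

lemma f_zero: "f 0 = 0"
  using f_add[OF K_zero K_zero] by simp

lemma f_uminus: "x \<in> K \<Longrightarrow> f (- x) = - f x"
  using f_add[of x "- x"] K_uminus[of x] f_zero by simp

lemma f_diff: "x \<in> K \<Longrightarrow> y \<in> K \<Longrightarrow> f (x - y) = f x - f y"
  using f_add[of "x - y" y] K_diff[of x y] by simp

lemma v_K: "v m \<noteq> 0 \<Longrightarrow> m \<in> K"
  using v_ell1 ell1_support by blast

text \<open>Since \<open>f 0 = 0\<close>, no block of consecutive steps sums to zero; this is what
  makes the points of a chain distinct.\<close>

lemma f_sum_list_pos: "ms \<noteq> [] \<Longrightarrow> (\<And>m. m \<in> set ms \<Longrightarrow> v m \<noteq> 0) \<Longrightarrow> 0 < f (sum_list ms)"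
proof (induction ms rule: list_nonempty_induct)
  case (cons m ms)
  then have "set ms \<subseteq> K" "m \<in> K" using v_K by auto
  then have "f (m + sum_list ms) = f m + f (sum_list ms)" by (intro f_add sum_list_in_K)
  then show ?case using cons v_pos[of m] by simp
qed (use v_pos in simp)

lemma small_divisor_exp: "x \<in> K \<Longrightarrow> x \<noteq> 0 \<Longrightarrow> exp (- C) * exp (- (\<epsilon> * N x)) \<le> norm (z x - 1)"
proof -
  assume x: "x \<in> K" "x \<noteq> 0"
  have "b + a * N x powr \<beta> \<le> \<epsilon> * N x + C"
  proof -
    have "0 \<le> ln (2::real)" by simp
    \<comment> \<open>The gap bound for a single term: \<open>n = 1\<close> and
      \<open>L = N x\<close>.\<close>
    moreover have "ln 2 + b + a * N x powr \<beta> \<le> \<epsilon> * N x + C"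
      using gap_bound[of "N x" 1] N_nonneg[of x] by simp
    ultimately show ?thesis by linarith
  qed
  then have "exp (- C) * exp (- (\<epsilon> * N x)) \<le> exp (- (b + a * N x powr \<beta>))"
    by (simp flip: exp_add)
  then show ?thesis using small_divisor[OF x] by linarith
qed

text \<open>Exact coincidences \<open>z s = \<omega>\<close> are exempt, so resonant angles qualify
  as well; only approximation that is too good without being exact is forbidden.\<close>

definition nonresonant :: "complex \<Rightarrow> bool" where
  "nonresonant \<omega> \<longleftrightarrow> (\<exists>\<kappa>>0. \<forall>s\<in>K. z s \<noteq> \<omega> \<longrightarrow> \<kappa> * exp (- (\<epsilon> * N s)) \<le> norm (z s - \<omega>))"

text \<open>Translation by \<open>q\<close> reduces this to the small divisors at \<open>1\<close>;
  its price \<open>exp (- (\<epsilon> * N (- q)))\<close> goes into \<open>\<kappa>\<close>.\<close>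

lemma nonresonant_z:
  assumes "q \<in> K"
  shows "nonresonant (z q)"
proof -
  have "exp (- C) * exp (- (\<epsilon> * N (- q))) * exp (- (\<epsilon> * N s)) \<le> norm (z s - z q)"
    if s: "s \<in> K" "z s \<noteq> z q" for s
  proof -
    have "N (s - q) \<le> N s + N (- q)" using N_add[of s "- q"] s assms K_uminus by simp
    then have "\<epsilon> * N (s - q) \<le> \<epsilon> * N s + \<epsilon> * N (- q)"
      using eps by (simp flip: distrib_left)
    then have "exp (- C) * exp (- (\<epsilon> * N (- q))) * exp (- (\<epsilon> * N s))
        \<le> exp (- C) * exp (- (\<epsilon> * N (s - q)))"
      by (simp flip: exp_add)
    also have "\<dots> \<le> norm (z (s - q) - 1)"
      using s assms by (intro small_divisor_exp K_diff) auto
    also have "\<dots> = norm (z s - z q)" using s assms by (simp add: dist_z)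
    finally show ?thesis .
  qed
  then show ?thesis unfolding nonresonant_def
    by (intro exI[of _ "exp (- C) * exp (- (\<epsilon> * N (- q)))"]) auto
qed

text \<open>The weak bound with \<open>\<kappa>\<close> is spent on one point of the chain, Siegel's
  estimate handles the others with constants independent of \<open>\<omega>\<close>. Each of the two
  contributes one \<open>\<epsilon>\<close>, and \<open>\<kappa>\<close> is not raised to a
  power.\<close>

lemma chain_lower_bound:
  assumes \<kappa>: "0 < \<kappa>" "\<And>s. s \<in> K \<Longrightarrow> z s \<noteq> \<omega> \<Longrightarrow> \<kappa> * exp (- (\<epsilon> * N s)) \<le> norm (z s - \<omega>)"
    and t: "t \<in> K" and ms: "\<And>m. m \<in> set ms \<Longrightarrow> v m \<noteq> 0"
    and ne: "\<And>i. i \<le> length ms \<Longrightarrow> z (points t ms i) \<noteq> \<omega>"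
  shows "\<kappa> * exp (- C * real (length ms)) * exp (- (2 * \<epsilon> * (N t + sum_list (map N ms))))
    \<le> (\<Prod>i\<le>length ms. norm (z (points t ms i) - \<omega>))"
proof -
  let ?L = "sum_list (map N ms)"
  have msK: "set ms \<subseteq> K" using ms v_K by auto
  have L: "0 \<le> ?L" by (auto intro!: sum_list_nonneg N_nonneg)
  have m: "\<kappa> * exp (- (\<epsilon> * (N t + ?L))) \<le> norm (z (points t ms i) - \<omega>)" if "i \<le> length ms" for i
  proof -
    have K: "set (take i ms) \<subseteq> K" using msK by (auto dest: in_set_takeD)
    have "sum_list (map N (take i ms)) + sum_list (map N (drop i ms)) = ?L"
      by (metis append_take_drop_id map_append sum_list_append)
    moreover have "0 \<le> sum_list (map N (drop i ms))" by (auto intro!: sum_list_nonneg N_nonneg)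
    moreover have "N (points t ms i) \<le> N t + N (sum_list (take i ms))"
      unfolding points_def using t K by (intro N_add sum_list_in_K)
    ultimately have "N (points t ms i) \<le> N t + ?L" using N_sum_list[OF K] by linarith
    then have "\<kappa> * exp (- (\<epsilon> * (N t + ?L))) \<le> \<kappa> * exp (- (\<epsilon> * N (points t ms i)))"
      using eps \<kappa>(1) by simp
    also have "\<dots> \<le> norm (z (points t ms i) - \<omega>)"
      using ne[OF that] t msK by (intro \<kappa>(2) points_in_K)
    finally show ?thesis .
  qed
  have "sum_list ys \<noteq> 0" if "ms = xs @ ys @ zs" "ys \<noteq> []" for xs ys zs
    using f_sum_list_pos[of ys] that ms f_zero by auto
  note chain_prod_ge[OF t msK this _ m]
  then have "\<kappa> * exp (- (\<epsilon> * (N t + ?L)))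
      * exp (- (\<Sum>j=1..length ms. ln 2 + b + a * (?L / real j) powr \<beta>))
      \<le> (\<Prod>i\<le>length ms. norm (z (points t ms i) - \<omega>))"
    using \<kappa>(1) by simp
  moreover have "exp (- C * real (length ms)) * exp (- (2 * \<epsilon> * (N t + ?L)))
      \<le> exp (- (\<epsilon> * (N t + ?L))) * exp (- (\<Sum>j=1..length ms. ln 2 + b + a * (?L / real j) powr \<beta>))"
  proof -
    have "(\<Sum>j=1..length ms. ln 2 + b + a * (?L / real j) powr \<beta>) \<le> \<epsilon> * ?L + C * real (length ms)"
      by (rule gap_bound[OF L])
    moreover have "0 \<le> \<epsilon> * N t" using eps N_nonneg[of t] by simp
    ultimately show ?thesis by (simp add: algebra_simps flip: exp_add)
  qed
  ultimately show ?thesis using \<kappa>(1) by (smt (verit) mult.assoc mult_left_mono)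
qed

text \<open>Since \<open>inverse 0 = 0\<close>, chains through a zero of the divisor drop out of the sum over chains.\<close>

lemma solve_cohomological:
  assumes e: "norm e = 1" and res: "nonresonant (inverse (e^2))"
    and g: "g \<in> ell1 h'" and h': "4 * \<epsilon> \<le> h'" "h' \<le> h"
    and small: "norm lam * exp (2 * C) * (\<Sum>\<^sub>\<infinity>m. norm (v m) * exp (h * N m)) < 1"
  obtains \<xi> where "\<xi> \<in> ell1 (h' - 4 * \<epsilon>)"
    "\<And>s. divisor e s \<noteq> 0 \<Longrightarrow> divisor e s * \<xi> s + lam * conv v \<xi> s = g s"
    "\<And>s. divisor e s = 0 \<Longrightarrow> \<xi> s = 0"
    "\<And>S. \<forall>t. g t \<noteq> 0 \<longrightarrow> t \<in> S \<Longrightarrow> \<forall>m. \<forall>t\<in>S. v m \<noteq> 0 \<longrightarrow> t + m \<in> S \<Longrightarrow> {s. \<xi> s \<noteq> 0} \<subseteq> S"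
proof -
  let ?\<omega> = "inverse (e^2)"
  obtain \<kappa> where \<kappa>: "0 < \<kappa>" "\<And>s. s \<in> K \<Longrightarrow> z s \<noteq> ?\<omega> \<Longrightarrow> \<kappa> * exp (- (\<epsilon> * N s)) \<le> norm (z s - ?\<omega>)"
    using res unfolding nonresonant_def by blast
  have \<kappa>1: "exp (- C) * exp (- (\<epsilon> * N s)) \<le> norm (z s - 1)" if "s \<in> K" "z s \<noteq> 1" for s
    using small_divisor_exp[of s] that z_zero by auto
  have v': "v \<in> ell1 h'" by (rule ell1_mono[OF v_ell1 h'(2)])
  have "(\<Sum>\<^sub>\<infinity>m. norm (v m) * exp (h' * N m)) \<le> (\<Sum>\<^sub>\<infinity>m. norm (v m) * exp (h * N m))"
    using v_ell1 v' h' by (intro infsum_mono) (auto simp: ell1_def intro!: mult_left_mono mult_right_mono N_nonneg)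
  then have "norm (- lam) * exp (2 * C) * (\<Sum>\<^sub>\<infinity>m. norm (v m) * exp (h' * N m))
      \<le> norm lam * exp (2 * C) * (\<Sum>\<^sub>\<infinity>m. norm (v m) * exp (h * N m))"
    by (simp add: mult_left_mono)
  with small have small': "norm (- lam) * exp (2 * C) * (\<Sum>\<^sub>\<infinity>m. norm (v m) * exp (h' * N m)) < 1"
    by linarith
  have bound: "norm (\<Prod>i\<le>length ms. inverse (divisor e (points t ms i)))
      \<le> inverse (exp (- C) * \<kappa>) * exp (2 * C) ^ length ms * exp (4 * \<epsilon> * (N t + sum_list (map N ms)))"
    if t: "g t \<noteq> 0" and ms: "\<And>m. m \<in> set ms \<Longrightarrow> v m \<noteq> 0" for t ms
  proof (cases "\<exists>i\<le>length ms. divisor e (points t ms i) = 0")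
    case True
    then have "(\<Prod>i\<le>length ms. inverse (divisor e (points t ms i))) = 0"
      by auto
    moreover have "0 \<le> inverse (exp (- C) * \<kappa>) * exp (2 * C) ^ length ms * exp (4 * \<epsilon> * (N t + sum_list (map N ms)))"
      using \<kappa>(1) by simp
    ultimately show ?thesis by (simp only: norm_zero)
  next
    case False
    let ?L = "N t + sum_list (map N ms)" and ?n = "length ms"
    have tK: "t \<in> K" using g t ell1_support by blast
    have ne: "z (points t ms i) \<noteq> 1" "z (points t ms i) \<noteq> ?\<omega>" if "i \<le> ?n" for i
      using False that norm_divisor[OF e, of "points t ms i"] by auto
    \<comment> \<open>One application with \<open>\<omega> = 1\<close>, where
      \<open>small_divisor_exp\<close> supplies the constant \<open>exp (- C)\<close>, and one with
      \<open>\<omega> = inverse (e^2)\<close> and \<open>\<kappa>\<close>. Together: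
      \<open>exp (2 * C)\<close> per step and \<open>4 * \<epsilon>\<close> per unit of
      length.\<close>
    have *: "(exp (- C) * exp (- C * real ?n) * exp (- (2 * \<epsilon> * ?L)))
        * (\<kappa> * exp (- C * real ?n) * exp (- (2 * \<epsilon> * ?L)))
        \<le> (\<Prod>i\<le>?n. norm (z (points t ms i) - 1)) * (\<Prod>i\<le>?n. norm (z (points t ms i) - ?\<omega>))"
      using \<kappa>(1)
      by (intro mult_mono chain_lower_bound \<kappa>1 \<kappa> tK ms ne prod_nonneg) auto
    have sq1: "exp (- (2 * \<epsilon> * ?L)) * exp (- (2 * \<epsilon> * ?L)) = inverse (exp (4 * \<epsilon> * ?L))"
      by (simp flip: exp_add exp_minus)
    have sq2: "exp (- C * real ?n) * exp (- C * real ?n) = inverse (exp (2 * C) ^ ?n)"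
      by (simp add: mult_ac flip: exp_add exp_minus exp_of_nat_mult)
    have "A * X * Y * (\<kappa> * X * Y) = A * \<kappa> * (X * X) * (Y * Y)" for A X Y :: real
      by (simp only: mult_ac)
    from this[of "exp (- C)" "exp (- C * real ?n)" "exp (- (2 * \<epsilon> * ?L))"]
    have eq: "exp (- C) * exp (- C * real ?n) * exp (- (2 * \<epsilon> * ?L))
        * (\<kappa> * exp (- C * real ?n) * exp (- (2 * \<epsilon> * ?L)))
        = (exp (- C) * \<kappa>) * inverse (exp (2 * C) ^ ?n) * inverse (exp (4 * \<epsilon> * ?L))"
      unfolding sq1 sq2 .
    have le: "(exp (- C) * \<kappa>) * inverse (exp (2 * C) ^ ?n) * inverse (exp (4 * \<epsilon> * ?L))
        \<le> (\<Prod>i\<le>?n. norm (divisor e (points t ms i)))"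
      using * unfolding eq norm_divisor[OF e] prod.distrib .
    have "norm (\<Prod>i\<le>?n. inverse (divisor e (points t ms i)))
        = inverse (\<Prod>i\<le>?n. norm (divisor e (points t ms i)))"
      by (simp add: norm_inverse flip: prod_norm prod_inversef)
    also have "\<dots> \<le> inverse ((exp (- C) * \<kappa>) * inverse (exp (2 * C) ^ ?n) * inverse (exp (4 * \<epsilon> * ?L)))"
      by (rule le_imp_inverse_le[OF le]) (use \<kappa>(1) in simp)
    also have "\<dots> = inverse (exp (- C) * \<kappa>) * exp (2 * C) ^ ?n * exp (4 * \<epsilon> * ?L)"
      by (simp only: inverse_mult_distrib inverse_inverse_eq)
    finally show ?thesis .
  qed
  have C2: "0 \<le> exp (2 * C)" by simp
  show ?thesis
  proof (rule solve_by_chains[OF g v' h'(1) C2 bound small'])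
    fix \<xi>
    assume \<xi>: "\<xi> \<in> ell1 (h' - 4 * \<epsilon>)"
      "\<And>s. \<xi> s = inverse (divisor e s) * (g s + (- lam) * conv v \<xi> s)"
      "\<And>S s. (\<And>t. g t \<noteq> 0 \<Longrightarrow> t \<in> S) \<Longrightarrow> (\<And>m t. v m \<noteq> 0 \<Longrightarrow> t \<in> S \<Longrightarrow> t + m \<in> S) \<Longrightarrow>
        \<xi> s \<noteq> 0 \<Longrightarrow> s \<in> S"
    show thesis
    proof (rule that[OF \<xi>(1)])
      show "divisor e s * \<xi> s + lam * conv v \<xi> s = g s" if "divisor e s \<noteq> 0" for s
      proof -
        have "divisor e s * \<xi> s = g s + (- lam) * conv v \<xi> s"
          by (subst \<xi>(2)) (use that in simp)
        then show ?thesis by simp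
      qed
      show "\<xi> s = 0" if "divisor e s = 0" for s
        by (subst \<xi>(2)) (simp add: that)
      show "{s. \<xi> s \<noteq> 0} \<subseteq> S"
        if "\<forall>t. g t \<noteq> 0 \<longrightarrow> t \<in> S" "\<forall>m. \<forall>t\<in>S. v m \<noteq> 0 \<longrightarrow> t + m \<in> S" for S
        using \<xi>(3)[of S] that by blast
    qed
  qed
qed

end

context torus_translation
begin

lemma conv_summable:
  assumes "c \<in> ell1 h" "e \<in> ell1 h" "0 \<le> h"
  shows "(\<lambda>i. c i * e (s - i)) summable_on UNIV"
proof -
  have "(\<lambda>i. norm (u i)) summable_on UNIV" if "u \<in> ell1 h" for u :: "'a \<Rightarrow> complex"
  proof -
    have "1 \<le> exp (h * N i)" for i using assms(3) N_nonneg[of i] by simp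
    then have "norm (u i) * 1 \<le> norm (u i) * exp (h * N i)" for i by (intro mult_left_mono) auto
    then show ?thesis
      using that unfolding ell1_def by (intro summable_on_comparison_test[where g = "\<lambda>i. norm (u i)"]) auto
  qed
  then show ?thesis using assms by (intro convolution_summable(1)) auto
qed

lemma conv_add:
  assumes "c \<in> ell1 h" "e \<in> ell1 h" "e' \<in> ell1 h" "0 \<le> h"
  shows "conv c (\<lambda>k. e k + e' k) s = conv c e s + conv c e' s"
  unfolding conv_def using assms
  by (simp add: distrib_left infsum_add conv_summable)

lemma conv_cmult: "conv c (\<lambda>k. u * e k) s = u * conv c e s"
proof -
  have "(\<lambda>i. c i * (u * e (s - i))) = (\<lambda>i. u * (c i * e (s - i)))" by (auto simp: mult_ac)
  then show ?thesis by (simp add: conv_def infsum_cmult_right')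
qed

lemma conv_nonzero: "conv c e s \<noteq> 0 \<Longrightarrow> \<exists>m. c m \<noteq> 0 \<and> e (s - m) \<noteq> 0"
  unfolding conv_def by (rule ccontr) (auto intro!: infsum_0)

lemma conv_single: "(\<And>i. i \<noteq> p \<Longrightarrow> c i * e (s - i) = 0) \<Longrightarrow> conv c e s = c p * e (s - p)"
  unfolding conv_def using infsum_cong_neutral[of "{p}" UNIV "\<lambda>i. c i * e (s - i)" "\<lambda>i. c i * e (s - i)"]
  by auto

lemma conv_indicator: "conv c (\<lambda>k. if k = 0 then 1 else 0) s = c s"
  by (subst conv_single[of s]) auto

end

section \<open>Pairs of Floquet solutions for potentials supported in a half space\<close>

context cone_potential
begin

text \<open>Fourier coefficients of \<open>e \<phi>(x + \<alpha>) + \<phi>(x - \<alpha>) / e + (lam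
  v(x) - e - 1 / e) \<phi>(x)\<close>. If they vanish, \<open>e^n \<phi>(x + n \<alpha>)\<close>
  solves the Schroedinger equation at energy \<open>e + 1 / e\<close>.\<close>

definition cohom :: "complex \<Rightarrow> complex \<Rightarrow> ('a \<Rightarrow> complex) \<Rightarrow> 'a \<Rightarrow> complex" where
  "cohom e lam \<phi> s = divisor e s * \<phi> s + lam * conv v \<phi> s"

text \<open>The leading \<open>1\<close> of \<open>\<phi>\<close> turns the potential into the
  source \<open>- lam * v\<close>. Zeros of the divisor with \<open>f s \<le> 0\<close> do no harm,
  because all modes of \<open>v\<close> times \<open>\<phi>\<close> have positive \<open>f\<close>;
  only zeros with \<open>0 < f s\<close> can obstruct.\<close>

lemma floquet_solution:
  assumes e: "norm e = 1" and res: "nonresonant (inverse (e^2))"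
    and small: "norm lam * exp (2 * C) * (\<Sum>\<^sub>\<infinity>m. norm (v m) * exp (h * N m)) < 1"
  obtains \<phi> where "\<phi> \<in> ell1 (h - 4 * \<epsilon>)" "\<phi> 0 = 1" "\<And>s. \<phi> s \<noteq> 0 \<Longrightarrow> s = 0 \<or> 0 < f s"
    "\<And>s. \<not> (s \<in> K \<and> 0 < f s \<and> divisor e s = 0) \<Longrightarrow> cohom e lam \<phi> s = 0"
proof -
  have h: "4 * \<epsilon> \<le> h" "0 \<le> h - 4 * \<epsilon>" using eps by linarith+
  obtain \<xi> where \<xi>: "\<xi> \<in> ell1 (h - 4 * \<epsilon>)"
    "\<And>s. divisor e s \<noteq> 0 \<Longrightarrow> divisor e s * \<xi> s + lam * conv v \<xi> s = - lam * v s"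
    "\<And>s. divisor e s = 0 \<Longrightarrow> \<xi> s = 0"
    "\<And>S. \<forall>t. - lam * v t \<noteq> 0 \<longrightarrow> t \<in> S \<Longrightarrow> \<forall>m. \<forall>t\<in>S. v m \<noteq> 0 \<longrightarrow> t + m \<in> S \<Longrightarrow> {s. \<xi> s \<noteq> 0} \<subseteq> S"
    by (rule solve_cohomological[OF e res ell1_cmult[OF v_ell1, of "- lam"] h(1) order_refl small]) blast
  have supp: "s \<in> K \<and> 0 < f s" if "\<xi> s \<noteq> 0" for s
  proof -
    have "{s. \<xi> s \<noteq> 0} \<subseteq> {s \<in> K. 0 < f s}"
      by (rule \<xi>(4)) (auto simp: v_K v_pos f_add intro: K_add add_pos_pos)
    with that show ?thesis by auto
  qed
  define \<phi> where "\<phi> s = (if s = 0 then 1 else 0) + \<xi> s" for s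
  have \<delta>: "(\<lambda>k. if k = 0 then 1 else 0) \<in> ell1 (h - 4 * \<epsilon>)"
    by (rule ell1_indicator[OF K_zero])
  have conv_\<phi>: "conv v \<phi> s = v s + conv v \<xi> s" for s
    unfolding \<phi>_def[abs_def]
    using conv_add[OF ell1_mono[OF v_ell1] \<delta> \<xi>(1), of s] h eps by (simp add: conv_indicator)
  show ?thesis
  proof
    show "\<phi> \<in> ell1 (h - 4 * \<epsilon>)" unfolding \<phi>_def[abs_def] by (rule ell1_add[OF \<delta> \<xi>(1)])
    show "\<phi> 0 = 1" using supp[of 0] f_zero by (auto simp: \<phi>_def)
    show \<phi>_supp: "s = 0 \<or> 0 < f s" if "\<phi> s \<noteq> 0" for s
      using that supp[of s] by (auto simp: \<phi>_def split: if_splits)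
    show "cohom e lam \<phi> s = 0" if s: "\<not> (s \<in> K \<and> 0 < f s \<and> divisor e s = 0)" for s
    proof (cases "divisor e s = 0")
      case True
      have "conv v \<phi> s = 0"
      proof (rule ccontr)
        assume "conv v \<phi> s \<noteq> 0"
        then obtain m where m: "v m \<noteq> 0" "\<phi> (s - m) \<noteq> 0" using conv_nonzero by blast
        then have "s - m \<in> K" "0 \<le> f (s - m)"
          using supp[of "s - m"] K_zero f_zero by (auto simp: \<phi>_def split: if_splits)
        with m(1) have "s \<in> K" "0 < f s"
          using K_add[of m "s - m"] f_add[of m "s - m"] v_K[of m] v_pos[of m] by auto
        with s True show False by simp
      qed
      with True show ?thesis by (simp add: cohom_def)
    next
      case False
      then have "s \<noteq> 0" using e by (auto simp: divisor_def z_zero)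
      then have "\<phi> s = \<xi> s" by (simp add: \<phi>_def)
      then show ?thesis using \<xi>(2)[OF False] by (simp add: cohom_def conv_\<phi> algebra_simps)
    qed
  qed
qed

text \<open>The divisor of \<open>\<phi>\<close> vanishes at \<open>p\<close>. For \<open>p \<noteq> 0\<close>, prescribing \<open>\<phi> p = 0\<close> leaves one
  unsolved equation, linear in \<open>c\<close>, which determines \<open>c\<close>; for \<open>p = 0\<close> one takes \<open>\<phi> 0 = 0\<close> and \<open>c = 1\<close>.\<close>

lemma resonant_pair:
  assumes e: "norm e = 1" and p: "p \<in> K" "0 \<le> f p" "z p = inverse (e^2)"
    and small: "norm lam * exp (2 * C) * (\<Sum>\<^sub>\<infinity>m. norm (v m) * exp (h * N m)) < 1"
  obtains \<psi> \<phi> c where "\<psi> \<in> ell1 (h - 8 * \<epsilon>)" "\<phi> \<in> ell1 (h - 8 * \<epsilon>)"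
    "\<psi> 0 = 1" "\<And>s. \<psi> s \<noteq> 0 \<Longrightarrow> s = 0 \<or> 0 < f s" "\<And>s. \<phi> s \<noteq> 0 \<Longrightarrow> s = 0 \<or> 0 < f s"
    "\<And>s. cohom (inverse e) lam \<psi> s = 0"
    "\<And>s. cohom e lam \<phi> s = c * ((z p / z s - z s) * \<psi> (s - p))"
    "inverse e * \<phi> 0 - e * \<phi> 0 - c * (if p = 0 then 1 else 0) \<noteq> 0"
proof -
  have e0: "e \<noteq> 0" using e by auto
  have e': "norm (inverse e) = 1" using e by (simp add: norm_inverse)
  have res: "nonresonant (inverse (e^2))" using nonresonant_z[OF p(1)] p(3) by simp
  have zmp: "z (- p) = inverse ((inverse e)^2)" using z_uminus[OF p(1)] p(3) by (simp add: power_inverse)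
  have res': "nonresonant (inverse ((inverse e)^2))"
    using nonresonant_z[OF K_uminus[OF p(1)]] zmp by simp
  have h: "0 \<le> h - 4 * \<epsilon>" "4 * \<epsilon> \<le> h - 4 * \<epsilon>" "h - 4 * \<epsilon> \<le> h" "h - 8 * \<epsilon> \<le> h - 4 * \<epsilon>"
    "h - 4 * \<epsilon> - 4 * \<epsilon> = h - 8 * \<epsilon>" "0 \<le> h - 8 * \<epsilon>" "h - 8 * \<epsilon> \<le> h"
    using eps by linarith+
  have D0: "divisor e s = 0 \<longleftrightarrow> s = 0 \<or> s = p" if "s \<in> K" for s
    using divisor_eq_0[OF e that] z_inject[OF that p(1)] p(3) by auto
  obtain \<psi> where \<psi>: "\<psi> \<in> ell1 (h - 4 * \<epsilon>)" "\<psi> 0 = 1" "\<And>s. \<psi> s \<noteq> 0 \<Longrightarrow> s = 0 \<or> 0 < f s"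
    "\<And>s. \<not> (s \<in> K \<and> 0 < f s \<and> divisor (inverse e) s = 0) \<Longrightarrow> cohom (inverse e) lam \<psi> s = 0"
    by (rule floquet_solution[OF e' res' small]) blast
  \<comment> \<open>For \<open>inverse e\<close> the divisor vanishes only at \<open>0\<close> and
    \<open>- p\<close>, and \<open>f (- p) \<le> 0\<close>: this solution meets no
    obstruction.\<close>
  have \<psi>0: "cohom (inverse e) lam \<psi> s = 0" for s
  proof (rule \<psi>(4))
    show "\<not> (s \<in> K \<and> 0 < f s \<and> divisor (inverse e) s = 0)"
      using divisor_eq_0[OF e', of s] z_inject[of s "- p"] zmp K_uminus[OF p(1)] f_zero
        f_uminus[OF p(1)] p(2) by auto
  qed
  \<comment> \<open>These are the coefficients of \<open>exp (i<p,x>) (\<psi>(x - \<alpha>) - z(p)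
    \<psi>(x + \<alpha>))\<close>.\<close>
  define G where "G s = (z p / z s - z s) * \<psi> (s - p)" for s
  have "norm (z p / z s - z s) \<le> 2" for s
    using norm_triangle_ineq4[of "z p / z s" "z s"] by (simp add: norm_divide norm_z)
  then have G: "G \<in> ell1 (h - 4 * \<epsilon>)"
    unfolding G_def by (rule ell1_mult[OF ell1_shift[OF \<psi>(1) p(1) h(1)]])
  have G_supp: "s \<in> K \<and> (s = p \<or> f p < f s)" if "G s \<noteq> 0" for s
  proof -
    have nz: "\<psi> (s - p) \<noteq> 0" using that by (auto simp: G_def)
    then have "s - p \<in> K" using ell1_support[OF \<psi>(1)] by blast
    then have "s \<in> K" using K_add[of "s - p" p] p by simp
    with \<psi>(3)[OF nz] show ?thesis using f_diff[OF _ p(1), of s] by auto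
  qed
  obtain \<xi> where \<xi>: "\<xi> \<in> ell1 (h - 8 * \<epsilon>)"
    "\<And>s. divisor e s \<noteq> 0 \<Longrightarrow> divisor e s * \<xi> s + lam * conv v \<xi> s = G s"
    "\<And>s. divisor e s = 0 \<Longrightarrow> \<xi> s = 0"
    "\<And>S. \<forall>t. G t \<noteq> 0 \<longrightarrow> t \<in> S \<Longrightarrow> \<forall>m. \<forall>t\<in>S. v m \<noteq> 0 \<longrightarrow> t + m \<in> S \<Longrightarrow> {s. \<xi> s \<noteq> 0} \<subseteq> S"
    by (rule solve_cohomological[OF e res G h(2,3) small, unfolded h(5)]) blast
  have \<xi>_supp: "s \<in> K \<and> s \<noteq> p \<and> f p < f s" if "\<xi> s \<noteq> 0" for s
  proof -
    have "{s. \<xi> s \<noteq> 0} \<subseteq> {s \<in> K. s = p \<or> f p < f s}"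
    proof (rule \<xi>(4))
      show "\<forall>m. \<forall>t\<in>{s \<in> K. s = p \<or> f p < f s}. v m \<noteq> 0 \<longrightarrow> t + m \<in> {s \<in> K. s = p \<or> f p < f s}"
        using v_K v_pos p(1) by (auto simp: f_add K_add intro: add_strict_mono less_trans)
    qed (use G_supp in auto)
    with that have "s \<in> K" "s = p \<or> f p < f s" by auto
    moreover have "s \<noteq> p" using \<xi>(3)[of p] D0[OF p(1)] that by auto
    ultimately show ?thesis by auto
  qed
  \<comment> \<open>All modes of \<open>\<xi>\<close> lie strictly beyond the level
    \<open>f p\<close>, and \<open>v\<close> only raises \<open>f\<close>; so nothing arrives at or
    below that level.\<close>
  have conv_\<xi>: "conv v \<xi> s = 0" if "f s \<le> f p" "s \<in> K" for s
  proof (rule ccontr)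
    assume "conv v \<xi> s \<noteq> 0"
    then obtain m where m: "v m \<noteq> 0" "\<xi> (s - m) \<noteq> 0" using conv_nonzero by blast
    then have "f p < f (s - m)" "0 < f m" using \<xi>_supp v_pos by auto
    moreover have "f (s - m) = f s - f m" using f_diff[OF that(2) v_K[OF m(1)]] .
    ultimately show False using that by simp
  qed
  have cohom_\<xi>: "cohom e lam \<xi> s = G s" if "s \<noteq> p" "s = 0 \<longrightarrow> G 0 = 0" for s
  proof (cases "divisor e s = 0")
    case False
    then show ?thesis using \<xi>(2) by (simp add: cohom_def)
  next
    case True
    show ?thesis
    proof (cases "s \<in> K")
      case sK: True
      with D0 True that have "s = 0" "G s = 0" by auto
      then show ?thesis using conv_\<xi>[of 0] True K_zero f_zero p by (simp add: cohom_def)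
    next
      case False
      then have "G s = 0" "\<xi> s = 0" using G_supp ell1_support[OF \<xi>(1)] by blast+
      moreover have "conv v \<xi> s = 0"
        using False ell1_support[OF ell1_conv[OF ell1_mono[OF v_ell1 h(7)] \<xi>(1) h(6)]] by blast
      ultimately show ?thesis by (simp add: cohom_def)
    qed
  qed
  show ?thesis
  proof (cases "p = 0")
    case True
    \<comment> \<open>For \<open>p = 0\<close> one has \<open>e^2 = 1\<close> and the two exponents
      coincide. The source then has no zero mode, \<open>\<xi>\<close> itself is the partner, and
      the Wronskian constant is \<open>- 1\<close>.\<close>
    have G0: "G 0 = 0" using True by (simp add: G_def z_zero)
    have "cohom e lam \<xi> 0 = 0"
      using conv_\<xi>[of 0] K_zero f_zero p D0[OF K_zero] by (simp add: cohom_def)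
    then have "cohom e lam \<xi> s = G s" for s using cohom_\<xi>[of s] True G0 by (cases "s = p") auto
    moreover have "\<xi> 0 = 0" using \<xi>_supp[of 0] True by auto
    ultimately show ?thesis
      using True \<xi>(1) \<psi>(2,3) \<psi>0 ell1_mono[OF \<psi>(1) h(4)] \<xi>_supp f_zero
      by (intro that[of \<psi> \<xi> 1]) (auto simp: G_def)
  next
    case False
    obtain \<eta> where \<eta>: "\<eta> \<in> ell1 (h - 4 * \<epsilon>)" "\<eta> 0 = 1" "\<And>s. \<eta> s \<noteq> 0 \<Longrightarrow> s = 0 \<or> 0 < f s"
      "\<And>s. \<not> (s \<in> K \<and> 0 < f s \<and> divisor e s = 0) \<Longrightarrow> cohom e lam \<eta> s = 0"
      by (rule floquet_solution[OF e res small]) blast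
    have \<eta>0: "cohom e lam \<eta> s = 0" if "s \<noteq> p" for s
      by (rule \<eta>(4)) (use D0 that f_zero in auto)
    have zp: "z p \<noteq> 1" using z_eq_one[OF p(1)] False by blast
    have Gp: "G p \<noteq> 0" using zp z_nonzero[of p] by (simp add: G_def \<psi>(2))
    have "\<psi> (- p) = 0" using \<psi>(3)[of "- p"] False f_uminus[OF p(1)] p(2) by auto
    then have G0: "G 0 = 0" by (simp add: G_def)
    \<comment> \<open>\<open>\<eta>\<close> fails its equation only at \<open>p\<close>, where
      \<open>cohom\<close> of \<open>\<xi>\<close> vanishes. So \<open>\<eta> + c \<xi>\<close>
      leaves \<open>cohom e lam \<eta> p\<close> there, which has to equal \<open>c * G p\<close>;
      and \<open>G p = 1 - z p\<close> is nonzero.\<close>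
    define c where "c = cohom e lam \<eta> p / G p"
    define \<phi> where "\<phi> s = \<eta> s + c * \<xi> s" for s
    have \<phi>: "\<phi> \<in> ell1 (h - 8 * \<epsilon>)"
      unfolding \<phi>_def[abs_def] by (intro ell1_add ell1_cmult \<xi>(1) ell1_mono[OF \<eta>(1) h(4)])
    have "conv v \<phi> s = conv v \<eta> s + c * conv v \<xi> s" for s
      unfolding \<phi>_def[abs_def]
      by (subst conv_add[OF ell1_mono[OF v_ell1 h(7)] ell1_mono[OF \<eta>(1) h(4)] ell1_cmult[OF \<xi>(1)] h(6)])
         (simp add: conv_cmult)
    then have lin: "cohom e lam \<phi> s = cohom e lam \<eta> s + c * cohom e lam \<xi> s" for s
      by (simp add: cohom_def \<phi>_def algebra_simps)
    have "cohom e lam \<xi> p = 0"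
      using conv_\<xi>[OF order_refl p(1)] D0[OF p(1)] by (simp add: cohom_def)
    then have "cohom e lam \<phi> s = c * G s" for s
      using cohom_\<xi>[of s] \<eta>0[of s] G0 Gp by (cases "s = p") (auto simp: lin c_def)
    moreover have "\<xi> 0 = 0" using \<xi>_supp[of 0] f_zero p(2) by auto
    then have \<phi>0: "\<phi> 0 = 1" by (simp add: \<phi>_def \<eta>(2))
    moreover have "s = 0 \<or> 0 < f s" if "\<phi> s \<noteq> 0" for s
    proof (cases "\<xi> s = 0")
      case True
      then show ?thesis using that \<eta>(3)[of s] by (auto simp: \<phi>_def)
    next
      case False
      then show ?thesis using \<xi>_supp[of s] p(2) by auto
    qed
    moreover have "inverse e - e \<noteq> 0"
    proof
      assume "inverse e - e = 0"
      then have "e^2 = 1" using e0 by (simp add: field_simps power2_eq_square)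
      with p(3) zp show False by simp
    qed
    ultimately show ?thesis
      using False \<phi> \<psi>(2,3) \<psi>0 ell1_mono[OF \<psi>(1) h(4)]
      by (intro that[of \<psi> \<phi> c]) (auto simp: G_def)
  qed
qed

text \<open>Without resonance both divisors vanish on the lattice only at \<open>0\<close>, which
  never obstructs, so both solutions are exact; \<open>e^2 \<noteq> 1\<close> keeps their Wronskian
  nonzero.\<close>

lemma nonresonant_pair:
  assumes e: "norm e = 1" "e^2 \<noteq> 1"
    and res: "nonresonant (inverse (e^2))" "nonresonant (e^2)"
    and ne: "\<And>s. s \<in> K \<Longrightarrow> s \<noteq> 0 \<Longrightarrow> z s \<noteq> e^2"
    and small: "norm lam * exp (2 * C) * (\<Sum>\<^sub>\<infinity>m. norm (v m) * exp (h * N m)) < 1"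
  obtains \<psi> \<phi> where "\<psi> \<in> ell1 (h - 8 * \<epsilon>)" "\<phi> \<in> ell1 (h - 8 * \<epsilon>)"
    "\<psi> 0 = 1" "\<And>s. \<psi> s \<noteq> 0 \<Longrightarrow> s = 0 \<or> 0 < f s" "\<And>s. \<phi> s \<noteq> 0 \<Longrightarrow> s = 0 \<or> 0 < f s"
    "\<And>s. cohom (inverse e) lam \<psi> s = 0" "\<And>s. cohom e lam \<phi> s = 0"
    "inverse e * \<phi> 0 - e * \<phi> 0 \<noteq> 0"
proof -
  have e0: "e \<noteq> 0" using e by auto
  have e': "norm (inverse e) = 1" using e by (simp add: norm_inverse)
  have h: "h - 8 * \<epsilon> \<le> h - 4 * \<epsilon>" using eps by simp
  have res': "nonresonant (inverse ((inverse e)^2))" using res(2) by (simp add: power_inverse)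
  have ne': "z s \<noteq> inverse (e^2)" if "s \<in> K" "s \<noteq> 0" for s
    using ne[of "- s"] that K_uminus[of s] z_uminus[of s] by auto
  obtain \<phi> where \<phi>: "\<phi> \<in> ell1 (h - 4 * \<epsilon>)" "\<phi> 0 = 1" "\<And>s. \<phi> s \<noteq> 0 \<Longrightarrow> s = 0 \<or> 0 < f s"
    "\<And>s. \<not> (s \<in> K \<and> 0 < f s \<and> divisor e s = 0) \<Longrightarrow> cohom e lam \<phi> s = 0"
    by (rule floquet_solution[OF e(1) res(1) small]) blast
  obtain \<psi> where \<psi>: "\<psi> \<in> ell1 (h - 4 * \<epsilon>)" "\<psi> 0 = 1" "\<And>s. \<psi> s \<noteq> 0 \<Longrightarrow> s = 0 \<or> 0 < f s"
    "\<And>s. \<not> (s \<in> K \<and> 0 < f s \<and> divisor (inverse e) s = 0) \<Longrightarrow> cohom (inverse e) lam \<psi> s = 0"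
    by (rule floquet_solution[OF e' res' small]) blast
  have "cohom e lam \<phi> s = 0" for s
    by (rule \<phi>(4)) (use divisor_eq_0[OF e(1), of s] ne'[of s] f_zero in \<open>cases "s = 0"; auto\<close>)
  moreover have "cohom (inverse e) lam \<psi> s = 0" for s
    by (rule \<psi>(4)) (use divisor_eq_0[OF e', of s] ne[of s] f_zero in \<open>cases "s = 0"; auto simp: power_inverse\<close>)
  moreover have "inverse e - e \<noteq> 0"
    using e(2) e0 by (auto simp: field_simps power2_eq_square)
  ultimately show ?thesis
    using \<phi> \<psi> ell1_mono[OF _ h] by (intro that[of \<psi> \<phi>]) auto
qed

end

section \<open>Integer vectors and the Diophantine conditions\<close>

text \<open>Cubic Taylor bound: as \<open>\<bar>u\<bar> \<le> 2\<close>, the remainder is at most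
  \<open>4 / 6\<close> of \<open>\<bar>u\<bar>\<close>, which leaves \<open>1 / 3\<close>.\<close>

lemma abs_sin_ge:
  fixes u :: real
  assumes "\<bar>u\<bar> \<le> pi / 2"
  shows "\<bar>u\<bar> / 3 \<le> \<bar>sin u\<bar>"
proof -
  have "\<bar>sin u - u\<bar> \<le> \<bar>u\<bar> ^ 3 / 6"
  proof -
    have "(\<Sum>m<3. sin_coeff m * u ^ m) = u" by (simp add: eval_nat_numeral sin_coeff_def)
    moreover have "fact 3 = (6 :: real)" by (simp add: eval_nat_numeral)
    ultimately show ?thesis using Maclaurin_sin_bound[of u 3] by simp
  qed
  moreover have "\<bar>u\<bar> ^ 3 \<le> 4 * \<bar>u\<bar>"
  proof -
    have "\<bar>u\<bar> \<le> 2" using assms pi_less_4 by simp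
    then have "\<bar>u\<bar>^2 \<le> 2^2" by (intro power_mono) auto
    then have "\<bar>u\<bar>^2 * \<bar>u\<bar> \<le> 4 * \<bar>u\<bar>" by (intro mult_right_mono) auto
    then show ?thesis by (simp add: power3_eq_cube power2_eq_square)
  qed
  ultimately show ?thesis by linarith
qed

lemma torus_norm_le:
  fixes n :: int
  shows "torus_norm t \<le> \<bar>t - 2 * pi * of_int n\<bar>"
  unfolding torus_norm_def by (intro cINF_lower bdd_belowI[of _ 0]) auto

lemma norm_cis_diff: "norm (cis x - cis y) = 2 * \<bar>sin ((x - y) / 2)\<bar>"
proof -
  have "cis x - cis y = cis ((x + y) / 2) * (cis ((x - y) / 2) - cis (- ((x - y) / 2)))"
    by (simp add: right_diff_distrib cis_mult field_simps)
  then have "norm (cis x - cis y) = norm (cis ((x - y) / 2) - cis (- ((x - y) / 2)))"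
    by (simp add: norm_mult)
  also have "cis ((x - y) / 2) - cis (- ((x - y) / 2)) = 2 * \<i> * of_real (sin ((x - y) / 2))"
    by (simp add: complex_eq_iff)
  finally show ?thesis by (simp add: norm_mult)
qed

text \<open>Turns the Diophantine conditions, stated with \<open>torus_norm\<close>, into distances
  on the unit circle, the form in which divisors occur. Subtracting the nearest multiple of
  \<open>2 * pi\<close> brings the angle into the range of \<open>abs_sin_ge\<close>.\<close>

lemma torus_norm_le_cis: "torus_norm (x - y) / 3 \<le> norm (cis x - cis y)"
proof -
  define n where "n = round ((x - y) / (2 * pi))"
  define u where "u = x - y - 2 * pi * of_int n"
  have "\<bar>of_int n - (x - y) / (2 * pi)\<bar> \<le> 1 / 2" unfolding n_def by (rule of_int_round_abs_le)
  then have "2 * pi * \<bar>of_int n - (x - y) / (2 * pi)\<bar> \<le> 2 * pi * (1 / 2)" by (intro mult_left_mono) auto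
  also have "2 * pi * \<bar>of_int n - (x - y) / (2 * pi)\<bar> = \<bar>2 * pi * (of_int n - (x - y) / (2 * pi))\<bar>"
    by (simp add: abs_mult)
  also have "2 * pi * (of_int n - (x - y) / (2 * pi)) = - u"
    by (simp add: u_def field_simps)
  finally have u: "\<bar>u\<bar> \<le> pi" by simp
  have "torus_norm (x - y) \<le> \<bar>u\<bar>" unfolding u_def by (rule torus_norm_le)
  also have "\<dots> \<le> 6 * \<bar>sin (u / 2)\<bar>" using abs_sin_ge[of "u / 2"] u by simp
  also have "\<bar>sin (u / 2)\<bar> = \<bar>sin ((x - y) / 2)\<bar>"
  proof -
    have "u / 2 = (x - y) / 2 - pi * of_int n" by (simp add: u_def field_simps)
    then have "sin (u / 2) = sin ((x - y) / 2) * cos (pi * of_int n) - cos ((x - y) / 2) * sin (pi * of_int n)"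
      by (simp only: sin_diff)
    then show ?thesis by (simp add: sin_npi_int cos_npi_int abs_mult)
  qed
  finally show ?thesis by (simp add: norm_cis_diff)
qed

section \<open>Integer vectors of finite weight and the lower bound for the Diophantine
  product\<close>

lemma jb_ge_1: "1 \<le> jb j"
  by (simp add: jb_def)

lemma jb_powr_ge_1: "0 \<le> \<eta> \<Longrightarrow> 1 \<le> jb j powr \<eta>"
  by (rule ge_one_powr_ge_zero[OF jb_ge_1])

lemma kweight_nonneg: "0 \<le> kweight \<eta> k j"
  by (simp add: kweight_def)

lemma kweight_ge_1: "0 \<le> \<eta> \<Longrightarrow> k j \<noteq> 0 \<Longrightarrow> 1 \<le> kweight \<eta> k j"
  unfolding kweight_def using mult_mono[OF jb_powr_ge_1[of \<eta> j], of 1 "\<bar>real_of_int (k j)\<bar>"] by auto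

text \<open>Each nonzero coordinate contributes at least \<open>1\<close> to the convergent sum,
  which bounds the size of the support.\<close>

lemma ivecs_finite:
  assumes "0 \<le> \<eta>" "k \<in> ivecs d \<eta>"
  shows "finite {j. k j \<noteq> 0}"
proof (rule finite_if_finite_subsets_card_bdd[THEN conjunct1])
  fix F assume F: "F \<subseteq> {j. k j \<noteq> 0}" "finite F"
  have "F \<subseteq> coords d" using F assms(2) by (auto simp: ivecs_def)
  then have "(\<Sum>j\<in>F. kweight \<eta> k j) \<le> infsum (kweight \<eta> k) (coords d)"
    using assms(2) F by (intro finite_sum_le_infsum) (auto simp: ivecs_def kweight_nonneg)
  moreover have "(\<Sum>j\<in>F. 1) \<le> (\<Sum>j\<in>F. kweight \<eta> k j)"
    using F assms(1) by (intro sum_mono kweight_ge_1) auto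
  ultimately show "card F \<le> nat \<lceil>infsum (kweight \<eta> k) (coords d)\<rceil>"
    using F by (auto simp: le_nat_iff le_ceiling_iff)
qed

lemma ivecs_iff:
  assumes "0 \<le> \<eta>"
  shows "k \<in> ivecs d \<eta> \<longleftrightarrow> {j. k j \<noteq> 0} \<subseteq> coords d \<and> finite {j. k j \<noteq> 0}"
proof
  assume k: "{j. k j \<noteq> 0} \<subseteq> coords d \<and> finite {j. k j \<noteq> 0}"
  then have "kweight \<eta> k summable_on coords d"
    by (intro finite_nonzero_values_imp_summable_on) (auto simp: kweight_def elim: rev_finite_subset)
  with k show "k \<in> ivecs d \<eta>" by (auto simp: ivecs_def)
qed (use ivecs_finite[OF assms] in \<open>auto simp: ivecs_def\<close>)

lemma kabs_eq_sum:
  assumes "0 \<le> \<eta>" "k \<in> ivecs d \<eta>" "finite F" "{j. k j \<noteq> 0} \<subseteq> F"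
  shows "kabs d \<eta> k = (\<Sum>j\<in>F. kweight \<eta> k j)"
proof -
  have "infsum (kweight \<eta> k) (coords d) = infsum (kweight \<eta> k) F"
    using assms by (intro infsum_cong_neutral) (auto simp: ivecs_iff kweight_def)
  with assms(3) show ?thesis by (simp add: kabs_def)
qed

lemma kabs_nonneg: "0 \<le> kabs d \<eta> k"
  unfolding kabs_def by (intro infsum_nonneg kweight_nonneg)

lemma kweight_zero: "kweight \<eta> 0 = (\<lambda>j. 0)"
  by (simp add: kweight_def fun_eq_iff)

lemma kweight_uminus: "kweight \<eta> (- k) = kweight \<eta> k"
  by (simp add: kweight_def fun_eq_iff)

lemma ivecs_zero: "0 \<in> ivecs d \<eta>"
  by (simp add: ivecs_def kweight_zero)

lemma ivecs_uminus: "k \<in> ivecs d \<eta> \<Longrightarrow> - k \<in> ivecs d \<eta>"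
  by (simp add: ivecs_def kweight_uminus)

lemma ivecs_add:
  assumes "0 \<le> \<eta>" "k \<in> ivecs d \<eta>" "l \<in> ivecs d \<eta>"
  shows "k + l \<in> ivecs d \<eta>"
proof -
  have "{j. (k + l) j \<noteq> 0} \<subseteq> {j. k j \<noteq> 0} \<union> {j. l j \<noteq> 0}" by auto
  then show ?thesis
    using assms by (auto simp: ivecs_iff intro: finite_subset)
qed

lemma kabs_zero: "kabs d \<eta> 0 = 0"
  by (simp add: kabs_def kweight_zero)

lemma kabs_uminus: "kabs d \<eta> (- k) = kabs d \<eta> k"
  by (simp add: kabs_def kweight_uminus)

lemma kabs_add:
  assumes "0 \<le> \<eta>" "k \<in> ivecs d \<eta>" "l \<in> ivecs d \<eta>"
  shows "kabs d \<eta> (k + l) \<le> kabs d \<eta> k + kabs d \<eta> l"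
proof -
  define F where "F = {j. k j \<noteq> 0} \<union> {j. l j \<noteq> 0}"
  have F: "finite F" "{j. k j \<noteq> 0} \<subseteq> F" "{j. l j \<noteq> 0} \<subseteq> F" "{j. (k + l) j \<noteq> 0} \<subseteq> F"
    using assms by (auto simp: F_def ivecs_finite)
  have "kweight \<eta> (k + l) j \<le> kweight \<eta> k j + kweight \<eta> l j" for j
    unfolding kweight_def distrib_left[symmetric] by (intro mult_left_mono) auto
  then show ?thesis
    using assms F by (simp add: kabs_eq_sum[of _ _ _ F] ivecs_add sum_mono flip: sum.distrib)
qed

lemma ivecs_star_iff:
  assumes "0 \<le> \<eta>"
  shows "k \<in> ivecs_star d \<eta> \<longleftrightarrow> k \<in> ivecs d \<eta> \<and> k \<noteq> 0"
proof -
  have "0 < kabs d \<eta> k" if k: "k \<in> ivecs d \<eta>" "k \<noteq> 0"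
  proof -
    obtain j where j: "k j \<noteq> 0" using k(2) by (auto simp: fun_eq_iff)
    have "1 \<le> kweight \<eta> k j" using assms j by (rule kweight_ge_1)
    also have "\<dots> \<le> (\<Sum>j\<in>{j. k j \<noteq> 0}. kweight \<eta> k j)"
      using j assms k by (intro member_le_sum) (auto simp: kweight_nonneg ivecs_finite)
    also have "\<dots> = kabs d \<eta> k" using assms k by (simp add: kabs_eq_sum[where F = "{j. k j \<noteq> 0}"] ivecs_finite)
    finally show ?thesis by simp
  qed
  then show ?thesis by (auto simp: ivecs_star_def kabs_zero)
qed

text \<open>Lets unordered Fourier sums be written as ordinary series, for termwise integration and
  for uniform limits.\<close>

lemma countable_ivecs:
  assumes "0 \<le> \<eta>"
  shows "countable (ivecs d \<eta>)"
proof -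
  have "countable {k :: nat \<Rightarrow> int. \<forall>j. n \<le> j \<longrightarrow> k j = 0}" for n
  proof -
    have "countable ((\<lambda>k. restrict k {..<n}) ` {k :: nat \<Rightarrow> int. \<forall>j. n \<le> j \<longrightarrow> k j = 0})"
    proof (rule countable_subset)
      show "(\<lambda>k. restrict k {..<n}) ` {k :: nat \<Rightarrow> int. \<forall>j. n \<le> j \<longrightarrow> k j = 0} \<subseteq> ({..<n} \<rightarrow>\<^sub>E UNIV)"
        by (intro image_subsetI) (simp add: restrict_PiE_iff)
      show "countable ({..<n} \<rightarrow>\<^sub>E (UNIV :: int set))" by (intro countable_PiE) auto
    qed
    moreover have "inj_on (\<lambda>k. restrict k {..<n}) {k :: nat \<Rightarrow> int. \<forall>j. n \<le> j \<longrightarrow> k j = 0}"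
    proof (rule inj_onI, rule ext)
      fix k l :: "nat \<Rightarrow> int" and j
      assume "k \<in> {k. \<forall>j. n \<le> j \<longrightarrow> k j = 0}" "l \<in> {k. \<forall>j. n \<le> j \<longrightarrow> k j = 0}"
        and "restrict k {..<n} = restrict l {..<n}"
      then show "k j = l j" by (cases "j < n") (auto dest: fun_cong[of _ _ j])
    qed
    ultimately show ?thesis by (rule countable_image_inj_on)
  qed
  moreover have "ivecs d \<eta> \<subseteq> (\<Union>n. {k. \<forall>j. n \<le> j \<longrightarrow> k j = 0})"
  proof
    fix k assume "k \<in> ivecs d \<eta>"
    then have "finite {j. k j \<noteq> 0}" using assms by (intro ivecs_finite)
    then obtain n where "\<forall>j\<in>{j. k j \<noteq> 0}. j < n" using finite_nat_set_iff_bounded by blast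
    then have "\<forall>j. n \<le> j \<longrightarrow> k j = 0" by (auto simp flip: not_less)
    then show "k \<in> (\<Union>n. {k. \<forall>j. n \<le> j \<longrightarrow> k j = 0})" by blast
  qed
  ultimately show ?thesis by (meson countable_UN countable_subset uncountable_def UNIV_I countableI_type)
qed

lemma pairing_eq_sum: "finite F \<Longrightarrow> {j. k j \<noteq> 0} \<subseteq> F \<Longrightarrow> pairing k x = (\<Sum>j\<in>F. of_int (k j) * x j)"
  unfolding pairing_def by (intro sum.mono_neutral_left) auto

lemma pairing_add:
  assumes "0 \<le> \<eta>" "k \<in> ivecs d \<eta>" "l \<in> ivecs d \<eta>"
  shows "pairing (k + l) x = pairing k x + pairing l x"
proof -
  define F where "F = {j. k j \<noteq> 0} \<union> {j. l j \<noteq> 0}"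
  have "finite F" "{j. k j \<noteq> 0} \<subseteq> F" "{j. l j \<noteq> 0} \<subseteq> F" "{j. (k + l) j \<noteq> 0} \<subseteq> F"
    using assms by (auto simp: F_def ivecs_finite)
  then show ?thesis by (simp add: pairing_eq_sum[of F] distrib_right sum.distrib)
qed

lemma pairing_zero: "pairing 0 x = 0"
  by (simp add: pairing_def)

lemma pairing_uminus: "pairing (- k) x = - pairing k x"
  by (simp add: pairing_def sum_negf)

lemma pairing_of_real: "pairing k (\<lambda>j. complex_of_real (x j)) = of_real (pairing k x)"
  by (simp add: pairing_def)

text \<open>Split at \<open>J\<close> with \<open>J * J powr \<eta> = N\<close>: at most
  \<open>J\<close> indices lie at or below it, and each one above costs at least
  \<open>J powr \<eta>\<close>, so there are at most \<open>J\<close> of those too.\<close>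

lemma card_le_of_sum_powr:
  fixes A :: "nat set" and N \<eta> :: real
  assumes "finite A" "A \<subseteq> {1..}" "0 < \<eta>" "(\<Sum>j\<in>A. real j powr \<eta>) \<le> N" "1 \<le> N"
  shows "real (card A) \<le> 2 * N powr (1 / (1 + \<eta>))"
proof -
  define J where "J = N powr (1 / (1 + \<eta>))"
  have J: "0 < J" using assms by (simp add: J_def)
  have "A \<inter> {j. real j \<le> J} \<subseteq> {1..nat \<lfloor>J\<rfloor>}"
    using assms(2) by (auto simp: le_nat_floor)
  then have "card (A \<inter> {j. real j \<le> J}) \<le> nat \<lfloor>J\<rfloor>"
    using card_mono[of "{1..nat \<lfloor>J\<rfloor>}"] by force
  then have 1: "real (card (A \<inter> {j. real j \<le> J})) \<le> J"
    using J by (meson of_nat_floor le_trans of_nat_le_iff less_imp_le order_trans)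
  let ?B = "A \<inter> {j. J < real j}"
  have "real (card ?B) * J powr \<eta> = (\<Sum>j\<in>?B. J powr \<eta>)" by simp
  also have "\<dots> \<le> (\<Sum>j\<in>?B. real j powr \<eta>)"
    using assms J by (intro sum_mono powr_mono2) auto
  also have "\<dots> \<le> (\<Sum>j\<in>A. real j powr \<eta>)" using assms by (intro sum_mono2) auto
  also have "\<dots> \<le> N" by fact
  also have "N = J * J powr \<eta>"
  proof -
    have "J * J powr \<eta> = J powr (1 + \<eta>)" using J by (simp add: powr_add)
    also have "\<dots> = N" using assms by (simp add: J_def powr_powr)
    finally show ?thesis by simp
  qed
  finally have 2: "real (card ?B) \<le> J" using J by simp
  have "card A \<le> card (A \<inter> {j. real j \<le> J}) + card ?B"
    by (rule order_trans[OF card_mono card_Un_le]) (use assms in auto)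
  with 1 2 show ?thesis unfolding J_def by linarith
qed

lemma dioph_weight_ge:
  assumes "0 < \<eta>" "0 < \<tau>"
  obtains a \<beta> where "0 \<le> a" "0 < \<beta>" "\<beta> < 1"
    "\<And>d k. k \<in> ivecs d \<eta> \<Longrightarrow> exp (- (a * kabs d \<eta> k powr \<beta>)) \<le> dioph_weight \<tau> k"
proof -
  \<comment> \<open>\<open>s\<close> takes half of the room \<open>\<eta> / (1 + \<eta>)\<close>
    that \<open>1 / (1 + \<eta>)\<close> leaves below \<open>1\<close>. In \<open>A\<close>,
    \<open>ln 2\<close> pays for \<open>1 + y \<le> 2 * y\<close> with \<open>1 \<le> y\<close>; the
    rest pays for the logarithms of \<open>jb j\<close> and \<open>\<bar>k j\<bar>\<close>, at most
    \<open>1 / \<eta>\<close> and \<open>1\<close> times that of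
    \<open>kweight \<eta> k j\<close>.\<close>
  define s where "s = \<eta> / (2 * (1 + \<eta>))"
  define \<beta> where "\<beta> = 1 / (1 + \<eta>) + s"
  define A where "A = ln 2 + \<tau> * (1 + 1 / \<eta>) / s"
  have s: "0 < s" using assms by (simp add: s_def)
  then have A: "0 < A" using assms by (auto simp: A_def intro!: add_pos_nonneg)
  have "\<beta> = (2 + \<eta>) / (2 + 2 * \<eta>)" using assms by (simp add: \<beta>_def s_def divide_simps) (simp add: algebra_simps)
  then have \<beta>: "0 < \<beta>" "\<beta> < 1" using assms by simp_all
  have "exp (- (2 * A * kabs d \<eta> k powr \<beta>)) \<le> dioph_weight \<tau> k" if k: "k \<in> ivecs d \<eta>" for d k
  proof (cases "k = 0")
    case False
    let ?S = "{j. k j \<noteq> 0}" and ?N = "kabs d \<eta> k"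
    have fin: "finite ?S" using assms by (intro ivecs_finite[OF _ k]) simp
    have S: "?S \<subseteq> {1..}" using k by (auto simp: ivecs_def coords_def)
    have N: "?N = (\<Sum>j\<in>?S. kweight \<eta> k j)" using assms k fin by (simp add: kabs_eq_sum)
    have le_N: "kweight \<eta> k j \<le> ?N" if "j \<in> ?S" for j
      unfolding N using that fin by (intro member_le_sum) (auto simp: kweight_nonneg)
    have ge1: "1 \<le> kweight \<eta> k j" if "j \<in> ?S" for j using that assms by (intro kweight_ge_1) auto
    obtain j0 where "j0 \<in> ?S" using False by (auto simp: fun_eq_iff)
    then have N1: "1 \<le> ?N" using ge1 le_N by force
    have "(\<Sum>j\<in>?S. real j powr \<eta>) \<le> ?N"
      unfolding N
    proof (intro sum_mono)
      fix j assume j: "j \<in> ?S"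
      then have "jb j = real j" using S by (auto simp: jb_def)
      moreover have "real j powr \<eta> * 1 \<le> real j powr \<eta> * \<bar>real_of_int (k j)\<bar>"
        using j by (intro mult_left_mono) auto
      ultimately show "real j powr \<eta> \<le> kweight \<eta> k j" by (simp add: kweight_def)
    qed
    then have card: "real (card ?S) \<le> 2 * ?N powr (1 / (1 + \<eta>))"
      using fin S assms N1 by (intro card_le_of_sum_powr)
    have fac: "exp (- (A * ?N powr s)) \<le> 1 / (1 + jb j powr \<tau> * \<bar>real_of_int (k j)\<bar> powr \<tau>)"
      if j: "j \<in> ?S" for j
    proof -
      let ?q = "\<bar>real_of_int (k j)\<bar>" and ?Y = "kweight \<eta> k j"
      have q: "1 \<le> ?q" using j by simp
      have jq: "jb j powr \<eta> \<le> ?Y" "?q \<le> ?Y"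
        unfolding kweight_def using q jb_powr_ge_1[of \<eta> j] assms
          mult_left_mono[of 1 ?q "jb j powr \<eta>"] mult_right_mono[of 1 "jb j powr \<eta>" ?q] by auto
      have "\<eta> * ln (jb j) \<le> ln ?Y"
        using jq(1) jb_ge_1[of j] ge1[OF j] by (simp flip: ln_powr)
      then have 1: "ln (jb j) \<le> ln ?Y / \<eta>" using assms by (simp add: field_simps)
      have 2: "ln ?q \<le> ln ?Y" using jq(2) q by (subst ln_le_cancel_iff) auto
      have "ln ?Y \<le> ?Y powr s / s" using ge1[OF j] s by (rule ln_powr_bound)
      also have "\<dots> \<le> ?N powr s / s"
        using s ge1[OF j] le_N[OF j] by (intro divide_right_mono powr_mono2) auto
      finally have Y: "ln ?Y \<le> ?N powr s / s" .
      have "ln (jb j) + ln ?q \<le> (1 + 1 / \<eta>) * ln ?Y" using 1 2 by (simp add: algebra_simps)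
      also have "\<dots> \<le> (1 + 1 / \<eta>) * (?N powr s / s)" using Y assms by (intro mult_left_mono) auto
      finally have "\<tau> * (ln (jb j) + ln ?q) \<le> \<tau> * ((1 + 1 / \<eta>) * (?N powr s / s))"
        using assms by (intro mult_left_mono) auto
      moreover have "ln 2 * 1 \<le> ln 2 * ?N powr s"
        using N1 s by (intro mult_left_mono ge_one_powr_ge_zero) auto
      moreover have "A * ?N powr s = ln 2 * ?N powr s + \<tau> * ((1 + 1 / \<eta>) * (?N powr s / s))"
        by (simp add: A_def distrib_right)
      ultimately have "ln 2 + \<tau> * (ln (jb j) + ln ?q) \<le> A * ?N powr s" by linarith
      then have "exp (ln 2 + \<tau> * (ln (jb j) + ln ?q)) \<le> exp (A * ?N powr s)" by simp
      also have "exp (ln 2 + \<tau> * (ln (jb j) + ln ?q)) = 2 * (jb j powr \<tau> * ?q powr \<tau>)"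
        using jb_ge_1[of j] q by (simp add: exp_add powr_def distrib_left)
      finally have "2 * (jb j powr \<tau> * ?q powr \<tau>) \<le> exp (A * ?N powr s)" .
      moreover have "1 \<le> jb j powr \<tau> * ?q powr \<tau>"
        using mult_mono[of 1 "jb j powr \<tau>" 1 "?q powr \<tau>"] jb_powr_ge_1[of \<tau> j]
          ge_one_powr_ge_zero[OF q, of \<tau>] assms by simp
      ultimately have "1 + jb j powr \<tau> * ?q powr \<tau> \<le> exp (A * ?N powr s)" by linarith
      then have "inverse (exp (A * ?N powr s)) \<le> inverse (1 + jb j powr \<tau> * ?q powr \<tau>)"
        by (intro le_imp_inverse_le) (auto intro: add_pos_nonneg)
      then show ?thesis by (simp add: exp_minus inverse_eq_divide)
    qed
    have "real (card ?S) * (A * ?N powr s) \<le> 2 * ?N powr (1 / (1 + \<eta>)) * (A * ?N powr s)"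
      using card A by (intro mult_right_mono) auto
    also have "\<dots> = 2 * A * ?N powr \<beta>" by (simp add: \<beta>_def powr_add)
    finally have "exp (- (2 * A * ?N powr \<beta>)) \<le> exp (real (card ?S) * (- (A * ?N powr s)))" by simp
    also have "\<dots> = (\<Prod>j\<in>?S. exp (- (A * ?N powr s)))" by (simp only: prod_constant exp_of_nat_mult)
    also have "\<dots> \<le> dioph_weight \<tau> k"
      unfolding dioph_weight_def by (intro prod_mono conjI fac) auto
    finally show ?thesis .
  qed (use A in \<open>simp add: dioph_weight_def\<close>)
  then show ?thesis using A \<beta> by (intro that[of "2 * A" \<beta>]) auto
qed

section \<open>Characters and Fourier series on the torus\<close>

lemma pairing_vadd:
  assumes "0 \<le> \<eta>" "k \<in> ivecs d \<eta>"
  shows "pairing k (vadd d x y) = pairing k x + pairing k y"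
proof -
  have "(\<Sum>j | k j \<noteq> 0. of_int (k j) * vadd d x y j) = (\<Sum>j | k j \<noteq> 0. of_int (k j) * x j + of_int (k j) * y j)"
    using assms by (intro sum.cong) (auto simp: vadd_def ivecs_iff distrib_left)
  then show ?thesis by (simp add: pairing_def sum.distrib)
qed

lemma torus_char_zero: "torus_char m 0 x = 1"
  by (simp add: torus_char_def pairing_zero)

lemma torus_char_add:
  "0 \<le> \<eta> \<Longrightarrow> k \<in> ivecs d \<eta> \<Longrightarrow> l \<in> ivecs d \<eta> \<Longrightarrow>
    torus_char m (k + l) x = torus_char m k x * torus_char m l x"
  by (simp add: torus_char_def pairing_add distrib_left add_divide_distrib exp_add)

lemma torus_char_vadd:
  "0 \<le> \<eta> \<Longrightarrow> k \<in> ivecs d \<eta> \<Longrightarrow> torus_char m k (vadd d x y) = torus_char m k x * torus_char m k y"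
  by (simp add: torus_char_def pairing_vadd distrib_left add_divide_distrib exp_add)

lemma torus_char_periodic:
  assumes "0 \<le> \<eta>" "k \<in> ivecs d \<eta>" "0 < m"
  shows "torus_char m k (vadd d x (\<lambda>j. of_real (2 * pi * real m * of_int (n j)))) = torus_char m k x"
proof -
  have "\<i> * pairing k (\<lambda>j. complex_of_real (2 * pi * real m * of_int (n j))) / of_nat m
      = of_real (2 * of_int (\<Sum>j | k j \<noteq> 0. k j * n j) * pi) * \<i>"
    using assms(3) unfolding pairing_def
    by (simp add: sum_distrib_left sum_distrib_right sum_divide_distrib mult_ac)
  then have "torus_char m k (\<lambda>j. of_real (2 * pi * real m * of_int (n j))) = 1"
    unfolding torus_char_def using exp_integer_2pi[OF Ints_of_int] by (simp only:)
  then show ?thesis by (simp add: torus_char_vadd[OF assms(1,2)])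
qed

text \<open>The strip has half-width \<open>h * jb j powr \<eta>\<close> in direction
  \<open>j\<close>, matching the weight of \<open>k j\<close> in \<open>kabs\<close>.\<close>

lemma norm_torus_char_le:
  assumes "0 \<le> \<eta>" "k \<in> ivecs d \<eta>" "x \<in> strip d \<eta> h"
  shows "norm (torus_char m k x) \<le> exp (h * kabs d \<eta> k / real m)"
proof -
  have fin: "finite {j. k j \<noteq> 0}" using assms by (simp add: ivecs_finite[OF assms(1,2)])
  have "\<bar>Im (pairing k x)\<bar> = \<bar>\<Sum>j | k j \<noteq> 0. of_int (k j) * Im (x j)\<bar>"
    by (simp add: pairing_def)
  also have "\<dots> \<le> (\<Sum>j | k j \<noteq> 0. \<bar>of_int (k j) * Im (x j)\<bar>)" by (rule sum_abs)
  also have "\<dots> \<le> (\<Sum>j | k j \<noteq> 0. h * kweight \<eta> k j)"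
  proof (intro sum_mono)
    fix j assume "j \<in> {j. k j \<noteq> 0}"
    then have "j \<in> coords d" using assms by (auto simp: ivecs_iff)
    then have "\<bar>Im (x j)\<bar> \<le> h * jb j powr \<eta>" using assms(3) by (auto simp: strip_def intro: less_imp_le)
    then have "\<bar>real_of_int (k j)\<bar> * \<bar>Im (x j)\<bar> \<le> \<bar>real_of_int (k j)\<bar> * (h * jb j powr \<eta>)"
      by (intro mult_left_mono) auto
    then show "\<bar>of_int (k j) * Im (x j)\<bar> \<le> h * kweight \<eta> k j"
      by (simp add: kweight_def abs_mult mult_ac)
  qed
  also have "\<dots> = h * kabs d \<eta> k"
    using fin assms by (simp add: kabs_eq_sum[OF assms(1,2) fin order_refl] sum_distrib_left)
  finally have "- Im (pairing k x) / real m \<le> h * kabs d \<eta> k / real m"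
    by (intro divide_right_mono) auto
  moreover have "Re (\<i> * pairing k x / of_nat m) = - Im (pairing k x) / real m"
    by (metis Re_divide_of_nat Re_i_times)
  ultimately show ?thesis by (simp add: torus_char_def norm_exp_eq_Re)
qed

definition real_point :: "enat \<Rightarrow> (nat \<Rightarrow> real) \<Rightarrow> nat \<Rightarrow> complex" where
  "real_point d x = (\<lambda>j\<in>coords d. complex_of_real (x j))"

lemma real_point_in_strip: "0 < h \<Longrightarrow> real_point d x \<in> strip d \<eta> h"
  unfolding strip_def real_point_def using jb_ge_1
  by (auto intro!: mult_pos_pos) (metis less_le_trans powr_gt_zero zero_less_one less_numeral_extra(3))

lemma torus_char_real_point:
  assumes "0 \<le> \<eta>" "k \<in> ivecs d \<eta>"
  shows "torus_char m k (real_point d x) = (\<Prod>j | k j \<noteq> 0. cis (of_int (k j) * x j / real m))"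
proof -
  have "torus_char m k (real_point d x) = exp (\<Sum>j | k j \<noteq> 0. \<i> * of_real (of_int (k j) * x j / real m))"
    unfolding torus_char_def pairing_def
    using assms by (auto simp: sum_distrib_left sum_divide_distrib real_point_def ivecs_iff intro!: arg_cong[where f = exp] sum.cong)
  also have "\<dots> = (\<Prod>j | k j \<noteq> 0. cis (of_int (k j) * x j / real m))"
    using assms by (simp only: exp_sum[OF ivecs_finite[OF assms]] cis_conv_exp)
  finally show ?thesis .
qed

lemma norm_torus_char_real_point:
  "0 \<le> \<eta> \<Longrightarrow> k \<in> ivecs d \<eta> \<Longrightarrow> norm (torus_char m k (real_point d x)) = 1"
  by (simp add: torus_char_real_point flip: prod_norm)

section \<open>Normalized measure on the torus and orthogonality of the characters\<close>

abbreviation circle_measure :: "nat \<Rightarrow> real measure" where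
  "circle_measure m \<equiv> uniform_measure lborel {0..2 * pi * real m}"

lemma prob_space_circle: "0 < m \<Longrightarrow> prob_space (circle_measure m)"
  by (rule prob_space_uniform_measure) auto

lemma integral_circle_cis:
  assumes "0 < m" "k \<noteq> 0"
  shows "(\<integral>t. cis (of_int k * t / real m) \<partial>circle_measure m) = 0"
proof -
  let ?c = "real_of_int k / real m" and ?A = "{0..2 * pi * real m}"
  have "circle_measure m = density lborel (\<lambda>t. ennreal (indicator ?A t / (2 * pi * real m)))"
    unfolding uniform_measure_def
    by (intro arg_cong[where f = "density lborel"] ext)
       (use assms in \<open>auto simp: indicator_def divide_ennreal[symmetric]\<close>)
  moreover have [measurable]: "(\<lambda>t. cis (of_int k * t / real m)) \<in> borel_measurable borel"
    by (intro borel_measurable_continuous_onI continuous_intros) (use assms in auto)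
  ultimately have "(\<integral>t. cis (of_int k * t / real m) \<partial>circle_measure m)
      = (\<integral>t. (indicator ?A t / (2 * pi * real m)) *\<^sub>R cis (of_int k * t / real m) \<partial>lborel)"
    by (simp add: integral_density)
  also have "\<dots> = (\<integral>t. indicator ?A t *\<^sub>R (cis (of_int k * t / real m) / (2 * pi * real m)) \<partial>lborel)"
    by (intro Bochner_Integration.integral_cong) (auto simp: scaleR_conv_of_real field_simps)
  also have "\<dots> = cis (?c * (2 * pi * real m)) / (\<i> * ?c * (2 * pi * real m))
      - cis (?c * 0) / (\<i> * ?c * (2 * pi * real m))"
  proof (rule integral_FTC_Icc)
    fix t :: real
    have "((\<lambda>t. exp (\<i> * of_real ?c * of_real t) / (\<i> * ?c * (2 * pi * real m))) has_vector_derivative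
        exp (\<i> * of_real ?c * of_real t) * (\<i> * of_real ?c) / (\<i> * ?c * (2 * pi * real m))) (at t within ?A)"
      by (intro has_vector_derivative_divide has_vector_derivative_real_field derivative_eq_intros) auto
    then show "((\<lambda>t. cis (?c * t) / (\<i> * ?c * (2 * pi * real m))) has_vector_derivative
        cis (of_int k * t / real m) / (2 * pi * real m)) (at t within ?A)"
      using assms by (simp add: cis_conv_exp mult_ac)
  qed (use assms in \<open>auto intro!: continuous_intros\<close>)
  also have "?c * (2 * pi * real m) = 2 * pi * of_int k" using assms by simp
  also have "cis (2 * pi * of_int k) = cis (?c * 0)"
    using cis_multiple_2pi[of "of_int k"] by (simp add: Ints_of_int)
  finally show ?thesis by simp
qed

lemma product_prob_space_circle: "0 < m \<Longrightarrow> product_prob_space (\<lambda>_. circle_measure m)"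
  by (simp add: product_prob_space_def product_prob_space_axioms_def product_sigma_finite_def
      prob_space_circle prob_space_imp_sigma_finite)

lemma prob_space_torus:
  assumes "0 < m"
  shows "prob_space (torus_measure m d)"
proof -
  interpret product_prob_space "\<lambda>_. circle_measure m" "coords d"
    by (rule product_prob_space_circle[OF assms])
  show ?thesis unfolding torus_measure_def by (rule P.prob_space_axioms)
qed

context
  fixes m :: nat and d :: enat and \<eta> :: real
  assumes m: "0 < m" and \<eta>: "0 \<le> \<eta>"
begin

interpretation product_prob_space "\<lambda>_. circle_measure m" "coords d"
  by (rule product_prob_space_circle[OF m])

lemma borel_measurable_torus_char:
  assumes "k \<in> ivecs d \<eta>"
  shows "(\<lambda>x. torus_char m k (real_point d x)) \<in> borel_measurable (torus_measure m d)"
proof -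
  have [measurable]: "(\<lambda>t. cis (of_int (k j) * t / real m)) \<in> borel_measurable borel" for j
    by (intro borel_measurable_continuous_onI continuous_intros) (use m in auto)
  show ?thesis
    unfolding torus_char_real_point[OF \<eta> assms] torus_measure_def
  proof (rule borel_measurable_prod)
    fix j assume "j \<in> {j. k j \<noteq> 0}"
    then have "j \<in> coords d" using assms \<eta> by (auto simp: ivecs_iff)
    then have "(\<lambda>x. x j) \<in> PiM (coords d) (\<lambda>_. circle_measure m) \<rightarrow>\<^sub>M circle_measure m"
      by (rule measurable_component_singleton)
    then have "(\<lambda>x. x j) \<in> PiM (coords d) (\<lambda>_. circle_measure m) \<rightarrow>\<^sub>M borel"
      by (simp add: measurable_cong_sets[OF refl, of "circle_measure m" borel])
    then show "(\<lambda>x. cis (of_int (k j) * x j / real m)) \<in> borel_measurable (PiM (coords d) (\<lambda>_. circle_measure m))"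
      by measurable
  qed
qed

lemma integrable_torus_char:
  assumes "k \<in> ivecs d \<eta>"
  shows "integrable (torus_measure m d) (\<lambda>x. torus_char m k (real_point d x))"
proof -
  interpret T: prob_space "torus_measure m d" by (rule prob_space_torus[OF m])
  show ?thesis
    by (rule T.integrable_const_bound[where B = 1])
       (auto simp: norm_torus_char_real_point[OF \<eta> assms] borel_measurable_torus_char[OF assms])
qed

text \<open>A character depends on finitely many coordinates. So even for infinite \<open>d\<close>
  the integral reduces to a finite product, where every \<open>k j \<noteq> 0\<close> contributes a
  factor \<open>0\<close>.\<close>

lemma integral_torus_char:
  assumes k: "k \<in> ivecs d \<eta>"
  shows "(\<integral>x. torus_char m k (real_point d x) \<partial>torus_measure m d) = (if k = 0 then 1 else 0)"
proof -
  interpret T: prob_space "torus_measure m d" by (rule prob_space_torus[OF m])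
  let ?S = "{j. k j \<noteq> 0}" and ?U = "circle_measure m"
  let ?g = "\<lambda>x. \<Prod>j\<in>?S. cis (of_int (k j) * x j / real m)"
  have S: "finite ?S" "?S \<subseteq> coords d" using k \<eta> by (auto simp: ivecs_iff)
  have mc [measurable]: "(\<lambda>t. cis (of_int (k j) * t / real m)) \<in> borel_measurable borel" for j
    by (intro borel_measurable_continuous_onI continuous_intros) (use m in auto)
  have g: "?g \<in> borel_measurable (PiM ?S (\<lambda>_. ?U))"
  proof (rule borel_measurable_prod)
    fix j assume "j \<in> ?S"
    then have "(\<lambda>x. x j) \<in> PiM ?S (\<lambda>_. ?U) \<rightarrow>\<^sub>M ?U" by (rule measurable_component_singleton)
    then have "(\<lambda>x. x j) \<in> PiM ?S (\<lambda>_. ?U) \<rightarrow>\<^sub>M borel"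
      by (simp add: measurable_cong_sets[OF refl, of ?U borel])
    then show "(\<lambda>x. cis (of_int (k j) * x j / real m)) \<in> borel_measurable (PiM ?S (\<lambda>_. ?U))"
      by measurable
  qed
  have "(\<integral>x. torus_char m k (real_point d x) \<partial>torus_measure m d)
      = (\<integral>x. ?g (restrict x ?S) \<partial>PiM (coords d) (\<lambda>_. ?U))"
    unfolding torus_measure_def torus_char_real_point[OF \<eta> k]
    by (intro Bochner_Integration.integral_cong prod.cong) auto
  also have "\<dots> = (\<integral>x. ?g x \<partial>distr (PiM (coords d) (\<lambda>_. ?U)) (PiM ?S (\<lambda>_. ?U)) (\<lambda>x. restrict x ?S))"
    by (rule integral_distr[symmetric, OF measurable_restrict_subset[OF S(2)] g])
  also have "\<dots> = (\<integral>x. ?g x \<partial>PiM ?S (\<lambda>_. ?U))"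
    by (simp only: distr_PiM_restrict_finite[OF S])
  also have "\<dots> = (\<Prod>j\<in>?S. \<integral>t. cis (of_int (k j) * t / real m) \<partial>?U)"
  proof (rule product_integral_prod[OF S(1)])
    fix j
    show "integrable ?U (\<lambda>t. cis (of_int (k j) * t / real m))"
      by (rule M.integrable_const_bound[where B = 1]) auto
  qed
  also have "\<dots> = (\<Prod>j\<in>?S. 0)"
    by (intro prod.cong integral_circle_cis m) auto
  also have "\<dots> = (if k = 0 then 1 else 0)"
    using S by (auto simp: fun_eq_iff card_gt_0_iff)
  finally show ?thesis .
qed

end

section \<open>Absolutely convergent trigonometric series as members of
  \<open>Comega\<close>\<close>

definition trig :: "nat \<Rightarrow> ((nat \<Rightarrow> int) \<Rightarrow> complex) \<Rightarrow> (nat \<Rightarrow> complex) \<Rightarrow> complex" where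
  "trig m c x = (\<Sum>\<^sub>\<infinity>k. c k * torus_char m k x)"

lemma infinite_ivecs:
  assumes "0 \<le> \<eta>" "1 \<le> d"
  shows "infinite (ivecs d \<eta>)"
proof
  assume fin: "finite (ivecs d \<eta>)"
  let ?e = "\<lambda>(n::nat) j. if j = (1::nat) then int n else 0"
  have "range ?e \<subseteq> ivecs d \<eta>"
    using assms by (auto simp: ivecs_iff coords_def one_enat_def intro: finite_subset[of _ "{1}"] split: if_splits)
  with fin have "finite (range ?e)" by (rule rev_finite_subset)
  moreover have "inj ?e"
  proof (rule injI)
    fix n n' assume "?e n = ?e n'"
    then have "?e n 1 = ?e n' 1" by (rule fun_cong)
    then show "n = n'" by simp
  qed
  ultimately show False using finite_imageD[of ?e UNIV] by simp
qed

context
  fixes m :: nat and d :: enat and \<eta> h :: real and c :: "(nat \<Rightarrow> int) \<Rightarrow> complex"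
  assumes m: "0 < m" and \<eta>: "0 \<le> \<eta>" and h: "0 < h" and d: "1 \<le> d"
    and c_support: "\<And>k. k \<notin> ivecs d \<eta> \<Longrightarrow> c k = 0"
    and c_summable: "(\<lambda>k. norm (c k) * exp (h * kabs d \<eta> k / real m)) summable_on UNIV"
begin

private abbreviation "E \<equiv> from_nat_into (ivecs d \<eta>)"
private abbreviation "weight k \<equiv> norm (c k) * exp (h * kabs d \<eta> k / real m)"

private lemma bij_E: "bij_betw E UNIV (ivecs d \<eta>)"
  by (rule bij_betw_from_nat_into[OF countable_ivecs[OF \<eta>] infinite_ivecs[OF \<eta> d]])

private lemma E_in: "E n \<in> ivecs d \<eta>"
  using bij_E by (auto simp: bij_betw_def)

private lemma has_sum_enum:
  fixes g :: "(nat \<Rightarrow> int) \<Rightarrow> 'b::{real_normed_vector, banach}"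
  assumes "\<And>k. k \<notin> ivecs d \<eta> \<Longrightarrow> g k = 0"
  shows "((\<lambda>n. g (E n)) has_sum s) UNIV \<longleftrightarrow> (g has_sum s) UNIV"
proof -
  have "((\<lambda>n. g (E n)) has_sum s) UNIV \<longleftrightarrow> (g has_sum s) (ivecs d \<eta>)"
    by (rule has_sum_reindex_bij_betw[OF bij_E])
  also have "\<dots> \<longleftrightarrow> (g has_sum s) UNIV"
    by (rule has_sum_cong_neutral) (use assms in auto)
  finally show ?thesis .
qed

private lemma summable_weight: "summable (\<lambda>n. weight (E n))"
proof -
  have "(weight has_sum infsum weight UNIV) UNIV" using c_summable by (rule has_sum_infsum)
  then have "((\<lambda>n. weight (E n)) has_sum infsum weight UNIV) UNIV"
    by (subst has_sum_enum) (auto simp: c_support)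
  then show ?thesis by (auto dest: has_sum_imp_sums sums_summable)
qed

private lemma trig_summable:
  assumes X: "\<And>k. k \<in> ivecs d \<eta> \<Longrightarrow> norm (X k) \<le> exp (h * kabs d \<eta> k / real m)"
  shows "(\<lambda>k. norm (c k * X k)) summable_on UNIV"
proof (rule summable_on_comparison_test[OF c_summable])
  fix k show "norm (c k * X k) \<le> weight k"
    using X[of k] c_support[of k] by (cases "k \<in> ivecs d \<eta>") (auto simp: norm_mult intro: mult_left_mono)
qed simp

private lemma trig_sums:
  assumes X: "\<And>k. k \<in> ivecs d \<eta> \<Longrightarrow> norm (X k) \<le> exp (h * kabs d \<eta> k / real m)"
  shows "(\<lambda>n. c (E n) * X (E n)) sums (\<Sum>\<^sub>\<infinity>k. c k * X k)"
proof -
  have "((\<lambda>k. c k * X k) has_sum (\<Sum>\<^sub>\<infinity>k. c k * X k)) UNIV"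
    by (rule has_sum_infsum[OF abs_summable_summable[OF trig_summable[OF X]]])
  then have "((\<lambda>n. c (E n) * X (E n)) has_sum (\<Sum>\<^sub>\<infinity>k. c k * X k)) UNIV"
    by (subst has_sum_enum[where g = "\<lambda>k. c k * X k"]) (auto simp: c_support)
  then show ?thesis by (rule has_sum_imp_sums)
qed

lemma trig_has_sum:
  assumes "x \<in> strip d \<eta> h"
  shows "((\<lambda>k. c k * torus_char m k x) has_sum trig m c x) (ivecs d \<eta>)"
proof -
  have "((\<lambda>k. c k * torus_char m k x) has_sum trig m c x) UNIV"
    unfolding trig_def
    by (rule has_sum_infsum[OF abs_summable_summable[OF trig_summable[OF norm_torus_char_le[OF \<eta> _ assms]]]])
  then show ?thesis
    by (rule has_sum_cong_neutral[THEN iffD1, rotated -1]) (auto simp: c_support)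
qed

text \<open>Orthogonality and termwise integration: at real points the summands have the constant
  moduli \<open>norm (c (E n))\<close>, whose series converges.\<close>

lemma fourier_trig:
  assumes l: "l \<in> ivecs d \<eta>"
  shows "fourier m d (trig m c) l = c l"
proof -
  let ?T = "torus_measure m d"
  interpret T: prob_space ?T by (rule prob_space_torus[OF m])
  have lm: "- l \<in> ivecs d \<eta>" using l by (rule ivecs_uminus)
  have norm_le: "norm (torus_char m k (real_point d x)) \<le> exp (h * kabs d \<eta> k / real m)"
    if "k \<in> ivecs d \<eta>" for k x
    by (rule norm_torus_char_le[OF \<eta> that real_point_in_strip[OF h]])
  let ?F = "\<lambda>n x. c (E n) * torus_char m (E n - l) (real_point d x)"
  have Enl: "E n - l \<in> ivecs d \<eta>" for n
    using ivecs_add[OF \<eta> E_in lm] by simp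
  have F: "?F n x = c (E n) * torus_char m (E n) (real_point d x) * torus_char m (- l) (real_point d x)" for n x
    using torus_char_add[OF \<eta> E_in lm, of m n] by simp
  have sums: "(\<lambda>n. ?F n x) sums (trig m c (real_point d x) * torus_char m (- l) (real_point d x))" for x
    unfolding F trig_def by (intro sums_mult2 trig_sums norm_le)
  have int: "integrable ?T (?F n)" for n
    by (intro integrable_mult_right integrable_torus_char[OF m \<eta> Enl])
  have norm_F: "norm (?F n x) = norm (c (E n))" for n x
    by (simp add: norm_mult norm_torus_char_real_point[OF \<eta> Enl])
  have "norm (c (E n)) * 1 \<le> weight (E n)" for n
    using h kabs_nonneg[of d \<eta> "E n"] by (intro mult_left_mono) auto
  then have summ: "summable (\<lambda>n. norm (c (E n)))"
    by (intro summable_comparison_test'[OF summable_weight, of 0]) auto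
  have "fourier m d (trig m c) l = (\<integral>x. (\<Sum>n. ?F n x) \<partial>?T)"
    unfolding fourier_def Let_def real_point_def[symmetric]
    by (intro Bochner_Integration.integral_cong refl)
       (use sums in \<open>auto simp: sums_iff fun_Compl_def\<close>)
  also have "\<dots> = (\<Sum>n. integral\<^sup>L ?T (?F n))"
  proof (rule integral_suminf[OF int])
    show "AE x in ?T. summable (\<lambda>n. norm (?F n x))" unfolding norm_F using summ by simp
    show "summable (\<lambda>n. \<integral>x. norm (?F n x) \<partial>?T)"
      unfolding norm_F using summ by (simp add: T.prob_space)
  qed
  also have "\<dots> = (\<Sum>n. if E n = l then c l else 0)"
    by (intro suminf_cong) (auto simp: integral_torus_char[OF m \<eta> Enl])
  also have "\<dots> = c l"
  proof -
    obtain n0 where n0: "E n0 = l" using bij_E l unfolding bij_betw_def by (metis imageE)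
    have "(\<lambda>n. if E n = l then c l else 0) = (\<lambda>n. if n = n0 then c l else 0)"
      using bij_E n0 by (auto simp: bij_betw_def inj_on_def fun_eq_iff)
    then show ?thesis using sums_single[of n0 "\<lambda>_. c l"] by (simp add: sums_iff)
  qed
  finally show ?thesis .
qed

lemma trig_periodic: "torus_periodic m d \<eta> h (trig m c)"
  unfolding torus_periodic_def trig_def
proof (intro ballI allI infsum_cong)
  fix x :: "nat \<Rightarrow> complex" and n :: "nat \<Rightarrow> int" and k
  show "c k * torus_char m k (vadd d x (\<lambda>j. of_real (2 * pi * real m * of_int (n j)))) = c k * torus_char m k x"
    using torus_char_periodic[OF \<eta> _ m, of k d x n] c_support[of k] by (cases "k \<in> ivecs d \<eta>") auto
qed

lemma trig_bounded: "bounded (trig m c ` strip d \<eta> h)"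
proof (rule boundedI)
  fix y assume "y \<in> trig m c ` strip d \<eta> h"
  then obtain x where x: "x \<in> strip d \<eta> h" "y = trig m c x" by auto
  have "norm y \<le> (\<Sum>\<^sub>\<infinity>k. norm (c k * torus_char m k x))"
    unfolding x(2) trig_def
    by (rule norm_infsum_bound[OF trig_summable[OF norm_torus_char_le[OF \<eta> _ x(1)]]])
  also have "\<dots> \<le> infsum weight UNIV"
  proof (rule infsum_mono[OF trig_summable[OF norm_torus_char_le[OF \<eta> _ x(1)]] c_summable])
    fix k show "norm (c k * torus_char m k x) \<le> weight k"
      using norm_torus_char_le[OF \<eta> _ x(1), of k m] c_support[of k]
      by (cases "k \<in> ivecs d \<eta>") (auto simp: norm_mult intro: mult_left_mono)
  qed
  finally show "norm y \<le> infsum weight UNIV" .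
qed

text \<open>Single characters are holomorphic along a line, and the M-test with the weights as
  majorants makes the convergence uniform on balls inside the strip.\<close>

lemma trig_line_holomorphic: "line_holomorphic d \<eta> h (trig m c)"
  unfolding line_holomorphic_def
proof (intro allI)
  fix x y :: "nat \<Rightarrow> complex"
  define L where "L t = vadd d x (\<lambda>j. t * y j)" for t
  define S where "S = interior {t. L t \<in> strip d \<eta> h}"
  have S: "open S" "\<And>t. t \<in> S \<Longrightarrow> L t \<in> strip d \<eta> h"
    unfolding S_def using interior_subset by auto
  let ?f = "\<lambda>n t. c (E n) * torus_char m (E n) (L t)"
  have "(\<lambda>t. \<Sum>n. ?f n t) holomorphic_on S"
  proof (rule holomorphic_uniform_sequence[OF S(1)])
    fix N
    have "(\<lambda>t. torus_char m k (L t)) holomorphic_on S" if k: "k \<in> ivecs d \<eta>" for k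
    proof -
      have "torus_char m k (L t) = torus_char m k x * exp (\<i> * (\<Sum>j | k j \<noteq> 0. of_int (k j) * (t * y j)) / of_nat m)" for t
        unfolding L_def torus_char_vadd[OF \<eta> k] by (simp add: torus_char_def pairing_def)
      then show ?thesis using m by (auto intro!: holomorphic_intros)
    qed
    then show "(\<lambda>t. \<Sum>n<N. ?f n t) holomorphic_on S"
      by (intro holomorphic_on_sum holomorphic_on_mult holomorphic_on_const) (auto simp: E_in)
  next
    fix t assume "t \<in> S"
    then obtain r where r: "0 < r" "cball t r \<subseteq> S" using S(1) open_contains_cball by blast
    have "uniform_limit (cball t r) (\<lambda>N t. \<Sum>n<N. ?f n t) (\<lambda>t. \<Sum>n. ?f n t) sequentially"
    proof (rule Weierstrass_m_test[OF _ summable_weight])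
      fix n u assume "u \<in> cball t r"
      then have "L u \<in> strip d \<eta> h" using r S by auto
      then show "norm (?f n u) \<le> weight (E n)"
        using norm_torus_char_le[OF \<eta> E_in] by (simp add: norm_mult mult_left_mono)
    qed
    then show "\<exists>r>0. cball t r \<subseteq> S \<and>
        uniform_limit (cball t r) (\<lambda>N t. \<Sum>n<N. ?f n t) (\<lambda>t. \<Sum>n. ?f n t) sequentially"
      using r by blast
  qed
  moreover have "(\<Sum>n. ?f n t) = trig m c (L t)" if "t \<in> S" for t
    unfolding trig_def
    using trig_sums[OF norm_torus_char_le[OF \<eta> _ S(2)[OF that]]] by (simp add: sums_iff)
  ultimately have "(\<lambda>t. trig m c (L t)) holomorphic_on S" by (rule holomorphic_transform)
  then show "(\<lambda>t. trig m c (vadd d x (\<lambda>j. t * y j))) holomorphic_on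
      interior {t. vadd d x (\<lambda>j. t * y j) \<in> strip d \<eta> h}"
    by (simp add: S_def L_def)
qed

lemma trig_in_Comega: "trig m c \<in> Comega m d \<eta> h"
proof -
  have "fnorm_term m d \<eta> h (trig m c) summable_on ivecs d \<eta>"
  proof -
    have "weight summable_on ivecs d \<eta>" by (rule summable_on_subset[OF c_summable]) simp
    then show ?thesis
      by (rule summable_on_cong[THEN iffD1, rotated]) (simp add: fnorm_term_def fourier_trig)
  qed
  moreover have "((\<lambda>k. fourier m d (trig m c) k * torus_char m k x) has_sum trig m c x) (ivecs d \<eta>)"
    if "x \<in> strip d \<eta> h" for x
    using trig_has_sum[OF that]
    by (rule has_sum_cong[THEN iffD1, rotated]) (simp add: fourier_trig)
  ultimately show ?thesis
    using trig_periodic trig_bounded trig_line_holomorphic by (simp add: Comega_def)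
qed

end

section \<open>Reducibility\<close>

text \<open>Companion of \<open>fiber_summable\<close>: evaluates the regrouped series against a
  function \<open>X\<close> of the new index.\<close>

lemma fiber_infsum:
  fixes A :: "'i \<Rightarrow> complex" and e :: "'i \<Rightarrow> 'k" and X :: "'k \<Rightarrow> complex"
  assumes "(\<lambda>i. norm (A i * X (e i))) summable_on UNIV"
  shows "(\<Sum>\<^sub>\<infinity>k. infsum A {i. e i = k} * X k) = (\<Sum>\<^sub>\<infinity>i. A i * X (e i))"
proof -
  let ?T = "SIGMA k:UNIV. {i. e i = k}"
  have "(\<lambda>i. A i * X (e i)) summable_on UNIV" by (rule abs_summable_summable[OF assms])
  also have "?this \<longleftrightarrow> (\<lambda>(k, i). A i * X k) summable_on ?T"
    by (rule summable_on_reindex_bij_witness[where i = snd and j = "\<lambda>i. (e i, i)"]) auto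
  finally have T: "(\<lambda>(k, i). A i * X k) summable_on ?T" .
  have "(\<Sum>\<^sub>\<infinity>k. infsum A {i. e i = k} * X k) = (\<Sum>\<^sub>\<infinity>k. \<Sum>\<^sub>\<infinity>i\<in>{i. e i = k}. A i * X k)"
    by (intro infsum_cong) (simp only: infsum_cmult_left')
  also have "\<dots> = infsum (\<lambda>(k, i). A i * X k) ?T"
    by (rule infsum_Sigma'_banach[OF T])
  also have "\<dots> = (\<Sum>\<^sub>\<infinity>i. A i * X (e i))"
    by (rule infsum_reindex_bij_witness[where j = snd and i = "\<lambda>i. (e i, i)"]) auto
  finally show ?thesis .
qed

locale torus_rotation =
  fixes d :: enat and \<eta> :: real and \<alpha> :: "nat \<Rightarrow> real" and a b \<beta> :: real
  assumes d: "1 \<le> d" and \<eta>: "0 \<le> \<eta>" and ab_nonneg: "0 \<le> a" "0 \<le> b" and \<beta>: "0 < \<beta>" "\<beta> < 1"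
    and cis_small_divisor: "k \<in> ivecs d \<eta> \<Longrightarrow> k \<noteq> 0 \<Longrightarrow>
      exp (- (b + a * kabs d \<eta> k powr \<beta>)) \<le> norm (cis (pairing k \<alpha>) - 1)"
begin

sublocale torus_translation "ivecs d \<eta>" "kabs d \<eta>" "\<lambda>k. cis (pairing k \<alpha>)" a b \<beta>
  by standard
     (use cis_small_divisor in \<open>auto simp: \<eta> ivecs_zero ivecs_add ivecs_uminus kabs_nonneg kabs_zero
       kabs_add pairing_add[OF \<eta>] cis_mult ab_nonneg \<beta>\<close>)

abbreviation trig1 :: "((nat \<Rightarrow> int) \<Rightarrow> complex) \<Rightarrow> (nat \<Rightarrow> complex) \<Rightarrow> complex" where
  "trig1 \<equiv> trig 1"

abbreviation shift :: "(nat \<Rightarrow> complex) \<Rightarrow> nat \<Rightarrow> complex" where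
  "shift x \<equiv> vadd d x (\<lambda>j. complex_of_real (\<alpha> j))"

lemma shift_in_strip: "x \<in> strip d \<eta> h \<Longrightarrow> shift x \<in> strip d \<eta> h"
  by (auto simp: strip_def vadd_def)

lemma norm_torus_char_1:
  "x \<in> strip d \<eta> h \<Longrightarrow> k \<in> ivecs d \<eta> \<Longrightarrow> norm (torus_char 1 k x) \<le> exp (h * kabs d \<eta> k)"
  using norm_torus_char_le[OF \<eta>, of k d x h 1] by simp

lemma trig1_abs_summable:
  "c \<in> ell1 h \<Longrightarrow> x \<in> strip d \<eta> h \<Longrightarrow> (\<lambda>k. norm (c k * torus_char 1 k x)) summable_on UNIV"
  by (rule ell1_abs_summable[OF _ norm_torus_char_1])

lemma trig1_summable:
  "c \<in> ell1 h \<Longrightarrow> x \<in> strip d \<eta> h \<Longrightarrow> (\<lambda>k. c k * torus_char 1 k x) summable_on UNIV"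
  by (rule abs_summable_summable[OF trig1_abs_summable])

lemma trig1_add:
  "c \<in> ell1 h \<Longrightarrow> e \<in> ell1 h \<Longrightarrow> x \<in> strip d \<eta> h \<Longrightarrow>
    trig1 (\<lambda>k. c k + e k) x = trig1 c x + trig1 e x"
  unfolding trig_def distrib_right by (intro infsum_add trig1_summable)

lemma trig1_cmult: "trig1 (\<lambda>k. u * c k) x = u * trig1 c x"
  by (simp add: trig_def mult.assoc infsum_cmult_right')

lemma trig1_conv:
  "c \<in> ell1 h \<Longrightarrow> e \<in> ell1 h \<Longrightarrow> x \<in> strip d \<eta> h \<Longrightarrow> trig1 (conv c e) x = trig1 c x * trig1 e x"
  unfolding trig_def
  by (rule infsum_conv[OF _ _ norm_torus_char_1]) (auto simp: torus_char_add[OF \<eta>])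

lemma trig1_shift:
  assumes "c \<in> ell1 h"
  shows "trig1 c (shift x) = trig1 (\<lambda>k. cis (pairing k \<alpha>) * c k) x"
  unfolding trig_def
proof (rule infsum_cong)
  fix k
  show "c k * torus_char 1 k (shift x) = cis (pairing k \<alpha>) * c k * torus_char 1 k x"
  proof (cases "c k = 0")
    case False
    then have k: "k \<in> ivecs d \<eta>" using assms ell1_support by blast
    have "torus_char 1 k (\<lambda>j. complex_of_real (\<alpha> j)) = cis (pairing k \<alpha>)"
      by (simp add: torus_char_def pairing_of_real cis_conv_exp)
    then show ?thesis by (simp add: torus_char_vadd[OF \<eta> k])
  qed simp
qed

lemma trig1_translate:
  assumes "c \<in> ell1 h" "p \<in> ivecs d \<eta>"
  shows "trig1 (\<lambda>k. c (k - p)) x = torus_char 1 p x * trig1 c x"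
proof -
  have "trig1 (\<lambda>k. c (k - p)) x = (\<Sum>\<^sub>\<infinity>k. c k * torus_char 1 (k + p) x)"
    unfolding trig_def
    by (rule infsum_reindex_bij_witness[where i = "\<lambda>k. k + p" and j = "\<lambda>k. k - p"]) auto
  also have "\<dots> = (\<Sum>\<^sub>\<infinity>k. torus_char 1 p x * (c k * torus_char 1 k x))"
  proof (rule infsum_cong)
    fix k
    show "c k * torus_char 1 (k + p) x = torus_char 1 p x * (c k * torus_char 1 k x)"
      using ell1_support[OF assms(1), of k] torus_char_add[OF \<eta> _ assms(2), of k 1 x]
      by (cases "c k = 0") auto
  qed
  finally show ?thesis by (simp add: trig_def infsum_cmult_right')
qed

lemma ell1_coefficients:
  assumes "c \<in> ell1 h"
  shows "\<And>k. k \<notin> ivecs d \<eta> \<Longrightarrow> c k = 0"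
    "(\<lambda>k. norm (c k) * exp (h * kabs d \<eta> k / real 1)) summable_on UNIV"
  using assms by (auto simp: ell1_def)

text \<open>Ergodicity of the rotation on the Fourier side: invariance gives
  \<open>(cis (pairing k \<alpha>) - 1) * c k = 0\<close>, and the first factor vanishes only at
  \<open>k = 0\<close>. This yields the constancy of the Wronskian.\<close>

lemma trig1_invariant_imp_const:
  assumes c: "c \<in> ell1 h" and h: "0 < h"
    and inv: "\<And>x. x \<in> strip d \<eta> h \<Longrightarrow> trig1 c (shift x) = trig1 c x"
    and x: "x \<in> strip d \<eta> h"
  shows "trig1 c x = c 0"
proof -
  define c' where "c' k = cis (pairing k \<alpha>) * c k" for k
  have c': "c' \<in> ell1 h" unfolding c'_def[abs_def] by (rule ell1_mult[OF c, of _ 1]) simp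
  have eq: "trig1 c' y = trig1 c y" if "y \<in> strip d \<eta> h" for y
    using inv[OF that] trig1_shift[OF c, of y] by (simp add: c'_def[abs_def])
  have "c k = 0" if k: "k \<noteq> 0" for k
  proof (rule ccontr)
    assume "c k \<noteq> 0"
    then have kK: "k \<in> ivecs d \<eta>" using c ell1_support by blast
    have "c' k = fourier 1 d (trig1 c') k"
      by (rule fourier_trig[OF _ \<eta> h d ell1_coefficients[OF c'] kK, symmetric]) simp_all
    also have "\<dots> = fourier 1 d (trig1 c) k"
      unfolding fourier_def Let_def real_point_def[symmetric]
      by (simp add: eq real_point_in_strip[OF h] del: One_nat_def)
    also have "\<dots> = c k"
      by (rule fourier_trig[OF _ \<eta> h d ell1_coefficients[OF c] kK]) simp_all
    finally have "cis (pairing k \<alpha>) = 1" using \<open>c k \<noteq> 0\<close> by (simp add: c'_def)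
    then show False using z_eq_one[OF kK] k by blast
  qed
  then have "trig1 c x = (\<Sum>\<^sub>\<infinity>k\<in>{0}. c k * torus_char 1 k x)"
    unfolding trig_def by (intro infsum_cong_neutral) auto
  then show ?thesis by (simp add: torus_char_zero)
qed

text \<open>On the double torus \<open>exp (i<k,x>)\<close> has frequency \<open>k + k\<close>, and
  the half character adds \<open>p\<close>. As \<open>kabs\<close> is halved in the weight there,
  the width \<open>h\<close> is kept.\<close>

lemma twisted_Comega:
  assumes c: "c \<in> ell1 h" and h: "0 < h" and p: "p \<in> ivecs d \<eta>"
  obtains F where "F \<in> Comega 2 d \<eta> h" "\<And>x. x \<in> strip d \<eta> h \<Longrightarrow> F x = torus_char 2 p x * trig1 c x"
proof -
  define e where "e k = k + k + p" for k :: "nat \<Rightarrow> int"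
  define c' where "c' l = infsum c {k. e k = l}" for l
  have eK: "e k \<in> ivecs d \<eta>" if "k \<in> ivecs d \<eta>" for k
    unfolding e_def by (intro ivecs_add \<eta> that p)
  have kabs_e: "kabs d \<eta> (e k) \<le> 2 * kabs d \<eta> k + kabs d \<eta> p" if k: "k \<in> ivecs d \<eta>" for k
    using kabs_add[OF \<eta> ivecs_add[OF \<eta> k k] p] kabs_add[OF \<eta> k k] by (simp add: e_def)
  have summ: "(\<lambda>k. norm (c k) * exp (h * kabs d \<eta> (e k) / real 2)) summable_on UNIV"
  proof (rule summable_on_comparison_test)
    show "(\<lambda>k. exp (h * kabs d \<eta> p / 2) * (norm (c k) * exp (h * kabs d \<eta> k))) summable_on UNIV"
      using c by (intro summable_on_cmult_right) (simp add: ell1_def)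
    fix k
    show "norm (c k) * exp (h * kabs d \<eta> (e k) / real 2)
        \<le> exp (h * kabs d \<eta> p / 2) * (norm (c k) * exp (h * kabs d \<eta> k))"
    proof (cases "c k = 0")
      case False
      then have "k \<in> ivecs d \<eta>" using c ell1_support by blast
      then have "h * kabs d \<eta> (e k) \<le> h * (2 * kabs d \<eta> k + kabs d \<eta> p)"
        using kabs_e h by (intro mult_left_mono) auto
      then have "exp (h * kabs d \<eta> (e k) / real 2) \<le> exp (h * kabs d \<eta> p / 2) * exp (h * kabs d \<eta> k)"
        by (simp add: algebra_simps flip: exp_add)
      then have "norm (c k) * exp (h * kabs d \<eta> (e k) / real 2)
          \<le> norm (c k) * (exp (h * kabs d \<eta> p / 2) * exp (h * kabs d \<eta> k))"
        by (intro mult_left_mono) auto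
      then show ?thesis by (simp add: mult_ac)
    qed simp
  qed simp
  have c'_support: "c' l = 0" if "l \<notin> ivecs d \<eta>" for l
    unfolding c'_def
  proof (rule infsum_0)
    fix k assume "k \<in> {k. e k = l}"
    then show "c k = 0" using that eK[of k] ell1_support[OF c, of k] by auto
  qed
  have c'_summable: "(\<lambda>l. norm (c' l) * exp (h * kabs d \<eta> l / real 2)) summable_on UNIV"
    unfolding c'_def
    by (rule fiber_summable(2)[where A = c and e = e and W = "\<lambda>l. exp (h * kabs d \<eta> l / real 2)"])
       (use summ in auto)
  show ?thesis
  proof
    show "trig 2 c' \<in> Comega 2 d \<eta> h"
      by (rule trig_in_Comega[OF _ \<eta> h d c'_support c'_summable]) simp
    fix x assume x: "x \<in> strip d \<eta> h"
    have char: "c k * torus_char 2 (e k) x = torus_char 2 p x * (c k * torus_char 1 k x)" for k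
    proof (cases "c k = 0")
      case False
      then have k: "k \<in> ivecs d \<eta>" using c ell1_support by blast
      have "torus_char 2 (k + k) x = torus_char 1 k x"
        unfolding torus_char_def pairing_add[OF \<eta> k k] by simp
      then show ?thesis
        unfolding e_def torus_char_add[OF \<eta> ivecs_add[OF \<eta> k k] p] by simp
    qed simp
    have "(\<lambda>k. norm (torus_char 2 p x * (c k * torus_char 1 k x))) summable_on UNIV"
      unfolding norm_mult[of "torus_char 2 p x"]
      by (intro summable_on_cmult_right trig1_abs_summable[OF c x])
    then have "(\<lambda>k. norm (c k * torus_char 2 (e k) x)) summable_on UNIV"
      unfolding char .
    then have "trig 2 c' x = (\<Sum>\<^sub>\<infinity>k. c k * torus_char 2 (e k) x)"
      unfolding trig_def c'_def by (rule fiber_infsum[where A = c and e = e and X = "\<lambda>l. torus_char 2 l x"])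
    also have "\<dots> = torus_char 2 p x * trig1 c x"
      unfolding char trig_def by (simp add: infsum_cmult_right')
    finally show "trig 2 c' x = torus_char 2 p x * trig1 c x" .
  qed
qed

end

section \<open>Two by two matrices and the conjugacy equation\<close>

lemma matrix_inv_left:
  fixes B :: "complex^'n^'n"
  assumes "det B \<noteq> 0"
  shows "matrix_inv B ** B = mat 1"
proof -
  have "\<exists>B'. B ** B' = mat 1 \<and> B' ** B = mat 1"
    using assms invertible_det_nz[of B] by (auto simp: invertible_def)
  then show ?thesis unfolding matrix_inv_def by (rule someI2_ex) simp
qed

lemma mat2_component [simp]:
  "mat2 p q r s $ 1 $ 1 = p" "mat2 p q r s $ 1 $ 2 = q"
  "mat2 p q r s $ 2 $ 1 = r" "mat2 p q r s $ 2 $ 2 = s"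
  by (simp_all add: mat2_def)

lemma det_mat2: "det (mat2 p q r s) = p * s - q * r"
  by (simp add: det_2)

lemma mat2_mult:
  "mat2 p q r s ** mat2 p' q' r' s' =
    mat2 (p * p' + q * r') (p * q' + q * s') (r * p' + s * r') (r * q' + s * s')"
  by (simp add: vec_eq_iff forall_2 matrix_matrix_mult_def sum_2)

lemma arg_cong4:
  "p = p' \<Longrightarrow> q = q' \<Longrightarrow> r = r' \<Longrightarrow> s = s' \<Longrightarrow> f p q r s = f p' q' r' s'"
  by simp

text \<open>Without the inverse, the conjugacy equation reads
  \<open>A(x) B(x) = B(x + \<alpha>) A'\<close>, which is linear in each column; \<open>unit\<close>
  says \<open>det B = 1\<close>.\<close>

lemma reducible_of_columns:
  assumes h: "0 < h" and det: "\<mu>1 * \<mu>2 = 1"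
    and Comega: "a1 \<in> Comega 2 d \<eta> h" "a2 \<in> Comega 2 d \<eta> h" "b1 \<in> Comega 2 d \<eta> h" "b2 \<in> Comega 2 d \<eta> h"
    and unit: "\<And>x. x \<in> strip d \<eta> h \<Longrightarrow> a1 x * b2 x - b1 x * a2 x = 1"
    and first: "\<And>x. x \<in> strip d \<eta> h \<Longrightarrow>
      (of_real E - of_real lam * v x) * a1 x - a2 x = \<mu>1 * a1 (vadd d x (\<lambda>j. of_real (\<alpha> j))) \<and>
      a1 x = \<mu>1 * a2 (vadd d x (\<lambda>j. of_real (\<alpha> j)))"
    and second: "\<And>x. x \<in> strip d \<eta> h \<Longrightarrow>
      (of_real E - of_real lam * v x) * b1 x - b2 x =
        \<mu>2 * b1 (vadd d x (\<lambda>j. of_real (\<alpha> j))) + \<zeta> * a1 (vadd d x (\<lambda>j. of_real (\<alpha> j))) \<and>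
      b1 x = \<mu>2 * b2 (vadd d x (\<lambda>j. of_real (\<alpha> j))) + \<zeta> * a2 (vadd d x (\<lambda>j. of_real (\<alpha> j)))"
  shows "reducible d \<eta> \<alpha> (schroedinger E lam v) (mat2 \<mu>1 \<zeta> 0 \<mu>2)"
proof -
  define B where "B x = mat2 (a1 x) (b1 x) (a2 x) (b2 x)" for x
  have detB: "det (B x) = 1" if "x \<in> strip d \<eta> h" for x
    using unit[OF that] by (simp add: B_def det_mat2)
  have "B \<in> Comega_SL2 2 d \<eta>"
    unfolding Comega_SL2_def using h detB Comega by (auto simp: forall_2 B_def intro!: exI[of _ h])
  moreover have "matrix_inv (B (vadd d x (\<lambda>j. of_real (\<alpha> j)))) ** schroedinger E lam v x ** B x = mat2 \<mu>1 \<zeta> 0 \<mu>2"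
    if "x \<in> real_points d" for x
  proof -
    let ?y = "vadd d x (\<lambda>j. complex_of_real (\<alpha> j))"
    have x: "x \<in> strip d \<eta> h"
    proof -
      have "0 < h * jb j powr \<eta>" for j using h jb_ge_1[of j] by simp
      then show ?thesis using that by (auto simp: real_points_def strip_def PiE_def Pi_def complex_is_Real_iff)
    qed
    then have y: "?y \<in> strip d \<eta> h" by (auto simp: strip_def vadd_def)
    have "schroedinger E lam v x ** B x = B ?y ** mat2 \<mu>1 \<zeta> 0 \<mu>2"
      unfolding schroedinger_def B_def mat2_mult
    proof (intro arg_cong4[where f = mat2])
      show "(of_real E - of_real lam * v x) * a1 x + (- 1) * a2 x = a1 ?y * \<mu>1 + b1 ?y * 0"
        using conjunct1[OF first[OF x]] by (simp add: mult.commute)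
      show "(of_real E - of_real lam * v x) * b1 x + (- 1) * b2 x = a1 ?y * \<zeta> + b1 ?y * \<mu>2"
        using conjunct1[OF second[OF x]] by (simp add: mult.commute add.commute)
      show "1 * a1 x + 0 * a2 x = a2 ?y * \<mu>1 + b2 ?y * 0"
        using conjunct2[OF first[OF x]] by (simp add: mult.commute)
      show "1 * b1 x + 0 * b2 x = a2 ?y * \<zeta> + b2 ?y * \<mu>2"
        using conjunct2[OF second[OF x]] by (simp add: mult.commute add.commute)
    qed
    then have "matrix_inv (B ?y) ** schroedinger E lam v x ** B x = (matrix_inv (B ?y) ** B ?y) ** mat2 \<mu>1 \<zeta> 0 \<mu>2"
      by (simp add: matrix_mul_assoc[symmetric])
    then show ?thesis using matrix_inv_left[of "B ?y"] detB[OF y] by simp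
  qed
  ultimately show ?thesis
    using det by (auto simp: reducible_def det_mat2)
qed

locale schroedinger_cone = torus_rotation d \<eta> \<alpha> a b \<beta>
    + cone_potential "ivecs d \<eta>" "kabs d \<eta>" "\<lambda>k. cis (pairing k \<alpha>)" a b \<beta> f v h \<epsilon> C
  for d \<eta> \<alpha> a b \<beta> f v h \<epsilon> C
begin

text \<open>Passage from coefficients back to functions: the factor
  \<open>cis (pairing k \<alpha>)\<close> is the shift by \<open>\<alpha>\<close>, its inverse the
  shift back, and convolution is multiplication.\<close>

lemma trig1_cohom:
  assumes u: "u \<in> ell1 h'" and h': "0 \<le> h'" "h' \<le> h" and x: "x \<in> strip d \<eta> h'"
  shows "trig1 (cohom e lam u) x = e * trig1 (\<lambda>k. cis (pairing k \<alpha>) * u k) x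
    + inverse e * trig1 (\<lambda>k. inverse (cis (pairing k \<alpha>)) * u k) x
    + (lam * trig1 v x - (e + inverse e)) * trig1 u x"
proof -
  let ?z = "\<lambda>k. cis (pairing k \<alpha>)"
  have v: "v \<in> ell1 h'" by (rule ell1_mono[OF v_ell1 h'(2)])
  have up: "(\<lambda>k. e * (?z k * u k)) \<in> ell1 h'"
    by (intro ell1_cmult ell1_mult[OF u, of _ 1]) simp
  have um: "(\<lambda>k. inverse e * (inverse (?z k) * u k)) \<in> ell1 h'"
    by (intro ell1_cmult ell1_mult[OF u, of _ 1]) (simp add: norm_inverse)
  have uc: "(\<lambda>k. (- (e + inverse e)) * u k) \<in> ell1 h'" by (rule ell1_cmult[OF u])
  have uv: "(\<lambda>k. lam * conv v u k) \<in> ell1 h'" by (rule ell1_cmult[OF ell1_conv[OF v u h'(1)]])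
  have "cohom e lam u = (\<lambda>k. (e * (?z k * u k) + inverse e * (inverse (?z k) * u k))
      + ((- (e + inverse e)) * u k + lam * conv v u k))"
    by (auto simp: fun_eq_iff cohom_def divisor_def algebra_simps)
  then have "trig1 (cohom e lam u) x = (trig1 (\<lambda>k. e * (?z k * u k)) x + trig1 (\<lambda>k. inverse e * (inverse (?z k) * u k)) x)
      + (trig1 (\<lambda>k. (- (e + inverse e)) * u k) x + trig1 (\<lambda>k. lam * conv v u k) x)"
    by (simp only: trig1_add[OF ell1_add[OF up um] ell1_add[OF uc uv] x] trig1_add[OF up um x] trig1_add[OF uc uv x])
  then show ?thesis
    unfolding trig1_cmult trig1_conv[OF v u x] by (simp add: algebra_simps)
qed

text \<open>The columns of the conjugation are \<open>e\<^sup>i\<^sup>\<langle>\<^sup>p\<^sup>,\<^sup>x\<^sup>\<rangle>\<^sup>/\<^sup>2 (\<psi>(x)/e, \<psi>(x - \<alpha>))/W\<close> and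
  \<open>e\<^sup>-\<^sup>i\<^sup>\<langle>\<^sup>p\<^sup>,\<^sup>x\<^sup>\<rangle>\<^sup>/\<^sup>2 (e \<phi>(x) + c e\<^sup>i\<^sup>\<langle>\<^sup>p\<^sup>,\<^sup>x\<^sup>\<rangle> \<psi>(x), \<phi>(x - \<alpha>))\<close>, where \<open>W\<close> is their Wronskian. The right-hand
  side of the equation for \<open>\<phi>\<close> is the one that makes the second column a generalized eigenvector.\<close>

lemma reducible_of_pair:
  fixes lam E :: real
  assumes e: "norm e = 1" "e + inverse e = of_real E"
    and p: "p \<in> ivecs d \<eta>" "0 \<le> f p" "c = 0 \<or> cis (pairing p \<alpha>) * e^2 = 1"
    and h': "0 < h'" "h' \<le> h"
    and V: "\<And>x. x \<in> strip d \<eta> h' \<Longrightarrow> V x = trig1 v x"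
    and \<psi>: "\<psi> \<in> ell1 h'" "\<psi> 0 = 1" "\<And>s. \<psi> s \<noteq> 0 \<Longrightarrow> s = 0 \<or> 0 < f s"
    and \<phi>: "\<phi> \<in> ell1 h'" "\<And>s. \<phi> s \<noteq> 0 \<Longrightarrow> s = 0 \<or> 0 < f s"
    and \<psi>_eq: "\<And>s. cohom (inverse e) (of_real lam) \<psi> s = 0"
    and \<phi>_eq: "\<And>s. cohom e (of_real lam) \<phi> s
      = c * ((cis (pairing p \<alpha>) / cis (pairing s \<alpha>) - cis (pairing s \<alpha>)) * \<psi> (s - p))"
    and W0: "inverse e * \<phi> 0 - e * \<phi> 0 - c * (if p = 0 then 1 else 0) \<noteq> 0"
  obtains \<zeta> where "\<zeta> = 0 \<longleftrightarrow> c = 0"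
    "reducible d \<eta> \<alpha> (schroedinger E lam V)
      (mat2 (inverse (e * cis (pairing p \<alpha> / 2))) \<zeta> 0 (e * cis (pairing p \<alpha> / 2)))"
proof -
  let ?z = "\<lambda>k. cis (pairing k \<alpha>)"
  \<comment> \<open>The factor that the half character of frequency \<open>p\<close> picks up under
    the shift.\<close>
  define w where "w = cis (pairing p \<alpha> / 2)"
  have ne: "e \<noteq> 0" "w \<noteq> 0" "?z p \<noteq> 0" using e by (auto simp: w_def)
  have w2: "?z p = w^2" by (simp add: w_def power2_eq_square cis_mult)
  have h0: "0 \<le> h'" using h' by simp
  define W where "W = inverse e * \<phi> 0 - e * \<phi> 0 - c * (if p = 0 then 1 else 0)"
  have W: "W \<noteq> 0" using W0 by (simp add: W_def)
  define \<psi>p \<psi>m \<phi>p \<phi>m where "\<psi>p k = ?z k * \<psi> k" and "\<psi>m k = inverse (?z k) * \<psi> k"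
    and "\<phi>p k = ?z k * \<phi> k" and "\<phi>m k = inverse (?z k) * \<phi> k" for k
  have mem: "\<psi>p \<in> ell1 h'" "\<psi>m \<in> ell1 h'" "\<phi>p \<in> ell1 h'" "\<phi>m \<in> ell1 h'"
    unfolding \<psi>p_def[abs_def] \<psi>m_def[abs_def] \<phi>p_def[abs_def] \<phi>m_def[abs_def]
    by (rule ell1_mult[OF \<psi>(1), of _ 1] ell1_mult[OF \<phi>(1), of _ 1], simp add: norm_inverse)+
  have sh: "trig1 \<psi> (shift x) = trig1 \<psi>p x" "trig1 \<psi>m (shift x) = trig1 \<psi> x"
    "trig1 \<phi> (shift x) = trig1 \<phi>p x" "trig1 \<phi>m (shift x) = trig1 \<phi> x" for x
  proof -
    have "(\<lambda>k. ?z k * \<psi>m k) = \<psi>" "(\<lambda>k. ?z k * \<phi>m k) = \<phi>"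
      by (simp_all add: fun_eq_iff \<psi>m_def \<phi>m_def mult.assoc[symmetric] del: cis_inverse)
    then show "trig1 \<psi> (shift x) = trig1 \<psi>p x" "trig1 \<psi>m (shift x) = trig1 \<psi> x"
      "trig1 \<phi> (shift x) = trig1 \<phi>p x" "trig1 \<phi>m (shift x) = trig1 \<phi> x"
      by (simp_all only: trig1_shift[OF \<psi>(1)] trig1_shift[OF \<phi>(1)] trig1_shift[OF mem(2)]
          trig1_shift[OF mem(4)] \<psi>p_def[abs_def] \<phi>p_def[abs_def])
  qed
  define q where "q = torus_char 1 p"
  have q_shift: "q (shift x) = w^2 * q x" for x
    unfolding q_def torus_char_vadd[OF \<eta> p(1)]
    by (simp add: w2[symmetric] torus_char_def pairing_of_real cis_conv_exp)
  let ?t = "\<lambda>x. of_real E - of_real lam * V x"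
  have eq\<psi>: "inverse e * trig1 \<psi>p x + e * trig1 \<psi>m x = ?t x * trig1 \<psi> x" if x: "x \<in> strip d \<eta> h'" for x
  proof -
    have "trig1 (cohom (inverse e) (of_real lam) \<psi>) x = 0" by (simp add: trig_def \<psi>_eq)
    then show ?thesis
      using trig1_cohom[OF \<psi>(1) h0 h'(2) x, of "inverse e" "of_real lam",
          folded \<psi>p_def[abs_def] \<psi>m_def[abs_def]] e(2) V[OF x]
      by (simp add: algebra_simps)
  qed
  have eq\<phi>: "e * trig1 \<phi>p x + inverse e * trig1 \<phi>m x - ?t x * trig1 \<phi> x
      = c * q x * (trig1 \<psi>m x - w^2 * trig1 \<psi>p x)" if x: "x \<in> strip d \<eta> h'" for x
  proof -
    define u where "u k = \<psi>m k + (- (w^2)) * \<psi>p k" for k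
    have u: "u \<in> ell1 h'" unfolding u_def[abs_def] by (intro ell1_add ell1_cmult mem)
    have "cohom e (of_real lam) \<phi> s = c * u (s - p)" for s
    proof (cases "\<psi> (s - p) = 0")
      case False
      then have sp: "s - p \<in> ivecs d \<eta>" using ell1_support[OF \<psi>(1)] by blast
      have "pairing s \<alpha> = pairing (s - p) \<alpha> + pairing p \<alpha>"
        using pairing_add[OF \<eta> sp p(1), of \<alpha>] by simp
      then have "?z s = ?z (s - p) * w^2" by (simp add: w2[symmetric] cis_mult)
      then show ?thesis
        unfolding \<phi>_eq u_def \<psi>m_def \<psi>p_def w2 using ne by (simp add: field_simps)
    qed (simp add: \<phi>_eq u_def \<psi>m_def \<psi>p_def)
    then have "cohom e (of_real lam) \<phi> = (\<lambda>s. c * u (s - p))" by (rule ext)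
    then have "trig1 (cohom e (of_real lam) \<phi>) x = trig1 (\<lambda>s. c * u (s - p)) x"
      by (simp only:)
    also have "\<dots> = c * (q x * trig1 u x)"
      unfolding trig1_cmult trig1_translate[OF u p(1)] q_def ..
    also have "trig1 u x = trig1 \<psi>m x + (- (w^2)) * trig1 \<psi>p x"
      unfolding u_def[abs_def] by (simp only: trig1_add[OF mem(2) ell1_cmult[OF mem(1)] x] trig1_cmult)
    finally have "trig1 (cohom e (of_real lam) \<phi>) x = c * q x * (trig1 \<psi>m x - w^2 * trig1 \<psi>p x)"
      by simp
    moreover have "trig1 (cohom e (of_real lam) \<phi>) x
        = e * trig1 \<phi>p x + inverse e * trig1 \<phi>m x - ?t x * trig1 \<phi> x"
      using trig1_cohom[OF \<phi>(1) h0 h'(2) x, of e "of_real lam",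
          folded \<phi>p_def[abs_def] \<phi>m_def[abs_def]] e(2) V[OF x]
      by (simp add: algebra_simps)
    ultimately show ?thesis by (simp only:)
  qed
  define P where "P k = e * \<phi> k + c * \<psi> (k - p)" for k
  have P: "P \<in> ell1 h'"
    unfolding P_def[abs_def] by (intro ell1_add ell1_cmult \<phi>(1) ell1_shift[OF \<psi>(1) p(1) h0])
  have trigP: "trig1 P x = e * trig1 \<phi> x + c * q x * trig1 \<psi> x" if "x \<in> strip d \<eta> h'" for x
    unfolding P_def[abs_def]
    by (simp only: trig1_add[OF ell1_cmult[OF \<phi>(1)] ell1_cmult[OF ell1_shift[OF \<psi>(1) p(1) h0]] that]
        trig1_cmult trig1_translate[OF \<psi>(1) p(1)] q_def mult.assoc)
  \<comment> \<open>Divided by \<open>W\<close>, this is the determinant of the two columns, in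
    which the half characters cancel.\<close>
  define Wf where "Wf x = inverse e * trig1 \<psi> x * trig1 \<phi>m x
    - trig1 \<psi>m x * (e * trig1 \<phi> x + c * q x * trig1 \<psi> x)" for x
  have Wf_inv: "Wf (shift x) = Wf x" if x: "x \<in> strip d \<eta> h'" for x
  proof -
    have "Wf (shift x) - Wf x = trig1 \<phi> x * (inverse e * trig1 \<psi>p x + e * trig1 \<psi>m x)
        - trig1 \<psi> x * (e * trig1 \<phi>p x + inverse e * trig1 \<phi>m x)
        + c * q x * trig1 \<psi> x * (trig1 \<psi>m x - w^2 * trig1 \<psi>p x)"
      unfolding Wf_def sh q_shift by (simp add: algebra_simps)
    also have "\<dots> = - trig1 \<psi> x * (e * trig1 \<phi>p x + inverse e * trig1 \<phi>m x - ?t x * trig1 \<phi> x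
        - c * q x * (trig1 \<psi>m x - w^2 * trig1 \<psi>p x))"
      unfolding eq\<psi>[OF x] by (simp add: algebra_simps)
    also have "\<dots> = 0" unfolding eq\<phi>[OF x] by simp
    finally show ?thesis by simp
  qed
  have Wf_const: "Wf x = W" if x: "x \<in> strip d \<eta> h'" for x
  proof -
    \<comment> \<open>The coefficients of \<open>Wf\<close>; by invariance only the zero mode is
      left to compute.\<close>
    define S where "S k = inverse e * conv \<psi> \<phi>m k + (- 1) * conv \<psi>m P k" for k
    have c1: "conv \<psi> \<phi>m \<in> ell1 h'" and c2: "conv \<psi>m P \<in> ell1 h'"
      by (intro ell1_conv \<psi>(1) mem P h0)+
    have S: "S \<in> ell1 h'" unfolding S_def[abs_def] by (intro ell1_add ell1_cmult c1 c2)
    have trigS: "trig1 S x = Wf x" if "x \<in> strip d \<eta> h'" for x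
      unfolding S_def[abs_def] Wf_def
      by (simp only: trig1_add[OF ell1_cmult[OF c1] ell1_cmult[OF c2] that] trig1_cmult
          trig1_conv[OF \<psi>(1) mem(4) that] trig1_conv[OF mem(2) P that] trigP[OF that]) simp
    have "trig1 S x = S 0"
      by (rule trig1_invariant_imp_const[OF S h'(1) _ x]) (simp add: trigS Wf_inv shift_in_strip del: One_nat_def)
    also have "S 0 = W"
    proof -
      have \<psi>mp: "\<psi> (0 - p) = (if p = 0 then 1 else 0)"
        using \<psi>(2) \<psi>(3)[of "- p"] f_uminus[OF p(1)] p(2) by auto
      \<comment> \<open>If \<open>\<psi> i \<noteq> 0\<close> and \<open>i \<noteq> 0\<close>, then
        \<open>f (- i) < 0\<close>, outside the support of the other factor. So the zero mode of
        each product is the product of the zero modes.\<close>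
      have neg: "\<psi> i * F (0 - i) = 0"
        if "i \<noteq> 0" "\<And>s. F s \<noteq> 0 \<Longrightarrow> 0 \<le> f s" for i and F :: "(nat \<Rightarrow> int) \<Rightarrow> complex"
      proof (rule ccontr)
        assume "\<psi> i * F (0 - i) \<noteq> 0"
        then have "0 < f i" "0 \<le> f (- i)" "i \<in> ivecs d \<eta>"
          using \<psi>(3)[of i] that ell1_support[OF \<psi>(1)] by auto
        then show False using f_uminus[of i] by simp
      qed
      have "0 \<le> f s" if "\<phi>m s \<noteq> 0" for s
        using that \<phi>(2)[of s] f_zero by (auto simp: \<phi>m_def intro: less_imp_le)
      then have "conv \<psi> \<phi>m 0 = \<psi> 0 * \<phi>m (0 - 0)"
        using neg by (intro conv_single) blast
      then have 1: "conv \<psi> \<phi>m 0 = \<phi> 0" by (simp add: \<psi>(2) \<phi>m_def pairing_zero)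
      have P_pos: "0 \<le> f s" if "P s \<noteq> 0" for s
      proof (cases "\<phi> s = 0")
        case True
        then have nz: "\<psi> (s - p) \<noteq> 0" using that by (auto simp: P_def)
        then have "s - p \<in> ivecs d \<eta>" using ell1_support[OF \<psi>(1)] by blast
        then have "f s = f (s - p) + f p" using f_add[of "s - p" p] p(1) by simp
        then show ?thesis using \<psi>(3)[OF nz] p(2) f_zero by auto
      qed (use \<phi>(2)[of s] f_zero in auto)
      have "conv \<psi>m P 0 = \<psi>m 0 * P (0 - 0)"
      proof (rule conv_single)
        fix i :: "nat \<Rightarrow> int" assume "i \<noteq> 0"
        then have "\<psi> i * P (0 - i) = 0" using neg P_pos by blast
        then show "\<psi>m i * P (0 - i) = 0" by (simp add: \<psi>m_def)
      qed
      then have 2: "conv \<psi>m P 0 = e * \<phi> 0 + c * (if p = 0 then 1 else 0)"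
        using \<psi>mp by (simp add: \<psi>m_def \<psi>(2) pairing_zero P_def)
      show ?thesis by (simp add: S_def W_def 1 2)
    qed
    finally show ?thesis using trigS[OF x] by simp
  qed
  \<comment> \<open>Matching the \<open>\<psi>\<close> terms of
    \<open>b1 x = e * w * b2 (shift x) + \<zeta> * a2 (shift x)\<close> gives
    \<open>\<zeta> = c * W / w\<close>. This is the same value, since \<open>w^2 * e^2 = 1\<close>
    unless \<open>c = 0\<close>.\<close>
  define \<zeta> where "\<zeta> = c * e^2 * w * W"
  have char2: "torus_char 2 p (shift x) = w * torus_char 2 p x"
    "torus_char 2 (- p) (shift x) = inverse w * torus_char 2 (- p) x"
    "torus_char 2 p x * torus_char 2 (- p) x = 1"
    "q x * torus_char 2 (- p) x = torus_char 2 p x" for x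
  proof -
    have "torus_char 2 p (\<lambda>j. complex_of_real (\<alpha> j)) = w"
      by (simp add: torus_char_def pairing_of_real w_def cis_conv_exp)
    then show "torus_char 2 p (shift x) = w * torus_char 2 p x"
      by (simp add: torus_char_vadd[OF \<eta> p(1)])
    have "torus_char 2 (- p) (\<lambda>j. complex_of_real (\<alpha> j)) = inverse w"
      by (simp add: torus_char_def pairing_uminus pairing_of_real w_def cis_conv_exp exp_minus)
    then show "torus_char 2 (- p) (shift x) = inverse w * torus_char 2 (- p) x"
      by (simp add: torus_char_vadd[OF \<eta> ivecs_uminus[OF p(1)]])
    show *: "torus_char 2 p x * torus_char 2 (- p) x = 1"
      by (simp add: torus_char_def pairing_uminus flip: exp_add)
    have "q x = torus_char 2 p x * torus_char 2 p x"
      by (simp add: q_def torus_char_def flip: exp_add)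
    then show "q x * torus_char 2 (- p) x = torus_char 2 p x" using * by simp
  qed
  have c\<psi>: "(\<lambda>k. (inverse e / W) * \<psi> k) \<in> ell1 h'" "(\<lambda>k. (1 / W) * \<psi>m k) \<in> ell1 h'"
    by (intro ell1_cmult \<psi>(1) mem)+
  obtain a1 where a1: "a1 \<in> Comega 2 d \<eta> h'"
    "\<And>x. x \<in> strip d \<eta> h' \<Longrightarrow> a1 x = torus_char 2 p x * trig1 (\<lambda>k. (inverse e / W) * \<psi> k) x"
    using twisted_Comega[OF c\<psi>(1) h'(1) p(1)] by blast
  obtain a2 where a2: "a2 \<in> Comega 2 d \<eta> h'"
    "\<And>x. x \<in> strip d \<eta> h' \<Longrightarrow> a2 x = torus_char 2 p x * trig1 (\<lambda>k. (1 / W) * \<psi>m k) x"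
    using twisted_Comega[OF c\<psi>(2) h'(1) p(1)] by blast
  obtain b1 where b1: "b1 \<in> Comega 2 d \<eta> h'"
    "\<And>x. x \<in> strip d \<eta> h' \<Longrightarrow> b1 x = torus_char 2 (- p) x * trig1 P x"
    using twisted_Comega[OF P h'(1) ivecs_uminus[OF p(1)]] by blast
  obtain b2 where b2: "b2 \<in> Comega 2 d \<eta> h'"
    "\<And>x. x \<in> strip d \<eta> h' \<Longrightarrow> b2 x = torus_char 2 (- p) x * trig1 \<phi>m x"
    using twisted_Comega[OF mem(4) h'(1) ivecs_uminus[OF p(1)]] by blast
  have "reducible d \<eta> \<alpha> (schroedinger E lam V) (mat2 (inverse (e * w)) \<zeta> 0 (e * w))"
  proof (rule reducible_of_columns[OF h'(1) _ a1(1) a2(1) b1(1) b2(1)])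
    show "inverse (e * w) * (e * w) = 1" using ne by (simp add: field_simps)
    fix x assume x: "x \<in> strip d \<eta> h'"
    note xs = shift_in_strip[OF x]
    let ?A0 = "trig1 \<psi> x" and ?Ap = "trig1 \<psi>p x" and ?Am = "trig1 \<psi>m x"
      and ?F0 = "trig1 \<phi> x" and ?Fp = "trig1 \<phi>p x" and ?Fm = "trig1 \<phi>m x"
      and ?c = "torus_char 2 p x" and ?m = "torus_char 2 (- p) x"
    have A: "a1 x = ?c * (inverse e / W * ?A0)" "a2 x = ?c * (1 / W * ?Am)"
      "a1 (shift x) = w * ?c * (inverse e / W * ?Ap)" "a2 (shift x) = w * ?c * (1 / W * ?A0)"
      by (simp_all only: a1(2)[OF x] a2(2)[OF x] a1(2)[OF xs] a2(2)[OF xs] trig1_cmult sh char2)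
    have B: "b1 x = ?m * (e * ?F0 + c * q x * ?A0)" "b2 x = ?m * ?Fm"
      "b1 (shift x) = inverse w * ?m * (e * ?Fp + c * (w^2 * q x) * ?Ap)" "b2 (shift x) = inverse w * ?m * ?F0"
      by (simp_all only: b1(2)[OF x] b2(2)[OF x] b1(2)[OF xs] b2(2)[OF xs] trigP[OF x] trigP[OF xs] sh char2 q_shift)
    have "a1 x * b2 x - b1 x * a2 x = (?c * ?m) * (Wf x / W)"
      unfolding A B Wf_def using W ne by (simp add: field_simps)
    also have "\<dots> = 1" using W by (simp add: char2 Wf_const[OF x])
    finally show "a1 x * b2 x - b1 x * a2 x = 1" .
    have t\<psi>: "?t x * ?A0 = inverse e * ?Ap + e * ?Am" using eq\<psi>[OF x] by simp
    show "?t x * a1 x - a2 x = inverse (e * w) * a1 (shift x) \<and> a1 x = inverse (e * w) * a2 (shift x)"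
    proof
      have "?t x * a1 x - a2 x = ?c / W * (inverse e * (?t x * ?A0) - ?Am)"
        unfolding A using W ne by (simp add: field_simps)
      also have "\<dots> = inverse (e * w) * a1 (shift x)"
        unfolding A t\<psi> using W ne by (simp add: field_simps)
      finally show "?t x * a1 x - a2 x = inverse (e * w) * a1 (shift x)" .
      show "a1 x = inverse (e * w) * a2 (shift x)"
        unfolding A using W ne by (simp add: field_simps)
    qed
    have t\<phi>: "?t x * ?F0 = e * ?Fp + inverse e * ?Fm - c * q x * (?Am - w^2 * ?Ap)"
      using eq\<phi>[OF x] by (simp add: algebra_simps)
    have qc: "?c = q x * ?m" by (simp add: char2)
    have ce: "c * (w^2 * e^2) = c" using p(3) w2 by auto
    show "?t x * b1 x - b2 x = e * w * b1 (shift x) + \<zeta> * a1 (shift x) \<and>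
        b1 x = e * w * b2 (shift x) + \<zeta> * a2 (shift x)"
    proof
      have "?t x * b1 x - b2 x = ?m * (e * (?t x * ?F0) + c * q x * (?t x * ?A0) - ?Fm)"
        unfolding B by (simp add: algebra_simps)
      also have "\<dots> = ?m * (e^2 * ?Fp + e * c * w^2 * q x * ?Ap + inverse e * (c * q x * ?Ap))"
        unfolding t\<phi> t\<psi> using ne by (simp add: field_simps power2_eq_square)
      also have "inverse e * (c * q x * ?Ap) = inverse e * ((c * (w^2 * e^2)) * q x * ?Ap)"
        unfolding ce ..
      also have "?m * (e^2 * ?Fp + e * c * w^2 * q x * ?Ap + inverse e * ((c * (w^2 * e^2)) * q x * ?Ap))
          = e * w * b1 (shift x) + \<zeta> * a1 (shift x)"
        unfolding A B \<zeta>_def qc using ne W by (simp add: field_simps power2_eq_square)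
      finally show "?t x * b1 x - b2 x = e * w * b1 (shift x) + \<zeta> * a1 (shift x)" .
      have "b1 x = ?m * (e * ?F0 + (c * (w^2 * e^2)) * q x * ?A0)"
        unfolding B ce ..
      also have "\<dots> = e * w * b2 (shift x) + \<zeta> * a2 (shift x)"
        unfolding A B \<zeta>_def qc using ne W by (simp add: field_simps power2_eq_square)
      finally show "b1 x = e * w * b2 (shift x) + \<zeta> * a2 (shift x)" .
    qed
  qed
  moreover have "\<zeta> = 0 \<longleftrightarrow> c = 0" using ne W by (simp add: \<zeta>_def)
  ultimately show ?thesis using that w_def by blast
qed

end

section \<open>From the Diophantine conditions to the nonresonant and the resonant case\<close>

lemma DC_freq_torus_rotation:
  assumes "1 \<le> d" "0 < \<eta>" "0 < \<tau>" "\<alpha> \<in> DC_freq d \<eta> \<tau>"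
    and dioph: "0 \<le> a" "0 < \<beta>" "\<beta> < 1"
      "\<And>k. k \<in> ivecs d \<eta> \<Longrightarrow> exp (- (a * kabs d \<eta> k powr \<beta>)) \<le> dioph_weight \<tau> k"
  obtains b where "torus_rotation d \<eta> \<alpha> a b \<beta>"
proof -
  obtain \<gamma> where \<gamma>: "0 < \<gamma>" "\<And>k. k \<in> ivecs_star d \<eta> \<Longrightarrow> \<gamma> * dioph_weight \<tau> k \<le> torus_norm (pairing k \<alpha>)"
    using assms(4) by (auto simp: DC_freq_def DC_freq_const_def)
  \<comment> \<open>The \<open>3\<close> comes from comparing \<open>torus_norm\<close> with the
    chord; \<open>max 0\<close> secures \<open>0 \<le> b\<close>.\<close>
  define b where "b = max 0 (- ln (\<gamma> / 3))"
  have "torus_rotation d \<eta> \<alpha> a b \<beta>"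
  proof
    fix k assume k: "k \<in> ivecs d \<eta>" "k \<noteq> 0"
    have "exp (- b) \<le> exp (ln (\<gamma> / 3))" by (simp add: b_def)
    then have "exp (- b) * exp (- (a * kabs d \<eta> k powr \<beta>)) \<le> \<gamma> / 3 * dioph_weight \<tau> k"
      using \<gamma>(1) dioph(4)[OF k(1)] by (intro mult_mono) auto
    also have "\<dots> \<le> torus_norm (pairing k \<alpha> - 0) / 3"
      using \<gamma>(2)[of k] k assms(2) by (simp add: ivecs_star_iff)
    also have "\<dots> \<le> norm (cis (pairing k \<alpha>) - cis 0)" by (rule torus_norm_le_cis)
    finally show "exp (- (b + a * kabs d \<eta> k powr \<beta>)) \<le> norm (cis (pairing k \<alpha>) - 1)"
      by (simp flip: exp_add)
  qed (use assms in \<open>auto simp: b_def\<close>)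
  then show ?thesis using that by blast
qed

context schroedinger_cone
begin

text \<open>Complex conjugation exchanges \<open>s\<close> and \<open>- s\<close> and preserves
  \<open>kabs\<close>.\<close>

lemma nonresonant_cis_uminus:
  assumes "nonresonant (cis x)"
  shows "nonresonant (cis (- x))"
proof -
  obtain \<kappa> where \<kappa>: "0 < \<kappa>" "\<And>s. s \<in> ivecs d \<eta> \<Longrightarrow> cis (pairing s \<alpha>) \<noteq> cis x \<Longrightarrow>
      \<kappa> * exp (- (\<epsilon> * kabs d \<eta> s)) \<le> norm (cis (pairing s \<alpha>) - cis x)"
    using assms unfolding nonresonant_def by blast
  have "\<kappa> * exp (- (\<epsilon> * kabs d \<eta> s)) \<le> norm (cis (pairing s \<alpha>) - cis (- x))"
    if s: "s \<in> ivecs d \<eta>" "cis (pairing s \<alpha>) \<noteq> cis (- x)" for s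
  proof -
    have eq: "cis (pairing s \<alpha>) - cis (- x) = cnj (cis (pairing (- s) \<alpha>) - cis x)"
      by (simp add: pairing_uminus cis_cnj)
    then have "cis (pairing (- s) \<alpha>) \<noteq> cis x" using s(2) by auto
    then show ?thesis
      using \<kappa>(2)[OF ivecs_uminus[OF s(1)]] unfolding eq complex_mod_cnj by (simp add: kabs_uminus)
  qed
  then show ?thesis using \<kappa>(1) unfolding nonresonant_def by blast
qed

lemma nonresonant_cis:
  assumes "0 < \<kappa>" and DC: "\<And>k. k \<in> ivecs_star d \<eta> \<Longrightarrow> \<kappa> * dioph_weight \<tau> k \<le> torus_norm (x - pairing k \<alpha>)"
    and dioph: "\<And>k. k \<in> ivecs d \<eta> \<Longrightarrow> exp (- (a * kabs d \<eta> k powr \<beta>)) \<le> dioph_weight \<tau> k"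
  shows "nonresonant (cis x)"
proof -
  \<comment> \<open>The Diophantine condition excludes \<open>k = 0\<close>; \<open>\<mu>\<close>
    covers the mode \<open>s = 0\<close>. If \<open>cis x = 1\<close> that mode is exempt and any
    positive value will do.\<close>
  define \<mu> where "\<mu> = (if cis x = 1 then 1 else norm (1 - cis x))"
  define \<kappa>' where "\<kappa>' = min \<mu> (\<kappa> / 3 * exp (- C))"
  have \<mu>: "0 < \<mu>" by (simp add: \<mu>_def)
  have "\<kappa>' * exp (- (\<epsilon> * kabs d \<eta> s)) \<le> norm (cis (pairing s \<alpha>) - cis x)"
    if s: "s \<in> ivecs d \<eta>" "cis (pairing s \<alpha>) \<noteq> cis x" for s
  proof (cases "s = 0")
    case True
    then show ?thesis using s(2) by (auto simp: \<kappa>'_def \<mu>_def pairing_zero kabs_zero)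
  next
    case False
    have "a * kabs d \<eta> s powr \<beta> \<le> \<epsilon> * kabs d \<eta> s + C"
    proof -
      have "0 \<le> ln (2::real)" by simp
      moreover have "ln 2 + b + a * kabs d \<eta> s powr \<beta> \<le> \<epsilon> * kabs d \<eta> s + C"
        using gap_bound[of "kabs d \<eta> s" 1] kabs_nonneg[of d \<eta> s] by simp
      ultimately show ?thesis using ab_nonneg by linarith
    qed
    then have "exp (- C) * exp (- (\<epsilon> * kabs d \<eta> s)) \<le> exp (- (a * kabs d \<eta> s powr \<beta>))"
      by (simp flip: exp_add)
    also have "\<dots> \<le> dioph_weight \<tau> s" by (rule dioph[OF s(1)])
    finally have "\<kappa> / 3 * (exp (- C) * exp (- (\<epsilon> * kabs d \<eta> s))) \<le> \<kappa> / 3 * dioph_weight \<tau> s"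
      using assms(1) by (intro mult_left_mono) auto
    also have "\<dots> \<le> torus_norm (x - pairing s \<alpha>) / 3"
      using DC[of s] False s(1) \<eta> by (simp add: ivecs_star_iff)
    also have "\<dots> \<le> norm (cis (pairing s \<alpha>) - cis x)"
      using torus_norm_le_cis[of x "pairing s \<alpha>"] by (simp add: norm_minus_commute)
    finally have "\<kappa> / 3 * exp (- C) * exp (- (\<epsilon> * kabs d \<eta> s)) \<le> norm (cis (pairing s \<alpha>) - cis x)"
      by (simp add: mult.assoc)
    moreover have "\<kappa>' * exp (- (\<epsilon> * kabs d \<eta> s)) \<le> \<kappa> / 3 * exp (- C) * exp (- (\<epsilon> * kabs d \<eta> s))"
      unfolding \<kappa>'_def by (intro mult_right_mono) auto
    ultimately show ?thesis by linarith
  qed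
  moreover have "0 < \<kappa>'" using \<mu> assms(1) by (simp add: \<kappa>'_def)
  ultimately show ?thesis unfolding nonresonant_def by blast
qed

lemma reducible_nonresonant:
  assumes small: "\<bar>lam\<bar> * exp (2 * C) * (\<Sum>\<^sub>\<infinity>m. norm (v m) * exp (h * kabs d \<eta> m)) < 1"
    and V: "\<And>x. x \<in> strip d \<eta> (h - 8 * \<epsilon>) \<Longrightarrow> V x = trig1 v x"
    and h: "8 * \<epsilon> < h" and \<rho>: "sin \<rho> \<noteq> 0"
    and \<kappa>: "0 < \<kappa>" "\<And>k. k \<in> ivecs_star d \<eta> \<Longrightarrow> \<kappa> * dioph_weight \<tau> k < torus_norm (2 * \<rho> - pairing k \<alpha>)"
    and dioph: "\<And>k. k \<in> ivecs d \<eta> \<Longrightarrow> exp (- (a * kabs d \<eta> k powr \<beta>)) \<le> dioph_weight \<tau> k"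
  shows "reducible d \<eta> \<alpha> (schroedinger (2 * cos \<rho>) lam V) (mat2 (cis \<rho>) 0 0 (cis (- \<rho>)))"
proof -
  \<comment> \<open>With this sign \<open>inverse ?e = cis \<rho>\<close> becomes the upper left
    entry.\<close>
  let ?e = "cis (- \<rho>)"
  have e2: "?e^2 = cis (- (2 * \<rho>))" "inverse (?e^2) = cis (2 * \<rho>)"
    by (simp_all add: power2_eq_square cis_mult)
  have e2_ne: "?e^2 \<noteq> 1"
  proof
    assume "?e^2 = 1"
    then have "(?e - 1) * (?e + 1) = 0" by (simp add: algebra_simps power2_eq_square)
    then have "?e = 1 \<or> ?e = - 1" by (auto simp: eq_neg_iff_add_eq_0)
    then show False using \<rho> by (auto simp: complex_eq_iff)
  qed
  have "nonresonant (cis (2 * \<rho>))"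
    by (rule nonresonant_cis[OF \<kappa>(1) less_imp_le[OF \<kappa>(2)] dioph])
  note res = this[folded e2(2)] and res' = nonresonant_cis_uminus[OF this, folded e2(1)]
  have ne: "cis (pairing s \<alpha>) \<noteq> ?e^2" if s: "s \<in> ivecs d \<eta>" "s \<noteq> 0" for s
  proof
    assume "cis (pairing s \<alpha>) = ?e^2"
    then have "cis (pairing (- s) \<alpha>) = cis (2 * \<rho>)"
      unfolding e2 by (metis cis_cnj complex_cnj_cnj pairing_uminus)
    then have "torus_norm (2 * \<rho> - pairing (- s) \<alpha>) \<le> 0"
      using torus_norm_le_cis[of "2 * \<rho>" "pairing (- s) \<alpha>"] by simp
    moreover have "- s \<in> ivecs_star d \<eta>" using s \<eta> by (simp add: ivecs_star_iff ivecs_uminus)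
    moreover have "0 \<le> \<kappa> * dioph_weight \<tau> (- s)"
      using \<kappa>(1) order_trans[OF exp_ge_zero dioph[OF ivecs_uminus[OF s(1)]]] by simp
    ultimately show False using \<kappa>(2)[of "- s"] by linarith
  qed
  have small': "norm (complex_of_real lam) * exp (2 * C) * (\<Sum>\<^sub>\<infinity>m. norm (v m) * exp (h * kabs d \<eta> m)) < 1"
    using small by simp
  have "norm ?e = 1" by simp
  then obtain \<psi> \<phi> where sol: "\<psi> \<in> ell1 (h - 8 * \<epsilon>)" "\<phi> \<in> ell1 (h - 8 * \<epsilon>)"
    "\<psi> 0 = 1" "\<And>s. \<psi> s \<noteq> 0 \<Longrightarrow> s = 0 \<or> 0 < f s" "\<And>s. \<phi> s \<noteq> 0 \<Longrightarrow> s = 0 \<or> 0 < f s"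
    "\<And>s. cohom (inverse ?e) (of_real lam) \<psi> s = 0" "\<And>s. cohom ?e (of_real lam) \<phi> s = 0"
    "inverse ?e * \<phi> 0 - ?e * \<phi> 0 \<noteq> 0"
    by (rule nonresonant_pair[OF _ e2_ne res res' ne small']) blast+
  have E: "?e + inverse ?e = of_real (2 * cos \<rho>)" by (simp add: complex_eq_iff)
  have h': "0 < h - 8 * \<epsilon>" "h - 8 * \<epsilon> \<le> h" using h eps by auto
  \<comment> \<open>No twist and no source: \<open>p = 0\<close> and \<open>c = 0\<close>, hence
    \<open>\<zeta> = 0\<close>.\<close>
  obtain \<zeta> where "\<zeta> = 0 \<longleftrightarrow> (0::complex) = 0" "reducible d \<eta> \<alpha> (schroedinger (2 * cos \<rho>) lam V)
      (mat2 (inverse (?e * cis (pairing 0 \<alpha> / 2))) \<zeta> 0 (?e * cis (pairing 0 \<alpha> / 2)))"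
    by (rule reducible_of_pair[of ?e "2 * cos \<rho>" 0 0 "h - 8 * \<epsilon>" V \<psi> \<phi> lam])
       (use sol E h' V f_zero K_zero in auto)
  then show ?thesis by (simp add: pairing_zero)
qed

text \<open>The resonance is moved to the side \<open>0 \<le> f p\<close> by taking
  \<open>p = k\<close>, \<open>\<theta> = - \<rho>\<close> or \<open>p = - k\<close>,
  \<open>\<theta> = \<rho>\<close>. Both choices have the same cosine, and the double eigenvalue is
  \<open>cis (- (pi * n))\<close> or \<open>cis (pi * n)\<close>, in either case
  \<open>res_sign n\<close>.\<close>

lemma reducible_resonant:
  assumes small: "\<bar>lam\<bar> * exp (2 * C) * (\<Sum>\<^sub>\<infinity>m. norm (v m) * exp (h * kabs d \<eta> m)) < 1"
    and V: "\<And>x. x \<in> strip d \<eta> (h - 8 * \<epsilon>) \<Longrightarrow> V x = trig1 v x"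
    and h: "8 * \<epsilon> < h"
    and k: "k \<in> ivecs d \<eta>" "2 * \<rho> = pairing k \<alpha> + 2 * pi * of_int n"
  obtains \<zeta> where "reducible d \<eta> \<alpha> (schroedinger (2 * cos \<rho>) lam V) (mat2 (res_sign n) \<zeta> 0 (res_sign n))"
proof -
  note result = that
  have small': "norm (complex_of_real lam) * exp (2 * C) * (\<Sum>\<^sub>\<infinity>m. norm (v m) * exp (h * kabs d \<eta> m)) < 1"
    using small by simp
  have h': "0 < h - 8 * \<epsilon>" "h - 8 * \<epsilon> \<le> h" using h eps by auto
  have cis_n: "cis (pi * of_int n) = res_sign n" "cis (- (pi * of_int n)) = res_sign n"
    by (auto simp: complex_eq_iff res_sign_def cos_npi_int sin_npi_int)
  have sign: "inverse (res_sign n) = res_sign n" by (simp add: res_sign_def)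
  have main: thesis
    if \<theta>: "2 * \<theta> = - pairing p \<alpha> + 2 * pi * of_int l" "cos \<theta> = cos \<rho>"
      "cis (\<theta> + pairing p \<alpha> / 2) = res_sign n" and p: "p \<in> ivecs d \<eta>" "0 \<le> f p" for \<theta> p l
  proof -
    let ?e = "cis \<theta>"
    have e2: "?e^2 = cis (2 * \<theta>)" by (simp add: power2_eq_square cis_mult)
    also have "\<dots> = cis (- pairing p \<alpha>) * cis (2 * pi * of_int l)"
      unfolding \<theta>(1) cis_mult ..
    also have "\<dots> = cis (- pairing p \<alpha>)" by (simp add: cis_multiple_2pi)
    finally have e2: "?e^2 = cis (- pairing p \<alpha>)" .
    have zp: "cis (pairing p \<alpha>) = inverse (?e^2)" unfolding e2 by simp
    have "norm ?e = 1" by simp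
    then obtain \<psi> \<phi> c where sol: "\<psi> \<in> ell1 (h - 8 * \<epsilon>)" "\<phi> \<in> ell1 (h - 8 * \<epsilon>)"
      "\<psi> 0 = 1" "\<And>s. \<psi> s \<noteq> 0 \<Longrightarrow> s = 0 \<or> 0 < f s" "\<And>s. \<phi> s \<noteq> 0 \<Longrightarrow> s = 0 \<or> 0 < f s"
      "\<And>s. cohom (inverse ?e) (of_real lam) \<psi> s = 0"
      "\<And>s. cohom ?e (of_real lam) \<phi> s
        = c * ((cis (pairing p \<alpha>) / cis (pairing s \<alpha>) - cis (pairing s \<alpha>)) * \<psi> (s - p))"
      "inverse ?e * \<phi> 0 - ?e * \<phi> 0 - c * (if p = 0 then 1 else 0) \<noteq> 0"
      by (rule resonant_pair[OF _ p zp small']) blast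
    have E: "?e + inverse ?e = of_real (2 * cos \<rho>)" using \<theta>(2) by (simp add: complex_eq_iff)
    have ze: "c = 0 \<or> cis (pairing p \<alpha>) * ?e^2 = 1" unfolding e2 by (simp add: cis_mult)
    have eq: "?e * cis (pairing p \<alpha> / 2) = res_sign n" using \<theta>(3) by (simp add: cis_mult)
    show thesis
      by (rule reducible_of_pair[OF \<open>norm ?e = 1\<close> E p ze h' V sol(1,3,4,2,5-8)])
         (auto simp: eq sign intro: result)
  qed
  show thesis
  proof (cases "0 \<le> f k")
    case True
    have "- \<rho> + pairing k \<alpha> / 2 = - (pi * of_int n)" using k(2) by (simp add: field_simps)
    then have "cis (- \<rho> + pairing k \<alpha> / 2) = res_sign n" by (simp only: cis_n)
    from main[OF _ _ this k(1) True, of "- n"] k(2) show thesis by simp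
  next
    case False
    have "\<rho> + pairing (- k) \<alpha> / 2 = pi * of_int n" using k(2) by (simp add: pairing_uminus field_simps)
    then have "cis (\<rho> + pairing (- k) \<alpha> / 2) = res_sign n" by (simp only: cis_n)
    moreover have "0 \<le> f (- k)" using False f_uminus[OF k(1)] by simp
    ultimately show thesis
      using main[of \<rho> "- k" n] k(2) ivecs_uminus[OF k(1)] by (simp add: pairing_uminus)
  qed
qed

end

theorem theorem1p5:
  fixes d :: enat and \<eta> h r \<tau> M :: real and \<alpha> :: "nat \<Rightarrow> real"
  assumes "1 \<le> d" and "0 < \<eta>" and "0 < h" and "0 < r" and "r \<le> 1" and "1 < \<tau>"
    and "\<alpha> \<in> DC_freq d \<eta> \<tau>"
  shows "\<exists>lam0>0. \<forall>(w :: nat \<Rightarrow> real) (v :: (nat \<Rightarrow> complex) \<Rightarrow> complex).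
    (\<forall>j\<in>coords d. 0 < w j) \<and> (w has_sum 1) (coords d) \<and>
    v \<in> Comega 1 d \<eta> h \<and> fnorm 1 d \<eta> h v = M \<and>
    (\<forall>x\<in>strip d \<eta> h.
       ((\<lambda>k. fourier 1 d v k * torus_char 1 k x) has_sum v x) (int_cone d \<eta> w r))
    \<longrightarrow> (\<forall>lam::real. \<bar>lam\<bar> < lam0 \<longrightarrow> (\<forall>E\<in>{-2..2}.
          (\<bar>E\<bar> < 2 \<and> rho E \<in> DC_rot d \<eta> \<tau> \<alpha> \<longrightarrow>
             reducible d \<eta> \<alpha> (schroedinger E lam v)
               (mat2 (exp (\<i> * of_real (rho E))) 0 0 (exp (- \<i> * of_real (rho E))))) \<and>
          (\<forall>k n. (k \<in> ivecs_star d \<eta> \<or> \<bar>E\<bar> = 2 \<and> k = (\<lambda>_. 0)) \<and>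
                 2 * rho E = pairing k \<alpha> + 2 * pi * of_int n \<longrightarrow>
             reducible d \<eta> \<alpha> (schroedinger E lam v) (mat2 (res_sign n) 0 0 (res_sign n)) \<or>
             (\<exists>\<zeta>. \<zeta> \<noteq> 0 \<and>
               reducible d \<eta> \<alpha> (schroedinger E lam v) (mat2 (res_sign n) \<zeta> 0 (res_sign n))))))"
proof -
  have \<eta>: "0 \<le> \<eta>" and \<tau>: "0 < \<tau>" using assms by auto
  obtain a \<beta> where dioph: "0 \<le> a" "0 < \<beta>" "\<beta> < 1"
    "\<And>d k. k \<in> ivecs d \<eta> \<Longrightarrow> exp (- (a * kabs d \<eta> k powr \<beta>)) \<le> dioph_weight \<tau> k"
    using dioph_weight_ge[OF assms(2) \<tau>] by blast
  obtain b where "torus_rotation d \<eta> \<alpha> a b \<beta>"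
    using DC_freq_torus_rotation[OF assms(1,2) \<tau> assms(7) dioph] by blast
  then interpret torus_rotation d \<eta> \<alpha> a b \<beta> .
  \<comment> \<open>The total loss \<open>8 * \<epsilon>\<close> is \<open>h / 2\<close>, so the
    conjugation is analytic on half the strip.\<close>
  define \<epsilon> where "\<epsilon> = h / 16"
  have width: "0 < \<epsilon>" "8 * \<epsilon> < h" using assms(3) by (auto simp: \<epsilon>_def)
  obtain C where C: "0 \<le> C"
    "\<And>L n. 0 \<le> L \<Longrightarrow> (\<Sum>j=1..n. ln 2 + b + a * (L / real j) powr \<beta>) \<le> \<epsilon> * L + C * real n"
    using sum_gap_bound[OF ab_nonneg \<beta> width(1)] by blast
  \<comment> \<open>Makes the ratio of the geometric series less than \<open>1\<close>; it is fixed
    before \<open>w\<close>, \<open>v\<close> and \<open>E\<close>. The summand \<open>1\<close>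
    keeps the denominator positive.\<close>
  define lam0 where "lam0 = 1 / (exp (2 * C) * (\<bar>M\<bar> + 1))"
  have lam0: "0 < lam0" by (simp add: lam0_def add_nonneg_pos)
  have key: "(\<bar>E\<bar> < 2 \<and> rho E \<in> DC_rot d \<eta> \<tau> \<alpha> \<longrightarrow>
             reducible d \<eta> \<alpha> (schroedinger E lam v)
               (mat2 (exp (\<i> * of_real (rho E))) 0 0 (exp (- \<i> * of_real (rho E))))) \<and>
          (\<forall>k n. (k \<in> ivecs_star d \<eta> \<or> \<bar>E\<bar> = 2 \<and> k = (\<lambda>_. 0)) \<and>
                 2 * rho E = pairing k \<alpha> + 2 * pi * of_int n \<longrightarrow>
             reducible d \<eta> \<alpha> (schroedinger E lam v) (mat2 (res_sign n) 0 0 (res_sign n)) \<or>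
             (\<exists>\<zeta>. \<zeta> \<noteq> 0 \<and>
               reducible d \<eta> \<alpha> (schroedinger E lam v) (mat2 (res_sign n) \<zeta> 0 (res_sign n))))"
    if v: "v \<in> Comega 1 d \<eta> h" "fnorm 1 d \<eta> h v = M"
      "\<forall>x\<in>strip d \<eta> h. ((\<lambda>k. fourier 1 d v k * torus_char 1 k x) has_sum v x) (int_cone d \<eta> w r)"
      and lam: "\<bar>lam\<bar> < lam0" and E: "E \<in> {-2..2}"
    for w v lam E
  proof -
    define f where "f k = pairing k (\<lambda>j. jb j powr \<eta> * w j)" for k
    \<comment> \<open>Cutting the coefficients off outside the cone makes \<open>f\<close> positive
      on their support by construction; the series over the cone still represents
      \<open>v\<close>.\<close>
    define v0 where "v0 k = (if k \<in> int_cone d \<eta> w r then fourier 1 d v k else 0)" for k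
    let ?W = "\<lambda>k. norm (fourier 1 d v k) * exp (h * kabs d \<eta> k)"
    have cone: "int_cone d \<eta> w r \<subseteq> ivecs d \<eta>" by (auto simp: int_cone_def ivecs_star_def)
    have pos: "0 < f k" if "k \<in> int_cone d \<eta> w r" for k
    proof -
      have "0 < r * kabs d \<eta> k" using that assms(4) by (simp add: int_cone_def ivecs_star_def)
      also have "\<dots> \<le> f k" using that by (simp add: int_cone_def f_def pairing_def mult_ac)
      finally show ?thesis .
    qed
    have W: "?W summable_on ivecs d \<eta>" "infsum ?W (ivecs d \<eta>) = M"
      using v(1,2) by (simp_all add: Comega_def fnorm_def fnorm_term_def[abs_def])
    have Wc: "?W summable_on int_cone d \<eta> w r" by (rule summable_on_subset[OF W(1) cone])
    have "(\<lambda>k. norm (v0 k) * exp (h * kabs d \<eta> k)) summable_on UNIV \<longleftrightarrow> ?W summable_on int_cone d \<eta> w r"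
      by (rule summable_on_cong_neutral) (auto simp: v0_def)
    with Wc have v0: "v0 \<in> ell1 h" using cone by (auto simp: ell1_def v0_def)
    have "(\<Sum>\<^sub>\<infinity>k. norm (v0 k) * exp (h * kabs d \<eta> k)) = infsum ?W (int_cone d \<eta> w r)"
      by (rule infsum_cong_neutral) (auto simp: v0_def)
    also have "\<dots> \<le> infsum ?W (ivecs d \<eta>)" by (rule infsum_mono2[OF Wc W(1) cone]) simp
    finally have v0_le: "(\<Sum>\<^sub>\<infinity>k. norm (v0 k) * exp (h * kabs d \<eta> k)) \<le> \<bar>M\<bar>" using W(2) by simp
    have V: "v x = trig1 v0 x" if x: "x \<in> strip d \<eta> h" for x
    proof -
      have "((\<lambda>k. v0 k * torus_char 1 k x) has_sum v x) UNIV \<longleftrightarrow>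
          ((\<lambda>k. fourier 1 d v k * torus_char 1 k x) has_sum v x) (int_cone d \<eta> w r)"
        by (rule has_sum_cong_neutral) (auto simp: v0_def)
      then show ?thesis using v(3) x unfolding trig_def by (simp add: infsumI)
    qed
    interpret schroedinger_cone d \<eta> \<alpha> a b \<beta> f v0 h \<epsilon> C
    proof
      show "f (x + y) = f x + f y" if "x \<in> ivecs d \<eta>" "y \<in> ivecs d \<eta>" for x y
        unfolding f_def by (rule pairing_add[OF \<eta> that])
    qed (use v0 width C pos in \<open>auto simp: v0_def split: if_splits\<close>)
    have "\<bar>lam\<bar> * exp (2 * C) * (\<Sum>\<^sub>\<infinity>k. norm (v0 k) * exp (h * kabs d \<eta> k)) \<le> \<bar>lam\<bar> * exp (2 * C) * (\<bar>M\<bar> + 1)"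
      using v0_le by (intro mult_left_mono) auto
    also have "\<dots> < lam0 * exp (2 * C) * (\<bar>M\<bar> + 1)"
      using lam by (intro mult_strict_right_mono) auto
    also have "\<dots> = 1" by (simp add: lam0_def)
    finally have small: "\<bar>lam\<bar> * exp (2 * C) * (\<Sum>\<^sub>\<infinity>k. norm (v0 k) * exp (h * kabs d \<eta> k)) < 1" .
    have "strip d \<eta> (h - 8 * \<epsilon>) \<subseteq> strip d \<eta> h"
    proof
      fix x assume x: "x \<in> strip d \<eta> (h - 8 * \<epsilon>)"
      have "(h - 8 * \<epsilon>) * jb j powr \<eta> \<le> h * jb j powr \<eta>" for j
        using width by (intro mult_right_mono) auto
      then show "x \<in> strip d \<eta> h" using x by (auto simp: strip_def intro: less_le_trans)
    qed
    then have V': "v x = trig1 v0 x" if "x \<in> strip d \<eta> (h - 8 * \<epsilon>)" for x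
      using V that by blast
    define \<rho> where "\<rho> = rho E"
    have E\<rho>: "E = 2 * cos \<rho>" using E by (simp add: \<rho>_def rho_def)
    have 1: "reducible d \<eta> \<alpha> (schroedinger E lam v)
        (mat2 (exp (\<i> * of_real \<rho>)) 0 0 (exp (- \<i> * of_real \<rho>)))"
      if nres: "\<bar>E\<bar> < 2" "\<rho> \<in> DC_rot d \<eta> \<tau> \<alpha>"
    proof -
      obtain \<kappa> where \<kappa>: "0 < \<kappa>"
        "\<And>k. k \<in> ivecs_star d \<eta> \<Longrightarrow> \<kappa> * dioph_weight \<tau> k < torus_norm (2 * \<rho> - pairing k \<alpha>)"
        using nres(2) by (auto simp: DC_rot_def DC_rot_const_def)
      \<comment> \<open>Excludes \<open>e^2 = 1\<close>, where the two Floquet solutions would have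
        zero Wronskian.\<close>
      have "sin \<rho> \<noteq> 0"
      proof
        assume "sin \<rho> = 0"
        then have "(cos \<rho>)^2 = 1" by (simp add: cos_squared_eq)
        then show False using nres(1) by (auto simp: E\<rho> power2_eq_1_iff)
      qed
      then have "reducible d \<eta> \<alpha> (schroedinger (2 * cos \<rho>) lam v) (mat2 (cis \<rho>) 0 0 (cis (- \<rho>)))"
        using small V' width(2) \<kappa> dioph(4) by (intro reducible_nonresonant[where \<kappa> = \<kappa> and \<tau> = \<tau>])
      then show ?thesis by (simp add: E\<rho> cis_conv_exp)
    qed
    have 2: "reducible d \<eta> \<alpha> (schroedinger E lam v) (mat2 (res_sign n) 0 0 (res_sign n)) \<or>
        (\<exists>\<zeta>. \<zeta> \<noteq> 0 \<and> reducible d \<eta> \<alpha> (schroedinger E lam v) (mat2 (res_sign n) \<zeta> 0 (res_sign n)))"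
      if k: "k \<in> ivecs_star d \<eta> \<or> \<bar>E\<bar> = 2 \<and> k = (\<lambda>_. 0)" and n: "2 * \<rho> = pairing k \<alpha> + 2 * pi * of_int n" for k n
    proof -
      have "k \<in> ivecs d \<eta>"
        using k ivecs_zero[of d \<eta>] by (auto simp: ivecs_star_def zero_fun_def)
      then obtain \<zeta> where "reducible d \<eta> \<alpha> (schroedinger E lam v) (mat2 (res_sign n) \<zeta> 0 (res_sign n))"
        unfolding E\<rho> using reducible_resonant[OF small V' width(2) _ n] by blast
      then show ?thesis by (cases "\<zeta> = 0") auto
    qed
    show ?thesis using 1 2 unfolding \<rho>_def by blast
  qed
  show ?thesis
    by (intro exI[of _ lam0] conjI[OF lam0] allI impI ballI) (use key in blast)
qed

end
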